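(* Let $P(z),q(z)\in\mathbb{C}[z]$ with $P$ non-constant and $q\neq 0$, and let $a,b\in\mathbb{C}$, $a\neq b$, be such that $\int_a^b P^i(z)q(z)\,dz=0$ for all integers $i\ge 0$. Let $Q(z)=\int q(z)\,dz$. Let $\tilde\lambda_P$ be an extended cactus corresponding to $P,a,b$, with non-white colors $1,\dots,\tilde k$, and let $\Gamma_{a,b}$ be the path joining $a$ and $b$ in $\tilde\lambda_P$. Suppose that there exists $s$, $1\le s\le\tilde k$, such that the weight $w(s)$ of the $s$-th color on $\Gamma_{a,b}$ equals $1$. Then $P$ and $Q$ have a common right divisor in the composition algebra of polynomials, i.e. there exist polynomials $\tilde P,\tilde Q,W\in\mathbb{C}[z]$ with $\deg W>1$ such that $P(z)=\tilde P(W(z))$ and $Q(z)=\tilde Q(W(z))$.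
   Context: Extended cactus. Let $c_1,\dots,c_{\tilde k}$ be the distinct points consisting of all finite critical values of $P$ together with $P(a)$ and $P(b)$. Choose a point $c\in\mathbb{C}\setminus\{c_1,\dots,c_{\tilde k}\}$ and a star $S$: a union of simple arcs $\gamma_1,\dots,\gamma_{\tilde k}$, where $\gamma_s$ joins $c$ to $c_s$, the arcs pairwise meeting only at $c$. The extended cactus is $\tilde\lambda_P=P^{-1}(S)$, viewed as a plane graph: its vertices are the points of $P^{-1}(c)$ (called white) and the points of $P^{-1}(c_s)$ (said to have color $s$), and its edges are the preimages of the arcs $\gamma_s$. This graph is a tree, and $a,b$ are non-white vertices of it. $\Gamma_{a,b}\subset\tilde\lambda_P$ is the unique simple path in the tree from $a$ to $b$. Weight. For $1\le s\le\tilde k$, $w(s)$ is the number of vertices of color $s$ lying on $\Gamma_{a,b}$, where the end vertices $a$ and $b$ are each counted with coefficient $1/2$. *)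

theory Defs
  imports
    "HOL-Complex_Analysis.Complex_Analysis"
    "HOL-Computational_Algebra.Polynomial"
    "Graph_Theory.Arc_Walk"
begin

definition critical_values :: "complex poly \<Rightarrow> complex set" where
  "critical_values P = poly P ` {z. poly (pderiv P) z = 0}"

definition marked_values :: "complex poly \<Rightarrow> complex \<Rightarrow> complex \<Rightarrow> complex set" where
  "marked_values P a b = critical_values P \<union> {poly P a, poly P b}"

definition is_star :: "complex \<Rightarrow> nat \<Rightarrow> (nat \<Rightarrow> complex) \<Rightarrow> (nat \<Rightarrow> real \<Rightarrow> complex) \<Rightarrow> bool" where
  "is_star c k cs \<gamma> \<longleftrightarrow>
     c \<notin> cs ` {1..k} \<and>
     (\<forall>s\<in>{1..k}. arc (\<gamma> s) \<and> pathstart (\<gamma> s) = c \<and> pathfinish (\<gamma> s) = cs s) \<and>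
     (\<forall>s\<in>{1..k}. \<forall>t\<in>{1..k}. s \<noteq> t \<longrightarrow> path_image (\<gamma> s) \<inter> path_image (\<gamma> t) = {c})"

text \<open>
  The edges of color \<open>s\<close> are the individual preimages of the arc \<open>\<gamma> s\<close>, that is, the images
  of the lifts of \<open>\<gamma> s\<close> through \<open>P\<close> over the whole of \<open>[0,1]\<close>, endpoints included. A lift starts
  at a white vertex and ends at a vertex of color \<open>s\<close>.
\<close>

definition lift_of :: "complex poly \<Rightarrow> (real \<Rightarrow> complex) \<Rightarrow> (real \<Rightarrow> complex) \<Rightarrow> bool" where
  "lift_of P \<gamma> \<eta> \<longleftrightarrow> path \<eta> \<and> (\<forall>t\<in>{0..1}. poly P (\<eta> t) = \<gamma> t)"

text \<open>
  The cactus is an undirected plane graph. As the graph library is one of digraphs, every edge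
  \<open>e\<close> (a set of points of the plane) with ends \<open>u\<close>, \<open>v\<close> is represented by the two arcs
  \<open>(u, e, v)\<close> and \<open>(v, e, u)\<close>.
\<close>

definition extended_cactus ::
  "complex poly \<Rightarrow> complex \<Rightarrow> nat \<Rightarrow> (nat \<Rightarrow> complex) \<Rightarrow> (nat \<Rightarrow> real \<Rightarrow> complex)
     \<Rightarrow> (complex, complex \<times> complex set \<times> complex) pre_digraph" where
  "extended_cactus P c k cs \<gamma> =
     \<lparr> verts = {z. poly P z = c \<or> (\<exists>s\<in>{1..k}. poly P z = cs s)},
       arcs = {(u, e, v). \<exists>s\<in>{1..k}. \<exists>\<eta>. lift_of P (\<gamma> s) \<eta> \<and> e = path_image \<eta> \<and>
                 ((u = pathstart \<eta> \<and> v = pathfinish \<eta>) \<or>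
                  (u = pathfinish \<eta> \<and> v = pathstart \<eta>))},
       tail = (\<lambda>(u, e, v). u),
       head = (\<lambda>(u, e, v). v) \<rparr>"

text \<open>
  \<open>V\<close> is the set of vertices of a path with end vertices \<open>a\<close>, \<open>b\<close>; a vertex \<open>z\<close> has
  color \<open>s\<close> if \<open>P z = cs s\<close>.
\<close>

definition color_weight ::
  "complex poly \<Rightarrow> (nat \<Rightarrow> complex) \<Rightarrow> complex \<Rightarrow> complex \<Rightarrow> complex set \<Rightarrow> nat \<Rightarrow> real" where
  "color_weight P cs a b V s =
     (\<Sum>z\<in>{z\<in>V. poly P z = cs s}. if z = a \<or> z = b then 1/2 else 1)"

end

theory Submission
  imports Defs "HOL-Computational_Algebra.Fundamental_Theorem_Algebra"
begin

text \<open>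
  Over the complement \<open>U\<close> of the star the polynomial \<open>P\<close> is an unramified covering, and the vanishing
  of the moments says that \<open>\<integral>\<^sub>\<Gamma> q / (P - t)\<close> vanishes for large \<open>t\<close>. By partial fractions this reads
  \<open>(\<Sum>P y = t. q y / P' y * l y) = R t\<close> with a polynomial \<open>R\<close>, where \<open>l\<close> is a logarithm of
  \<open>(z - b) / (z - a)\<close> off \<open>\<Gamma>\<close>; the left-hand side is holomorphic on the connected set \<open>U\<close>, so that the
  identity holds on \<open>U\<close>. Across an interior point of the arc \<open>\<gamma> s\<close> only those sheets whose lifts of
  \<open>\<gamma> s\<close> lie on \<open>\<Gamma>\<close> contribute a jump. If the weight of the colour \<open>s\<close> is 1, these are exactly two
  sheets, and the jumps of \<open>l\<close> on them are opposite and nonzero, since \<open>\<Gamma>\<close> can be split at a vertex into two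
  halves that contain one lift each. Hence \<open>q / P'\<close> takes the same values on two different sheets.

  The points at which the germs of \<open>q / P'\<close> agree as functions of the value of \<open>P\<close> then form classes of a
  constant size \<open>d \<ge> 2\<close>. The product of \<open>\<beta> - y\<close> over the class of \<open>z\<close> is a
  polynomial \<open>W\<close> in \<open>z\<close> of degree \<open>d\<close> whose generic fibres are the classes, and \<open>P\<close> and \<open>Q\<close> are
  constant on the classes.
\<close>

section \<open>Sheets of a polynomial over its noncritical values\<close>

text \<open>The arcs of the star are merely continuous: \<Gamma> carries no contour integral, an arc
  has no usable sides, and a disc minus the star may have infinitely many components. This shapes
  three choices. The moments are integrated along the segment from \<open>a\<close> to
  \<open>b\<close>, and \<Gamma> enters only as the cut of a logarithm, which outside a large disc
  agrees with the segment integral up to a constant. A jump is never a limit from two sides of an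
  arc; it compares two branches, one off the star and one on the disc, at two points common to both.
  And the jump on one sheet is found in the plane of values: the product of
  \<open>(y - p) / (y - p')\<close> over the fibre of \<open>w\<close> is
  \<open>(w - P p) / (w - P p')\<close>, whose jump depends only on which of \<open>P p\<close>,
  \<open>P p'\<close> is the tip of colour \<open>s\<close>. Applied to the whole of \<Gamma> this
  product would give only the sum of the jumps on the two sheets, which is zero; splitting \<Gamma>
  isolates them.\<close>

lemma poly_eq_finite:
  fixes P :: "complex poly"
  assumes "degree P > 0"
  shows "finite {y. poly P y = w}"
proof -
  have "P - [:w:] \<noteq> 0"
    using assms by auto
  then have "finite {y. poly (P - [:w:]) y = 0}"
    by (rule poly_roots_finite)
  then show ?thesis by simp
qed

lemma finite_critical_values:
  assumes "degree P > 0"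
  shows "finite (critical_values P)"
proof -
  have "pderiv P \<noteq> 0"
    using assms by (auto simp: pderiv_eq_0_iff)
  then show ?thesis
    unfolding critical_values_def by (intro finite_imageI poly_roots_finite)
qed

lemma noncritical_pderiv:
  "poly P z \<notin> critical_values P \<Longrightarrow> poly (pderiv P) z \<noteq> 0"
  by (auto simp: critical_values_def)

lemma noncritical_decompose:
  assumes "degree P > 0" "w \<notin> critical_values P"
  shows "P - [:w:] = smult (lead_coeff P) (\<Prod>y | poly P y = w. [:-y, 1:])"
proof -
  have "rsquarefree (P - [:w:])"
    using assms(2) by (auto simp: rsquarefree_roots pderiv_diff pderiv_pCons critical_values_def)
  from complex_poly_decompose_rsquarefree[OF this]
  have "smult (lead_coeff (P - [:w:])) (\<Prod>y | poly P y = w. [:-y, 1:]) = P - [:w:]"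
    by simp
  moreover have "lead_coeff (P - [:w:]) = lead_coeff P"
    using assms(1) lead_coeff_add_le[of "-[:w:]" P]
    by (metis (no_types, lifting) add.commute degree_minus degree_pCons_0 uminus_add_conv_diff)
  ultimately show ?thesis by simp
qed

lemma noncritical_card:
  assumes "degree P > 0" "w \<notin> critical_values P"
  shows "card {y. poly P y = w} = degree P"
proof -
  have "degree P = degree (P - [:w:])"
    using assms(1) by (metis degree_add_eq_left degree_minus degree_pCons_0 diff_conv_add_uminus)
  also have "\<dots> = degree (\<Prod>y | poly P y = w. [:-y, 1:])"
    using assms by (subst noncritical_decompose) auto
  also have "\<dots> = (\<Sum>y | poly P y = w. degree [:-y, 1:])"
    by (rule degree_prod_sum_eq) auto
  also have "\<dots> = card {y. poly P y = w}" by simp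
  finally show ?thesis ..
qed

text \<open>A trivialisation of the covering \<open>P\<close> over a disc, in which the points of
  the central fibre label the sheets. The last clause says that the sheets exhaust every fibre; it
  turns a sum over a moving fibre into a sum over a fixed finite index set.\<close>

definition sheets ::
  "complex poly \<Rightarrow> complex \<Rightarrow> real \<Rightarrow> (complex \<Rightarrow> complex \<Rightarrow> complex) \<Rightarrow> bool" where
  "sheets P w0 r u \<longleftrightarrow> r > 0 \<and> ball w0 r \<inter> critical_values P = {} \<and>
     (\<forall>y. poly P y = w0 \<longrightarrow> u y holomorphic_on ball w0 r \<and> u y w0 = y \<and>
        (\<forall>w\<in>ball w0 r. poly P (u y w) = w)) \<and>
     (\<forall>w\<in>ball w0 r. bij_betw (\<lambda>y. u y w) {y. poly P y = w0} {y. poly P y = w})"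

text \<open>Local injectivity gives an inverse branch at each point of the central fibre, on balls
  made small enough to be disjoint. That the branches exhaust a nearby fibre is a count: they give
  \<open>degree P\<close> distinct points, and a noncritical fibre has no more.\<close>

lemma sheets_exist:
  assumes "degree P > 0" "w0 \<notin> critical_values P"
  obtains r u where "sheets P w0 r u"
proof -
  define Z where "Z = {y. poly P y = w0}"
  have finZ: "finite Z"
    unfolding Z_def by (rule poly_eq_finite[OF assms(1)])
  have "\<exists>e>0. inj_on (poly P) (ball y e)" if "y \<in> Z" for y
  proof -
    have "deriv (poly P) y \<noteq> 0"
      using that assms(2) noncritical_pderiv[of P y]
      by (simp add: Z_def DERIV_imp_deriv[OF poly_DERIV])
    moreover have "poly P holomorphic_on UNIV" by (intro holomorphic_intros)
    ultimately show ?thesis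
      using has_complex_derivative_locally_injective[of "poly P" UNIV y] by auto
  qed
  then obtain e where e: "\<And>y. y \<in> Z \<Longrightarrow> e y > 0 \<and> inj_on (poly P) (ball y (e y))"
    by metis
  have "\<forall>y. \<exists>d>0. \<forall>x\<in>Z. x \<noteq> y \<longrightarrow> d \<le> dist y x"
    using finite_set_avoid[OF finZ] by blast
  then obtain d where d: "\<And>y. d y > (0::real)"
     and d': "\<And>x y. x \<in> Z \<Longrightarrow> x \<noteq> y \<Longrightarrow> d y \<le> dist y x"
    by metis
  define B where "B y = ball y (min (e y) (d y / 2))" for y
  have injB: "inj_on (poly P) (B y)" if "y \<in> Z" for y
    by (rule inj_on_subset[OF conjunct2[OF e[OF that]]]) (auto simp: B_def)
  have yB: "y \<in> B y" if "y \<in> Z" for y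
    using d[of y] e[OF that] by (simp add: B_def)
  have disj: "B x \<inter> B y = {}" if "x \<in> Z" "y \<in> Z" "x \<noteq> y" for x y
  proof -
    have "dist x y \<ge> d x" "dist x y \<ge> d y"
      using d'[of x y] d'[of y x] that by (auto simp: dist_commute)
    then have "ball x (d x / 2) \<inter> ball y (d y / 2) = {}"
      by (intro disjoint_ballI) auto
    then show ?thesis
      unfolding B_def by (auto simp: disjoint_iff)
  qed
  have opB: "open (B y)" for y by (simp add: B_def)
  have "\<exists>g. g holomorphic_on (poly P ` B y) \<and> (\<forall>z\<in>B y. g (poly P z) = z)" if "y \<in> Z" for y
    by (rule holomorphic_has_inverse[of "poly P" "B y"]) (use opB injB[OF that] in \<open>auto intro: holomorphic_intros\<close>)
  then obtain u where u: "\<And>y. y \<in> Z \<Longrightarrow> u y holomorphic_on (poly P ` B y)"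
     and u': "\<And>y z. y \<in> Z \<Longrightarrow> z \<in> B y \<Longrightarrow> u y (poly P z) = z"
    by metis
  define O' where "O' = (\<Inter>y\<in>Z. poly P ` B y) \<inter> - critical_values P"
  have "open (poly P ` B y)" if "y \<in> Z" for y
    by (rule open_mapping_thm3) (use opB injB[OF that] in \<open>auto intro: holomorphic_intros\<close>)
  then have "open O'"
    unfolding O'_def using finZ finite_critical_values[OF assms(1)]
    by (intro open_Int open_INT) (auto simp: finite_imp_closed)
  moreover have "w0 \<in> O'"
    unfolding O'_def using assms(2) yB by (auto simp: Z_def)
  ultimately obtain r where r: "r > 0" "ball w0 r \<subseteq> O'"
    by (meson openE)
  have P_u: "poly P (u y w) = w \<and> u y w \<in> B y" if "y \<in> Z" "w \<in> ball w0 r" for y w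
  proof -
    from that r obtain z where "z \<in> B y" "w = poly P z"
      unfolding O'_def by blast
    then show ?thesis using u' that by auto
  qed
  have "bij_betw (\<lambda>y. u y w) Z {y. poly P y = w}" if w: "w \<in> ball w0 r" for w
  proof -
    have wc: "w \<notin> critical_values P" using w r by (auto simp: O'_def)
    have inj: "inj_on (\<lambda>y. u y w) Z"
      using P_u[OF _ w] disj by (intro inj_onI) (metis disjoint_iff)
    have "(\<lambda>y. u y w) ` Z = {y. poly P y = w}"
    proof (rule card_subset_eq)
      show "card ((\<lambda>y. u y w) ` Z) = card {y. poly P y = w}"
        using card_image[OF inj] noncritical_card[OF assms] noncritical_card[OF assms(1) wc]
        by (simp add: Z_def)
    qed (use P_u[OF _ w] poly_eq_finite[OF assms(1)] in auto)
    with inj show ?thesis by (simp add: bij_betw_def)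
  qed
  moreover have "u y holomorphic_on ball w0 r" if "y \<in> Z" for y
    by (rule holomorphic_on_subset[OF u[OF that]]) (use r that in \<open>auto simp: O'_def\<close>)
  moreover have "u y w0 = y" if "y \<in> Z" for y
    using u'[OF that yB[OF that]] that by (simp add: Z_def)
  ultimately have "sheets P w0 r u"
    unfolding sheets_def using P_u r by (auto simp: Z_def O'_def)
  then show ?thesis by (rule that)
qed

context
  fixes P w0 r u
  assumes sh: "sheets P w0 r u"
begin

lemma sheets_pos: "r > 0"
  and sheets_noncritical: "w \<in> ball w0 r \<Longrightarrow> w \<notin> critical_values P"
  and sheets_holomorphic: "poly P y = w0 \<Longrightarrow> u y holomorphic_on ball w0 r"
  and sheets_centre: "poly P y = w0 \<Longrightarrow> u y w0 = y"
  and sheets_poly: "poly P y = w0 \<Longrightarrow> w \<in> ball w0 r \<Longrightarrow> poly P (u y w) = w"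
  and sheets_bij: "w \<in> ball w0 r \<Longrightarrow> bij_betw (\<lambda>y. u y w) {y. poly P y = w0} {y. poly P y = w}"
  using sh unfolding sheets_def by blast+

lemma sheets_inj:
  assumes "w \<in> ball w0 r" "poly P y = w0" "poly P y' = w0" "u y w = u y' w"
  shows "y = y'"
  using sheets_bij[OF assms(1)] assms(2-4) by (auto simp: bij_betw_def inj_on_def)

lemma sheets_surj:
  assumes "poly P z \<in> ball w0 r"
  obtains y where "poly P y = w0" "z = u y (poly P z)"
  using sheets_bij[OF assms] by (fastforce simp: bij_betw_def)

lemma sheets_subset:
  assumes "0 < r'" "r' \<le> r"
  shows "sheets P w0 r' u"
proof -
  have "ball w0 r' \<subseteq> ball w0 r" using assms by auto
  then show ?thesis
    using sh assms unfolding sheets_def by (auto intro: holomorphic_on_subset)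
qed

lemma sheets_inj_on: "poly P y = w0 \<Longrightarrow> inj_on (u y) (ball w0 r)"
  by (metis inj_onI sheets_poly)

lemma sheets_open_image:
  assumes "poly P y = w0" "open D" "D \<subseteq> ball w0 r"
  shows "open (u y ` D)"
proof (rule open_mapping_thm3)
  show "u y holomorphic_on D"
    using sheets_holomorphic assms holomorphic_on_subset by blast
  show "inj_on (u y) D"
    using sheets_inj_on assms inj_on_subset by blast
qed (use assms in auto)

lemma sheets_DERIV:
  assumes "poly P y = w0" "w \<in> ball w0 r"
  shows "(u y has_field_derivative 1 / poly (pderiv P) (u y w)) (at w)"
proof -
  obtain d where d: "(u y has_field_derivative d) (at w)"
    using sheets_holomorphic[OF assms(1)] assms(2)
    by (meson holomorphic_on_open open_ball)
  have "((\<lambda>w. poly P (u y w)) has_field_derivative poly (pderiv P) (u y w) * d) (at w)"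
    by (rule DERIV_chain2[OF poly_DERIV d])
  moreover have "((\<lambda>w. poly P (u y w)) has_field_derivative 1) (at w)"
  proof (rule has_field_derivative_transform_within_open)
    show "((\<lambda>w. w) has_field_derivative 1) (at w)" by simp
    show "open (ball w0 r)" by simp
  qed (use assms sheets_poly in auto)
  ultimately have "poly (pderiv P) (u y w) * d = 1"
    by (rule DERIV_unique)
  then show ?thesis
    using d by (metis nonzero_divide_eq_eq mult.commute mult_zero_left zero_neq_one)
qed

lemma sheets_sum:
  assumes "w \<in> ball w0 r"
  shows "(\<Sum>y | poly P y = w. f y) = (\<Sum>y | poly P y = w0. f (u y w))"
  by (rule sum.reindex_bij_betw[OF sheets_bij[OF assms], symmetric])

end

text \<open>Sums and products over fibres or classes have explicit formulas only locally, in terms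
  of sheets.\<close>

lemma holomorphic_on_local:
  assumes "\<And>z. z \<in> N \<Longrightarrow> \<exists>V g. open V \<and> z \<in> V \<and> g holomorphic_on V \<and> (\<forall>x\<in>V. f x = g x)"
  shows "f holomorphic_on N"
  unfolding holomorphic_on_def
proof
  fix z assume "z \<in> N"
  from assms[OF this] obtain V g
    where V: "open V" "z \<in> V" "g holomorphic_on V" "\<forall>x\<in>V. f x = g x"
    by (elim exE conjE)
  have "f holomorphic_on V"
    by (rule holomorphic_transform[OF V(3)]) (simp add: V)
  then show "f field_differentiable at z within N"
    using holomorphic_on_imp_differentiable_at[OF _ V(1,2)]
    by (simp add: field_differentiable_at_within)
qed

section \<open>Polynomials constant on the fibres of a polynomial\<close>

lemma prod_linear_dvd:
  fixes p :: "complex poly"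
  assumes "finite A" "\<And>a. a \<in> A \<Longrightarrow> poly p a = 0"
  shows "(\<Prod>a\<in>A. [:-a, 1:]) dvd p"
  using assms
proof (induction A arbitrary: p rule: finite_induct)
  case (insert a A)
  then obtain s where s: "p = [:-a, 1:] * s"
    by (metis dvdE insertI1 poly_eq_0_iff_dvd)
  have "(\<Prod>a\<in>A. [:-a, 1:]) dvd s"
  proof (rule insert.IH)
    fix b assume "b \<in> A"
    then have "b \<noteq> a" "poly p b = 0" using insert by auto
    then show "poly s b = 0" by (auto simp: s)
  qed
  then show ?case
    unfolding s prod.insert[OF insert.hyps] by (rule mult_dvd_mono[OF dvd_refl])
qed simp

text \<open>Repeated division by \<open>W - W z0\<close>: its roots are exactly the
  \<open>degree W\<close> points of \<open>C z0\<close>, all of which are also roots of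
  \<open>R - R z0\<close>, so the division leaves no remainder. The quotient is again constant on
  the classes and has smaller degree.\<close>

lemma pcompose_of_constant_on_fibres:
  fixes W R :: "complex poly"
  assumes "degree W > 0"
    and "finite F" "finite F'"
    and fib: "\<And>z. z \<notin> F \<Longrightarrow> finite (C z) \<and> card (C z) = degree W \<and> (\<forall>y\<in>C z. poly W y = poly W z)"
    and R: "\<And>z y. z \<notin> F' \<Longrightarrow> y \<in> C z \<Longrightarrow> poly R y = poly R z"
  shows "\<exists>T. R = pcompose T W"
  using assms(3) R
proof (induction "degree R" arbitrary: R F' rule: less_induct)
  case less
  show ?case
  proof (cases "degree R = 0")
    case True
    then obtain c where "R = [:c:]" using degree_eq_zeroE by blast
    then show ?thesis by (metis pcompose_const)
  next
    case False
    have "infinite (UNIV :: complex set)" by (rule infinite_UNIV_char_0)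
    then obtain z0 where z0: "z0 \<notin> F \<union> F'"
      using less.prems(1) assms(2) by (metis UNIV_eq_I finite_UnI)
    define D where "D = (\<Prod>y\<in>C z0. [:-y, 1:])"
    have degD: "degree D = degree W"
      unfolding D_def using fib[of z0] z0 by (subst degree_prod_sum_eq) auto
    define W0 where "W0 = W - [:poly W z0:]"
    have degW0: "degree W0 = degree W"
      using assms(1) unfolding W0_def
      by (metis degree_add_eq_left degree_minus degree_pCons_0 diff_conv_add_uminus)
    have "D dvd W0"
      unfolding D_def W0_def using fib[of z0] z0 by (intro prod_linear_dvd) auto
    then obtain e where e: "W0 = D * e" by (auto elim: dvdE)
    have "W0 \<noteq> 0" using degW0 assms(1) by auto
    then have "degree W0 = degree D + degree e"
      unfolding e by (intro degree_mult_eq) auto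
    then have "degree e = 0" using degD degW0 by simp
    then obtain k where k: "e = [:k:]" using degree_eq_zeroE by blast
    then have "k \<noteq> 0" using e \<open>W0 \<noteq> 0\<close> by auto
    have "D dvd R - [:poly R z0:]"
      unfolding D_def using fib[of z0] z0 less.prems(2)[of z0] by (intro prod_linear_dvd) auto
    then obtain R0 where R0: "R - [:poly R z0:] = D * R0" by (auto elim: dvdE)
    define R1 where "R1 = smult (1 / k) R0"
    have R1: "R = [:poly R z0:] + W0 * R1"
      using R0 \<open>k \<noteq> 0\<close> by (simp add: R1_def e k algebra_simps)
    have "R1 \<noteq> 0"
      using R1 False by (metis add_0_right degree_pCons_0 mult_zero_right)
    have "degree R = degree (R - [:poly R z0:])"
      using False by (metis degree_add_eq_left degree_minus degree_pCons_0 diff_conv_add_uminus gr0I)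
    also have "\<dots> = degree (W0 * R1)" using R1 by (metis add_diff_cancel_left')
    also have "\<dots> = degree W + degree R1"
      using degree_mult_eq[OF \<open>W0 \<noteq> 0\<close> \<open>R1 \<noteq> 0\<close>] degW0 by simp
    finally have deg: "degree R1 < degree R" using assms(1) by simp
    have "\<exists>T. R1 = pcompose T W"
    proof (rule less.hyps[OF deg])
      \<comment> \<open>The fibre of \<open>W\<close> through \<open>z0\<close> joins the
        exceptional set, because there the factor \<open>poly W z - poly W z0\<close> cannot be
        cancelled. This is why \<open>F'\<close> varies in the induction.\<close>
      show "finite (F \<union> F' \<union> {z. poly W z = poly W z0})"
        using assms(2) less.prems(1) poly_eq_finite[OF assms(1)] by simp
      fix z y assume z: "z \<notin> F \<union> F' \<union> {z. poly W z = poly W z0}" and y: "y \<in> C z"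
      have W: "poly W y = poly W z" using fib[of z] z y by auto
      have R: "poly R y = poly R z" using less.prems(2)[of z y] z y by auto
      have *: "poly R x = poly R z0 + (poly W x - poly W z0) * poly R1 x" for x
        by (subst R1) (simp add: W0_def)
      have "(poly W z - poly W z0) * poly R1 y = (poly W z - poly W z0) * poly R1 z"
        using *[of y] *[of z] W R by (metis add_left_cancel)
      then show "poly R1 y = poly R1 z" using z by simp
    qed
    then obtain T where "R1 = pcompose T W" by blast
    moreover have "pcompose [:-poly W z0, 1:] W = W0"
      by (simp add: W0_def pcompose_pCons)
    ultimately have "R = pcompose ([:poly R z0:] + [:-poly W z0, 1:] * T) W"
      by (subst R1) (simp only: pcompose_add pcompose_mult pcompose_const)
    then show ?thesis by blast
  qed
qed

section \<open>Growth of polynomials, and polynomials recognised by their growth\<close>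

lemma poly_norm_bound:
  fixes p :: "complex poly"
  obtains S where "S > 0" "\<And>z. norm (poly p z) \<le> S * (1 + norm z) ^ degree p"
proof -
  define S where "S = 1 + (\<Sum>i\<le>degree p. norm (coeff p i))"
  have "S > 0" unfolding S_def by (simp add: add_pos_nonneg sum_nonneg)
  moreover have "norm (poly p z) \<le> S * (1 + norm z) ^ degree p" for z
  proof -
    have "norm (poly p z) = norm (\<Sum>i\<le>degree p. coeff p i * z ^ i)"
      by (simp add: poly_altdef)
    also have "\<dots> \<le> (\<Sum>i\<le>degree p. norm (coeff p i) * norm z ^ i)"
      by (rule order.trans[OF norm_sum]) (simp add: norm_mult norm_power)
    also have "\<dots> \<le> (\<Sum>i\<le>degree p. norm (coeff p i) * (1 + norm z) ^ degree p)"
    proof (intro sum_mono mult_left_mono)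
      fix i assume "i \<in> {..degree p}"
      have "norm z ^ i \<le> (1 + norm z) ^ i" by (intro power_mono) auto
      also have "\<dots> \<le> (1 + norm z) ^ degree p"
        using \<open>i \<in> _\<close> by (intro power_increasing) auto
      finally show "norm z ^ i \<le> (1 + norm z) ^ degree p" .
    qed auto
    also have "\<dots> \<le> S * (1 + norm z) ^ degree p"
      by (simp add: S_def sum_distrib_right[symmetric] mult_right_mono)
    finally show ?thesis .
  qed
  ultimately show ?thesis by (rule that)
qed

lemma poly_norm_lower_bound:
  fixes p :: "complex poly"
  assumes "degree p > 0"
  obtains m A where "m > 0" "A \<ge> 1" "\<And>z. norm z \<ge> A \<Longrightarrow> m * norm z ^ degree p \<le> norm (poly p z)"
proof -
  define n where "n = degree p"
  define l where "l = norm (lead_coeff p)"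
  define L where "L = (\<Sum>i<n. norm (coeff p i))"
  have l: "l > 0" using assms by (auto simp: l_def)
  have L: "L \<ge> 0" by (simp add: L_def sum_nonneg)
  \<comment> \<open>Beyond \<open>2 * L / l\<close> the lower terms amount to at most half of the
    leading one; the 1 makes the powers of \<open>norm z\<close> increase with the exponent.\<close>
  define A where "A = max 1 (2 * L / l)"
  have "l / 2 * norm z ^ n \<le> norm (poly p z)" if "norm z \<ge> A" for z
  proof -
    have z1: "norm z \<ge> 1" and zL: "norm z \<ge> 2 * L / l" using that by (auto simp: A_def)
    have "poly p z = (\<Sum>i<n. coeff p i * z ^ i) + lead_coeff p * z ^ n"
      by (simp add: poly_altdef n_def lessThan_Suc_atMost[symmetric])
    moreover have "norm (\<Sum>i<n. coeff p i * z ^ i) \<le> L * norm z ^ (n - 1)"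
    proof -
      have "norm (\<Sum>i<n. coeff p i * z ^ i) \<le> (\<Sum>i<n. norm (coeff p i) * norm z ^ i)"
        by (rule order.trans[OF norm_sum]) (simp add: norm_mult norm_power)
      also have "\<dots> \<le> (\<Sum>i<n. norm (coeff p i) * norm z ^ (n - 1))"
        using z1 by (intro sum_mono mult_left_mono power_increasing) auto
      finally show ?thesis by (simp add: L_def sum_distrib_right)
    qed
    moreover have "L * norm z ^ (n - 1) \<le> l / 2 * norm z ^ n"
    proof -
      have "L \<le> l / 2 * norm z" using zL l by (simp add: field_simps)
      then have "L * norm z ^ (n - 1) \<le> l / 2 * norm z * norm z ^ (n - 1)"
        by (intro mult_right_mono) auto
      also have "\<dots> = l / 2 * norm z ^ n"
        using assms by (cases n) (auto simp: n_def)
      finally show ?thesis .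
    qed
    moreover have "norm (lead_coeff p * z ^ n) = l * norm z ^ n"
      by (simp add: l_def norm_mult norm_power)
    ultimately show ?thesis
      using norm_diff_ineq[of "lead_coeff p * z ^ n" "\<Sum>i<n. coeff p i * z ^ i"]
      by (simp add: add.commute)
  qed
  then show ?thesis
    using that[of "l / 2" A] l by (auto simp: n_def A_def)
qed

text \<open>Near infinity \<open>norm (poly P z)\<close> is comparable to
  \<open>norm z ^ degree P\<close> in both directions. So all points of a germ class have the size
  of any one of them, which bounds the growth of symmetric functions of a class.\<close>

lemma poly_fibre_norm_bound:
  fixes P :: "complex poly"
  assumes "degree P > 0"
  obtains K where "K \<ge> 1" "\<And>y z. poly P y = poly P z \<Longrightarrow> norm y \<le> K * (1 + norm z)"
proof -
  obtain m A where m: "m > 0" "A \<ge> 1"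
     and lower: "\<And>z. norm z \<ge> A \<Longrightarrow> m * norm z ^ degree P \<le> norm (poly P z)"
    using poly_norm_lower_bound[OF assms] by blast
  obtain S where S: "S > 0" "\<And>z. norm (poly P z) \<le> S * (1 + norm z) ^ degree P"
    using poly_norm_bound by blast
  define K where "K = max A (S / m)"
  have K: "K \<ge> 1" "K \<ge> A" "S / m \<le> K" using m by (auto simp: K_def)
  have "norm y \<le> K * (1 + norm z)" if "poly P y = poly P z" for y z
  proof (cases "norm y \<ge> A")
    case True
    have "m * norm y ^ degree P \<le> S * (1 + norm z) ^ degree P"
      using lower[OF True] S(2)[of z] that by simp
    then have "norm y ^ degree P \<le> (S / m) * (1 + norm z) ^ degree P"
      using m by (simp add: field_simps)
    also have "\<dots> \<le> K * (1 + norm z) ^ degree P"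
      using K by (intro mult_right_mono) auto
    \<comment> \<open>Since \<open>K \<ge> 1\<close>, the constant may be raised to the full power,
      which avoids taking a root of \<open>S / m\<close>.\<close>
    also have "\<dots> \<le> K ^ degree P * (1 + norm z) ^ degree P"
      using K assms by (intro mult_right_mono) (auto intro: self_le_power)
    also have "\<dots> = (K * (1 + norm z)) ^ degree P" by (simp add: power_mult_distrib)
    finally show ?thesis
      using power_le_imp_le_base[of "norm y" "degree P - 1"] K assms by simp
  next
    case False
    have "A * 1 \<le> K * (1 + norm z)" using K m by (intro mult_mono) auto
    then show ?thesis using False by simp
  qed
  with K(1) show ?thesis by (rule that)
qed

text \<open>The bound keeps \<open>f\<close> bounded near the points of \<open>F\<close>, so that
  they are removable; then Liouville's theorem for polynomial growth applies and gives the Taylor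
  polynomial at 0.\<close>

lemma poly_of_polynomial_growth:
  assumes "finite F" and hol: "f holomorphic_on - F"
    and bound: "\<And>z. z \<notin> F \<Longrightarrow> norm (f z) \<le> B * (1 + norm z) ^ d"
  shows "\<exists>p. degree p \<le> d \<and> (\<forall>z. z \<notin> F \<longrightarrow> f z = poly p z)"
proof -
  have B0: "B \<ge> 0"
  proof -
    obtain z where "z \<notin> F"
      using assms(1) infinite_UNIV_char_0[where 'a=complex] by (metis UNIV_eq_I)
    then have "0 \<le> B * (1 + norm z) ^ d"
      using bound norm_ge_zero order.trans by blast
    moreover have "(1 + norm z) ^ d > 0" by (simp add: add_pos_nonneg)
    ultimately show ?thesis by (simp add: zero_le_mult_iff)
  qed
  have "f \<in> O[at z](\<lambda>_. 1)" if "z \<in> F" for z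
  proof (rule bigoI)
    have "open (ball z 1 - (F - {z}))"
      using assms(1) by (intro open_Diff) (auto simp: finite_imp_closed)
    then have "eventually (\<lambda>x. x \<in> ball z 1 - (F - {z}) - {z}) (at z)"
      by (intro eventually_at_in_open) auto
    then show "\<forall>\<^sub>F x in at z. norm (f x) \<le> (B * (2 + norm z) ^ d) * norm (1::complex)"
    proof eventually_elim
      case (elim x)
      have "norm x \<le> norm z + 1"
        using elim norm_triangle_sub[of x z] by (auto simp: dist_norm norm_minus_commute)
      then have "(1 + norm x) ^ d \<le> (2 + norm z) ^ d" by (intro power_mono) auto
      then have "B * (1 + norm x) ^ d \<le> B * (2 + norm z) ^ d"
        using B0 by (rule mult_left_mono)
      then show ?case using bound[of x] elim by auto
    qed
  qed
  then obtain g where g: "g holomorphic_on UNIV" "\<And>z. z \<notin> F \<Longrightarrow> g z = f z"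
    using removable_singularities[OF assms(1), of UNIV f] hol by (auto simp: Compl_eq_Diff_UNIV)
  have "bounded F" using assms(1) by (rule finite_imp_bounded)
  then obtain M where M: "\<And>z. z \<in> F \<Longrightarrow> norm z \<le> M" by (auto simp: bounded_iff)
  have growth: "norm (g z) \<le> (B * 2 ^ d) * norm z ^ d" if "max 1 (M + 1) \<le> norm z" for z
  proof -
    have "z \<notin> F" using M[of z] that by auto
    then have "norm (g z) \<le> B * (1 + norm z) ^ d" using g bound by simp
    also have "\<dots> \<le> B * (2 * norm z) ^ d"
      using B0 that by (intro mult_left_mono power_mono) auto
    finally show ?thesis by (simp add: power_mult_distrib)
  qed
  define p where "p = (\<Sum>k\<le>d. monom ((deriv ^^ k) g 0 / fact k) k)"
  have "degree p \<le> d"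
    unfolding p_def by (intro degree_sum_le) (auto intro: order.trans[OF degree_monom_le])
  moreover have "g z = poly p z" for z
    using Liouville_polynomial[OF g(1), of "max 1 (M + 1)", OF growth, where \<xi> = z] by (simp add: p_def poly_sum poly_monom)
  ultimately show ?thesis using g(2) by metis
qed

section \<open>Germ classes and right factors\<close>

definition regular_points :: "complex poly \<Rightarrow> complex set" where
  "regular_points P = {z. poly P z \<notin> critical_values P}"

text \<open>
  \<open>fibre_deriv P\<close> is differentiation with respect to the value of \<open>P\<close>: on a sheet \<open>u\<close> it becomes \<open>d/dw\<close>
  of \<open>f (u w)\<close>. So two points over the same noncritical value lie in the same \<open>germ_class\<close>
  iff \<open>f\<close> has the same germ, as a function of \<open>w\<close>, on the sheets through them.
\<close>

definition fibre_deriv :: "complex poly \<Rightarrow> (complex \<Rightarrow> complex) \<Rightarrow> complex \<Rightarrow> complex" where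
  "fibre_deriv P f = (\<lambda>z. deriv f z / poly (pderiv P) z)"

definition germ_class :: "complex poly \<Rightarrow> (complex \<Rightarrow> complex) \<Rightarrow> complex \<Rightarrow> complex set" where
  "germ_class P f z = {y. poly P y = poly P z \<and> (\<forall>k. (fibre_deriv P ^^ k) f y = (fibre_deriv P ^^ k) f z)}"

lemma finite_Compl_regular_points:
  assumes "degree P > 0"
  shows "finite (- regular_points P)"
proof -
  have "- regular_points P = (\<Union>w\<in>critical_values P. {y. poly P y = w})"
    by (auto simp: regular_points_def)
  then show ?thesis
    using finite_critical_values[OF assms] poly_eq_finite[OF assms] by simp
qed

lemma open_regular_points: "degree P > 0 \<Longrightarrow> open (regular_points P)"
  using finite_imp_closed[OF finite_Compl_regular_points, of P] by (simp add: closed_def)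

lemma connected_regular_points:
  assumes "degree P > 0"
  shows "connected (regular_points P)"
proof -
  have "connected (UNIV - (- regular_points P))"
    using finite_Compl_regular_points[OF assms]
    by (intro connected_open_delete_finite) auto
  then show ?thesis by (simp add: Diff_eq)
qed

lemma fibre_deriv_holomorphic:
  assumes "degree P > 0" "f holomorphic_on regular_points P"
  shows "(fibre_deriv P ^^ k) f holomorphic_on regular_points P"
proof (induction k)
  case (Suc k)
  then show ?case
    using open_regular_points[OF assms(1)] noncritical_pderiv
    by (auto simp: fibre_deriv_def[of P "(fibre_deriv P ^^ k) f"] regular_points_def
        intro!: holomorphic_intros holomorphic_deriv)
qed (use assms in auto)

lemma sheets_regular:
  "sheets P w0 r u \<Longrightarrow> poly P y = w0 \<Longrightarrow> w \<in> ball w0 r \<Longrightarrow> u y w \<in> regular_points P"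
  by (simp add: regular_points_def sheets_poly sheets_noncritical)

lemma sheets_compose_holomorphic:
  assumes "sheets P w0 r u" "poly P y = w0" "f holomorphic_on regular_points P"
  shows "(\<lambda>w. f (u y w)) holomorphic_on ball w0 r"
proof -
  have "f \<circ> u y holomorphic_on ball w0 r"
    using assms sheets_regular
    by (intro holomorphic_on_compose_gen[OF sheets_holomorphic[OF assms(1,2)] assms(3)]) blast
  then show ?thesis by (simp add: o_def)
qed

lemma higher_deriv_sheet:
  assumes "degree P > 0" and f: "f holomorphic_on regular_points P"
    and sh: "sheets P w0 r u" and y: "poly P y = w0" and "w \<in> ball w0 r"
  shows "(deriv ^^ k) (\<lambda>w. f (u y w)) w = (fibre_deriv P ^^ k) f (u y w)"
  using assms(5)
proof (induction k arbitrary: w)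
  case (Suc k)
  define F where "F = (fibre_deriv P ^^ k) f"
  have "F holomorphic_on regular_points P"
    unfolding F_def by (rule fibre_deriv_holomorphic[OF assms(1) f])
  then have "(F has_field_derivative deriv F (u y w)) (at (u y w))"
    using open_regular_points[OF assms(1)] sheets_regular[OF sh y Suc.prems]
    by (rule holomorphic_derivI)
  from DERIV_chain2[OF this sheets_DERIV[OF sh y Suc.prems]]
  have "((\<lambda>w. F (u y w)) has_field_derivative fibre_deriv P F (u y w)) (at w)"
    by (simp add: fibre_deriv_def)
  then have "((deriv ^^ k) (\<lambda>w. f (u y w)) has_field_derivative fibre_deriv P F (u y w)) (at w)"
    by (rule has_field_derivative_transform_within_open[OF _ open_ball Suc.prems])
       (simp add: Suc.IH F_def)
  then show ?case by (simp add: F_def DERIV_imp_deriv)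
qed simp

text \<open>By the identity theorem all derivatives at one point determine a function on the whole
  disc. Hence membership in a class is carried along by the sheets, which equality of the values of
  \<open>f\<close> alone would not ensure.\<close>

lemma germ_class_sheets:
  assumes "degree P > 0" and f: "f holomorphic_on regular_points P"
    and sh: "sheets P w0 r u" and y: "poly P y1 = w0" "poly P y2 = w0" and w: "w \<in> ball w0 r"
  shows "u y2 w \<in> germ_class P f (u y1 w) \<longleftrightarrow> (\<forall>w'\<in>ball w0 r. f (u y2 w') = f (u y1 w'))"
proof
  note hol = sheets_compose_holomorphic[OF sh _ f]
  note hd = higher_deriv_sheet[OF assms(1) f sh _ w, symmetric]
  show "\<forall>w'\<in>ball w0 r. f (u y2 w') = f (u y1 w')" if "u y2 w \<in> germ_class P f (u y1 w)"
  proof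
    fix w' assume "w' \<in> ball w0 r"
    have "(deriv ^^ k) (\<lambda>w. f (u y2 w)) w = (deriv ^^ k) (\<lambda>w. f (u y1 w)) w" for k
      using that hd[OF y(1)] hd[OF y(2)] by (simp add: germ_class_def)
    from holomorphic_fun_eq_on_connected[OF hol[OF y(2)] hol[OF y(1)] open_ball connected_ball this w \<open>w' \<in> _\<close>]
    show "f (u y2 w') = f (u y1 w')" .
  qed
  show "u y2 w \<in> germ_class P f (u y1 w)" if "\<forall>w'\<in>ball w0 r. f (u y2 w') = f (u y1 w')"
  proof -
    have "(deriv ^^ k) (\<lambda>w. f (u y2 w)) w = (deriv ^^ k) (\<lambda>w. f (u y1 w)) w" for k
      using hol[OF y(2)] hol[OF y(1)] open_ball w
      by (rule higher_deriv_transform_within_open) (use that in auto)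
    then show ?thesis
      using hd[OF y(1)] hd[OF y(2)] sheets_poly[OF sh y(1) w] sheets_poly[OF sh y(2) w]
      by (simp add: germ_class_def)
  qed
qed

lemma germ_class_refl: "z \<in> germ_class P f z"
  by (simp add: germ_class_def)

lemma germ_class_eq: "y \<in> germ_class P f z \<Longrightarrow> germ_class P f y = germ_class P f z"
  by (auto simp: germ_class_def)

lemma germ_class_poly: "y \<in> germ_class P f z \<Longrightarrow> poly P y = poly P z"
  by (simp add: germ_class_def)

lemma finite_germ_class: "degree P > 0 \<Longrightarrow> finite (germ_class P f z)"
  by (rule finite_subset[OF _ poly_eq_finite[of P "poly P z"]]) (auto simp: germ_class_def)

text \<open>The members of a class move holomorphically with \<open>z\<close>, as
  \<open>v y = u y o P\<close>. The bijection makes the class size locally constant, and the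
  derivative is the chain rule for \<open>u y\<close> after \<open>P\<close>.\<close>

lemma germ_class_local:
  assumes "degree P > 0" and f: "f holomorphic_on regular_points P" and z1: "z1 \<in> regular_points P"
  obtains V v where "open V" "z1 \<in> V" "V \<subseteq> regular_points P"
    "\<And>z. z \<in> V \<Longrightarrow> bij_betw (\<lambda>y. v y z) (germ_class P f z1) (germ_class P f z)"
    "\<And>y z. y \<in> germ_class P f z1 \<Longrightarrow> z \<in> V \<Longrightarrow>
       (v y has_field_derivative poly (pderiv P) z / poly (pderiv P) (v y z)) (at z)"
proof -
  define w0 where "w0 = poly P z1"
  have "w0 \<notin> critical_values P"
    using z1 by (simp add: regular_points_def w0_def)
  then obtain r u where sh: "sheets P w0 r u"
    using sheets_exist[OF assms(1)] by blast
  \<comment> \<open>On the image of the sheet through \<open>z1\<close>, the point \<open>z\<close>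
    is itself \<open>u z1 (poly P z)\<close>, so that classes of \<open>z\<close> can be compared
    with those of \<open>z1\<close>.\<close>
  define V where "V = u z1 ` ball w0 r"
  define v where "v y z = u y (poly P z)" for y z
  have zP: "poly P z1 = w0" by (simp add: w0_def)
  have w0: "w0 \<in> ball w0 r" using sheets_pos[OF sh] by simp
  have V: "poly P z \<in> ball w0 r" "z = u z1 (poly P z)" if "z \<in> V" for z
    using that sheets_poly[OF sh zP] by (auto simp: V_def)
  have cl: "u y w \<in> germ_class P f (u z1 w) \<longleftrightarrow> y \<in> germ_class P f z1"
    if "poly P y = w0" "w \<in> ball w0 r" for y w
    using germ_class_sheets[OF assms(1) f sh zP that(1) that(2)]
      germ_class_sheets[OF assms(1) f sh zP that(1) w0]
    by (simp add: sheets_centre[OF sh zP] sheets_centre[OF sh that(1)])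
  show ?thesis
  proof (rule that)
    show "open V"
      unfolding V_def by (rule sheets_open_image[OF sh zP]) auto
    show "z1 \<in> V"
      unfolding V_def using sheets_centre[OF sh zP] w0 by (metis imageI)
    show "V \<subseteq> regular_points P"
      unfolding V_def using sheets_regular[OF sh zP] by blast
    show "bij_betw (\<lambda>y. v y z) (germ_class P f z1) (germ_class P f z)" if z: "z \<in> V" for z
    proof (rule bij_betwI')
      note b = V(1)[OF z]
      show "v y z = v y' z \<longleftrightarrow> y = y'" if "y \<in> germ_class P f z1" "y' \<in> germ_class P f z1" for y y'
      proof -
        have "poly P y = w0" "poly P y' = w0"
          using that[THEN germ_class_poly] zP by simp_all
        then show ?thesis using sheets_inj[OF sh b, of y y'] unfolding v_def by blast
      qed
      show "v y z \<in> germ_class P f z" if "y \<in> germ_class P f z1" for y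
        using cl[of y, OF _ b] that V(2)[OF z] by (metis v_def germ_class_poly zP)
      show "\<exists>y\<in>germ_class P f z1. y' = v y z" if "y' \<in> germ_class P f z" for y'
      proof -
        have P: "poly P y' = poly P z" using that by (rule germ_class_poly)
        with b have "poly P y' \<in> ball w0 r" by simp
        from sheets_surj[OF sh this] obtain y where y: "poly P y = w0" "y' = u y (poly P y')" .
        then have "y \<in> germ_class P f z1"
          using cl[OF y(1) b] that V(2)[OF z] P by simp
        then show ?thesis using y P by (auto simp: v_def)
      qed
    qed
    show "(v y has_field_derivative poly (pderiv P) z / poly (pderiv P) (v y z)) (at z)"
      if "y \<in> germ_class P f z1" "z \<in> V" for y z
    proof -
      have "poly P y = w0" using germ_class_poly[OF that(1)] zP by simp
      from DERIV_chain2[OF sheets_DERIV[OF sh this V(1)[OF that(2)]] poly_DERIV]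
      show ?thesis by (simp add: v_def [abs_def])
    qed
  qed
qed

theorem decomposition_of_germ_class:
  fixes P Q :: "complex poly"
  defines "f \<equiv> \<lambda>z. poly (pderiv Q) z / poly (pderiv P) z"
  assumes "degree P > 0" and z0: "z0 \<in> regular_points P"
    and y0: "y0 \<in> germ_class P f z0" "y0 \<noteq> z0"
  shows "\<exists>Pt Qt W. degree W > 1 \<and> P = pcompose Pt W \<and> Q = pcompose Qt W"
proof -
  define N where "N = regular_points P"
  define cl where "cl = germ_class P f"
  define d where "d = card (cl z0)"
  note P = \<open>degree P > 0\<close>
  have f: "f holomorphic_on regular_points P"
    unfolding f_def using noncritical_pderiv
    by (auto simp: regular_points_def intro!: holomorphic_intros)
  note around = germ_class_local[OF P f, folded N_def cl_def]
  have N: "open N" "connected N" "finite (- N)"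
    unfolding N_def by (rule open_regular_points[OF P] connected_regular_points[OF P]
        finite_Compl_regular_points[OF P])+
  have fin: "finite (cl z)" for z
    unfolding cl_def by (rule finite_germ_class[OF P])
  have clN: "y \<in> N" if "y \<in> cl z" "z \<in> N" for y z
    using that germ_class_poly[of y P f z] by (simp add: N_def cl_def regular_points_def)
  have cleq: "cl y = cl z" if "y \<in> cl z" for y z
    using that unfolding cl_def by (rule germ_class_eq)
  have clrefl: "z \<in> cl z" for z
    unfolding cl_def by (rule germ_class_refl)
  have card: "card (cl z) = d" if "z \<in> N" for z
    unfolding d_def
  proof (rule connected_local_const[OF N(2) that])
    show "z0 \<in> N" using z0 by (simp add: N_def)
    show "\<forall>a\<in>N. \<forall>\<^sub>F b in at a within N. card (cl a) = card (cl b)"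
    proof
      fix a assume "a \<in> N"
      then obtain V v where V: "open V" "a \<in> V" "\<And>z. z \<in> V \<Longrightarrow> bij_betw (\<lambda>y. v y z) (cl a) (cl z)"
        using around by metis
      have "\<forall>\<^sub>F b in at a within N. b \<in> V"
        using V(1,2) unfolding eventually_at_topological by blast
      then show "\<forall>\<^sub>F b in at a within N. card (cl a) = card (cl b)"
        by eventually_elim (use V(3) bij_betw_same_card in blast)
    qed
  qed
  have "card {z0, y0} \<le> d"
    unfolding d_def using y0(1) clrefl by (intro card_mono fin) (auto simp: cl_def)
  then have d: "d \<ge> 2" using y0(2) by simp
  \<comment> \<open>This is the class polynomial evaluated at \<open>z0\<close>. The choice makes it
    nonconstant: it vanishes at \<open>z0\<close>, but elsewhere only if \<open>z0\<close> lies in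
    the class of \<open>z\<close>, that is, only on part of one fibre of \<open>P\<close>.\<close>
  define Wf where "Wf z = (\<Prod>y\<in>cl z. z0 - y)" for z
  have "Wf holomorphic_on N"
  proof (rule holomorphic_on_local)
    fix z assume "z \<in> N"
    then obtain V v where V: "open V" "z \<in> V" "\<And>x. x \<in> V \<Longrightarrow> bij_betw (\<lambda>y. v y x) (cl z) (cl x)"
      "\<And>y x. y \<in> cl z \<Longrightarrow> x \<in> V \<Longrightarrow>
         (v y has_field_derivative poly (pderiv P) x / poly (pderiv P) (v y x)) (at x)"
      using around by metis
    have "v y holomorphic_on V" if "y \<in> cl z" for y
      using V(1) V(4)[OF that] holomorphic_on_open by blast
    then have "(\<lambda>x. \<Prod>y\<in>cl z. z0 - v y x) holomorphic_on V"
      by (intro holomorphic_intros) auto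
    moreover have "Wf x = (\<Prod>y\<in>cl z. z0 - v y x)" if "x \<in> V" for x
      unfolding Wf_def by (rule prod.reindex_bij_betw[OF V(3)[OF that], symmetric])
    ultimately show "\<exists>V g. open V \<and> z \<in> V \<and> g holomorphic_on V \<and> (\<forall>x\<in>V. Wf x = g x)"
      using V(1,2) by (intro exI[of _ V] exI[of _ "\<lambda>x. \<Prod>y\<in>cl z. z0 - v y x"]) auto
  qed
  then have hol: "Wf holomorphic_on - (- N)" by simp
  obtain K where K: "K \<ge> 1" "\<And>y z. poly P y = poly P z \<Longrightarrow> norm y \<le> K * (1 + norm z)"
    using poly_fibre_norm_bound[OF P] by blast
  have "norm (Wf z) \<le> (norm z0 + K) ^ d * (1 + norm z) ^ d" if "z \<notin> - N" for z
  proof -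
    have "norm (Wf z) = (\<Prod>y\<in>cl z. norm (z0 - y))" by (simp add: Wf_def prod_norm)
    also have "\<dots> \<le> (\<Prod>y\<in>cl z. (norm z0 + K) * (1 + norm z))"
    proof (intro prod_mono conjI)
      fix y assume "y \<in> cl z"
      then have "norm y \<le> K * (1 + norm z)" by (intro K(2)) (simp add: cl_def germ_class_poly)
      moreover have "norm z0 * 1 \<le> norm z0 * (1 + norm z)" by (intro mult_left_mono) auto
      ultimately have "norm z0 + norm y \<le> (norm z0 + K) * (1 + norm z)"
        by (simp only: distrib_right mult_1_right add_mono)
      then show "norm (z0 - y) \<le> (norm z0 + K) * (1 + norm z)"
        using norm_triangle_ineq4[of z0 y] by linarith
    qed simp
    also have "\<dots> = (norm z0 + K) ^ d * (1 + norm z) ^ d"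
      using card[of z] that by (simp add: power_mult_distrib)
    finally show ?thesis .
  qed
  from poly_of_polynomial_growth[OF N(3) hol this]
  obtain W where "degree W \<le> d" and W: "\<And>z. z \<in> N \<Longrightarrow> Wf z = poly W z" by auto
  have z0N: "z0 \<in> N" using z0 by (simp add: N_def)
  have W0: "degree W > 0"
  proof (rule ccontr)
    assume "\<not> degree W > 0"
    then obtain c where "W = [:c:]" using degree_eq_zeroE by blast
    then have "Wf z = Wf z0" if "z \<in> N" for z
      using W[OF that] W[OF z0N] by simp
    moreover have "Wf z0 = 0"
      unfolding Wf_def using clrefl fin by (simp add: prod_zero_iff)
    ultimately have "Wf z = 0" if "z \<in> N" for z
      using that by simp
    then have "z0 \<in> cl z" if "z \<in> N" for z
      using that fin by (auto simp: Wf_def prod_zero_iff)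
    then have "N \<subseteq> {y. poly P y = poly P z0}"
      by (auto simp: cl_def intro: germ_class_poly[symmetric])
    then have "finite N" using poly_eq_finite[OF P] finite_subset by blast
    with N(3) have "finite (UNIV :: complex set)"
      by (metis Compl_partition finite_Un)
    then show False using infinite_UNIV_char_0 by blast
  qed
  have Wcl: "poly W y = poly W z" if "z \<in> N" "y \<in> cl z" for y z
    using W[OF that(1)] W[OF clN[OF that(2,1)]] cleq[OF that(2)] by (simp add: Wf_def)
  \<comment> \<open>The growth bound gave the other inequality. Equality is what makes the classes
    full generic fibres of \<open>W\<close>.\<close>
  have "d \<le> degree W"
  proof -
    have ne: "W - [:poly W z0:] \<noteq> 0"
      using W0 by (metis eq_iff_diff_eq_0 degree_pCons_0 less_irrefl)
    have "d \<le> card {x. poly (W - [:poly W z0:]) x = 0}"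
      unfolding d_def using Wcl[OF z0N] by (intro card_mono poly_roots_finite ne) auto
    also have "\<dots> \<le> degree (W - [:poly W z0:])" by (rule card_poly_roots_bound[OF ne])
    also have "\<dots> = degree W"
      using W0 by (metis degree_add_eq_left degree_minus degree_pCons_0 diff_conv_add_uminus)
    finally show ?thesis .
  qed
  with \<open>degree W \<le> d\<close> have degW: "degree W = d" by simp
  have fib: "finite (cl z) \<and> card (cl z) = degree W \<and> (\<forall>y\<in>cl z. poly W y = poly W z)" if "z \<notin> - N" for z
    using fin card[of z] Wcl[of z] that degW by simp
  \<comment> \<open>A priori \<open>Q\<close> is constant on a class only up to constants of integration; averaging over the class kills them.\<close>
  define E where "E z = (\<Sum>y\<in>cl z. poly Q z - poly Q y)" for z
  have E': "(E has_field_derivative 0) (at z)" if "z \<in> N" for z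
  proof -
    obtain V v where V: "open V" "z \<in> V" "\<And>x. x \<in> V \<Longrightarrow> bij_betw (\<lambda>y. v y x) (cl z) (cl x)"
      "\<And>y x. y \<in> cl z \<Longrightarrow> x \<in> V \<Longrightarrow>
         (v y has_field_derivative poly (pderiv P) x / poly (pderiv P) (v y x)) (at x)"
      using around[OF \<open>z \<in> N\<close>] by metis
    have "((\<lambda>x. \<Sum>y\<in>cl z. poly Q x - poly Q (v y x)) has_field_derivative (\<Sum>y\<in>cl z. 0)) (at z)"
    proof (rule DERIV_sum)
      fix y assume y: "y \<in> cl z"
      have "v y z \<in> cl z" using V(3)[OF V(2)] y bij_betwE by blast
      \<comment> \<open>Only the order 0 part of the germ is needed here: \<open>Q' / P'\<close>
        agrees at \<open>z\<close> and \<open>v y z\<close>, and \<open>P'\<close> cancels against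
        the derivative of \<open>v y\<close>.\<close>
      then have "(fibre_deriv P ^^ 0) f (v y z) = (fibre_deriv P ^^ 0) f z"
        unfolding cl_def germ_class_def by blast
      then have "poly (pderiv Q) (v y z) / poly (pderiv P) (v y z) = poly (pderiv Q) z / poly (pderiv P) z"
        by (simp add: f_def)
      moreover have "poly (pderiv P) z \<noteq> 0"
        using \<open>z \<in> N\<close> by (simp add: N_def regular_points_def noncritical_pderiv)
      ultimately have "poly (pderiv Q) (v y z) * (poly (pderiv P) z / poly (pderiv P) (v y z)) = poly (pderiv Q) z"
        by (simp add: field_simps)
      then show "((\<lambda>x. poly Q x - poly Q (v y x)) has_field_derivative 0) (at z)"
        using DERIV_diff[OF poly_DERIV DERIV_chain2[OF poly_DERIV V(4)[OF y V(2)]], of Q Q] by simp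
    qed
    moreover have "(\<Sum>y\<in>cl z. poly Q x - poly Q (v y x)) = E x" if "x \<in> V" for x
      unfolding E_def by (rule sum.reindex_bij_betw[OF V(3)[OF that]])
    ultimately show ?thesis
      using has_field_derivative_transform_within_open[OF _ V(1,2)] by simp
  qed
  have "E constant_on N"
    using N(1,2) E' by (intro has_field_derivative_0_imp_constant_on) auto
  then obtain e where e: "\<And>z. z \<in> N \<Longrightarrow> E z = e"
    by (auto simp: constant_on_def)
  have Qcl: "poly Q y = poly Q z" if "z \<notin> - N" "y \<in> cl z" for z y
  proof -
    have E: "E x = of_nat d * poly Q x - (\<Sum>y\<in>cl x. poly Q y)" if "x \<in> N" for x
      unfolding E_def using card[OF that] by (simp add: sum_subtractf)
    have "z \<in> N" using that by simp
    moreover have "y \<in> N" using clN[OF that(2) \<open>z \<in> N\<close>] .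
    ultimately have "of_nat d * poly Q y = of_nat d * poly Q z"
      using E[of y] E[of z] e[of y] e[of z] cleq[OF that(2)] by simp
    then show ?thesis using d by simp
  qed
  obtain Pt where "P = pcompose Pt W"
    using pcompose_of_constant_on_fibres[OF W0 N(3) N(3) fib, of P]
    by (auto simp: cl_def dest: germ_class_poly)
  moreover obtain Qt where "Q = pcompose Qt W"
    using pcompose_of_constant_on_fibres[OF W0 N(3) N(3) fib Qcl] by auto
  moreover have "degree W > 1" using d degW by simp
  ultimately show ?thesis by blast
qed

section \<open>Jumps of logarithms\<close>

text \<open>The values lie in the discrete set of multiples of \<open>2 * pi * \<i>\<close>.\<close>

lemma exp_eq_one_imp_constant:
  fixes h :: "'a::topological_space \<Rightarrow> complex"
  assumes "connected S" "continuous_on S h" "\<And>z. z \<in> S \<Longrightarrow> exp (h z) = 1"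
  obtains c where "exp c = 1" "\<And>z. z \<in> S \<Longrightarrow> h z = c"
proof -
  have "h constant_on S"
  proof (rule continuous_discrete_range_constant[OF assms(1,2)])
    fix x assume x: "x \<in> S"
    have "2 * pi \<le> norm (h y - h x)" if "y \<in> S" "h y \<noteq> h x" for y
    proof -
      have "exp (h y) = exp (h x)" using assms(3) that x by simp
      then obtain n :: int where n: "h y = h x + (of_int (2 * n) * pi) * \<i>"
        by (auto simp: exp_eq)
      then have "n \<noteq> 0" using that by auto
      then have "1 \<le> \<bar>real_of_int n\<bar>" by linarith
      then show ?thesis using n by (simp add: norm_mult)
    qed
    then show "\<exists>e>0. \<forall>y. y \<in> S \<and> h y \<noteq> h x \<longrightarrow> e \<le> norm (h y - h x)"
      by (intro exI[of _ "2 * pi"]) auto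
  qed
  then obtain c where "\<And>z. z \<in> S \<Longrightarrow> h z = c" by (auto simp: constant_on_def)
  then show ?thesis using that assms(3) by (cases "S = {}") (auto intro: that[of 0])
qed

text \<open>Logarithms arise here from homotopy theory and are only continuous at first, while the
  identity theorem needs holomorphy. Where \<open>g\<close> varies by less than \<open>pi\<close>,
  the quotient \<open>f x / f z\<close> avoids the cut of \<open>Ln\<close>, and \<open>g\<close> is
  the principal branch up to a constant.\<close>

lemma holomorphic_of_continuous_log:
  assumes "open S" "f holomorphic_on S" "continuous_on S g" "\<And>z. z \<in> S \<Longrightarrow> exp (g z) = f z"
  shows "g holomorphic_on S"
proof (rule holomorphic_on_local)
  fix z assume z: "z \<in> S"
  have "\<forall>\<^sub>F x in nhds z. x \<in> S \<and> dist (g x) (g z) < pi"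
  proof (intro eventually_conj)
    show "\<forall>\<^sub>F x in nhds z. x \<in> S" using assms(1) z by (rule eventually_nhds_in_open)
    have "isCont g z" using assms(1,3) z continuous_on_eq_continuous_at by blast
    then show "\<forall>\<^sub>F x in nhds z. dist (g x) (g z) < pi"
      using tendstoD[of g "g z" "nhds z" pi] pi_gt_zero
      by (simp add: isCont_def tendsto_at_iff_tendsto_nhds)
  qed
  then obtain V where V: "open V" "z \<in> V" "\<And>x. x \<in> V \<Longrightarrow> x \<in> S \<and> dist (g x) (g z) < pi"
    unfolding eventually_nhds by blast
  have Im: "\<bar>Im (g x - g z)\<bar> < pi" if "x \<in> V" for x
    using V(3)[OF that] abs_Im_le_cmod[of "g x - g z"] by (simp add: dist_norm)
  have eq: "g x = g z + Ln (f x / f z)" if "x \<in> V" for x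
  proof -
    have "f x / f z = exp (g x - g z)"
      using assms(4)[of x] assms(4)[OF z] V(3)[OF that] by (simp add: exp_diff)
    then show ?thesis using Im[OF that] by (simp add: Ln_exp abs_less_iff)
  qed
  have "f x / f z \<notin> \<real>\<^sub>\<le>\<^sub>0" if "x \<in> V" for x
  proof
    assume "f x / f z \<in> \<real>\<^sub>\<le>\<^sub>0"
    moreover have ex: "f x / f z = exp (g x - g z)"
      using assms(4)[of x] assms(4)[OF z] V(3)[OF that] by (simp add: exp_diff)
    ultimately have "Im (Ln (f x / f z)) = pi"
      by (metis Im_Ln_eq_pi complex_nonpos_Reals_iff exp_not_eq_zero le_less complex_eq_iff zero_complex.sel)
    then show False using Im[OF that] ex by (simp add: Ln_exp abs_less_iff)
  qed
  moreover have "f holomorphic_on V" using assms(2) V(3) holomorphic_on_subset by blast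
  moreover have "f z \<noteq> 0" using assms(4)[OF z] by (metis exp_not_eq_zero)
  ultimately have "(\<lambda>x. g z + Ln (f x / f z)) holomorphic_on V"
    by (intro holomorphic_intros) auto
  with V(1,2) eq show "\<exists>V k. open V \<and> z \<in> V \<and> k holomorphic_on V \<and> (\<forall>x\<in>V. g x = k x)"
    by blast
qed

text \<open>Moving \<open>p\<close> to \<open>p'\<close> along a path inside \<open>E\<close>
  deforms the quotient to the constant 1 without zeros off \<open>E\<close>, so it is inessential
  there and has a logarithm.\<close>

lemma log_ratio_off_path_connected:
  fixes p p' :: complex
  assumes "path_connected E" "p \<in> E" "p' \<in> E"
  obtains g where "continuous_on (- E) g" "\<And>z. z \<notin> E \<Longrightarrow> exp (g z) = (z - p) / (z - p')"
proof -
  obtain \<delta> where d: "path \<delta>" "path_image \<delta> \<subseteq> E" "pathstart \<delta> = p" "pathfinish \<delta> = p'"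
    using assms(1)[unfolded path_connected_def, rule_format, OF assms(2,3)] by blast
  define h where "h = (\<lambda>x. (snd x - (\<delta> \<circ> fst) x) / (snd x - p'))"
  have "continuous_on ({0..1} \<times> (- E)) h"
    unfolding h_def using d assms by (intro continuous_intros) (auto simp: path_defs)
  moreover have "h \<in> ({0..1} \<times> (- E)) \<rightarrow> - {0}"
    unfolding h_def using d assms by (auto simp: path_defs)
  ultimately have "homotopic_with_canon (\<lambda>x. True) (- E) (- {0}) (\<lambda>z. h (0, z)) (\<lambda>z. h (1, z))"
    by (auto simp: homotopic_with_def)
  then have "homotopic_with_canon (\<lambda>x. True) (- E) (- {0}) (\<lambda>z. h (0, z)) (\<lambda>z. 1)"
    by (rule homotopic_with_eq) (use d assms in \<open>auto simp: h_def path_defs\<close>)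
  then obtain g where "continuous_on (- E) g" "\<forall>z\<in>- E. h (0, z) = exp (g z)"
    using inessential_eq_continuous_logarithm[of "- E" "\<lambda>z. h (0, z)"] by metis
  then show ?thesis
    using that[of g] d by (auto simp: h_def path_defs)
qed

text \<open>Around the circle a branch would return to its initial value, while the winding number 1
  forces the increment \<open>2 * pi * \<i>\<close>.\<close>

lemma no_log_on_sphere:
  fixes p :: complex
  assumes "R > 0" "continuous_on (sphere p R) g" "\<And>z. z \<in> sphere p R \<Longrightarrow> exp (g z) = z - p"
  shows False
proof -
  define \<omega> where "\<omega> = circlepath p R"
  have \<omega>: "path \<omega>" "path_image \<omega> = sphere p R" "pathstart \<omega> = pathfinish \<omega>"
    using assms(1) by (auto simp: \<omega>_def)
  have "p \<notin> path_image \<omega>" using assms(1) \<omega> by simp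
  then obtain q where q: "path q" "pathfinish q - pathstart q = 2 * of_real pi * \<i> * winding_number \<omega> p"
    "\<And>t. t \<in> {0..1} \<Longrightarrow> \<omega> t = p + exp (q t)"
    using winding_number_as_continuous_log[OF \<omega>(1)] by blast
  have "winding_number \<omega> p = 1"
    unfolding \<omega>_def by (rule winding_number_circlepath_centre[OF assms(1)])
  have om: "\<omega> t \<in> sphere p R" if "t \<in> {0..1}" for t
    using that \<omega>(2) by (auto simp: path_image_def)
  have "continuous_on {0..1} (\<lambda>t. q t - g (\<omega> t))"
    using q(1) \<omega>(1,2) assms(2)
    by (intro continuous_intros continuous_on_compose2[OF assms(2)]) (auto simp: path_def path_image_def)
  moreover have "exp (q t - g (\<omega> t)) = 1" if "t \<in> {0..1}" for t
    using q(3)[OF that] assms(3)[OF om[OF that]] by (simp add: exp_diff)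
  ultimately obtain c where c: "\<And>t. t \<in> {0..1} \<Longrightarrow> q t - g (\<omega> t) = c"
    using exp_eq_one_imp_constant[OF connected_Icc, of 0 1 "\<lambda>t. q t - g (\<omega> t)"] by metis
  have "q 1 - q 0 = g (\<omega> 1) - g (\<omega> 0)" using c[of 0] c[of 1] by (simp add: algebra_simps)
  also have "\<dots> = 0" using \<omega>(3) by (simp add: path_defs)
  finally show False
    using q(2) \<open>winding_number \<omega> p = 1\<close> by (simp add: path_defs)
qed

text \<open>
  If the logarithm existed, then cutting it off near \<open>K2\<close> would interpolate between \<open>z - p2\<close> near \<open>K1\<close> and
  \<open>z - p1\<close> near \<open>K2\<close> by a function without zeros in the plane, whose winding number along a large circle is 1.
\<close>

lemma no_log_separating:
  fixes K1 K2 :: "complex set"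
  assumes "compact K1" "compact K2" "K1 \<inter> K2 = {}" "p1 \<in> K1" "p2 \<in> K2"
    and cont: "continuous_on (- (K1 \<union> K2)) \<Lambda>"
    and log: "\<And>z. z \<notin> K1 \<union> K2 \<Longrightarrow> exp (\<Lambda> z) = (z - p2) / (z - p1)"
  shows False
proof -
  define K where "K = K1 \<union> K2"
  obtain \<psi> :: "complex \<Rightarrow> real" where \<psi>: "continuous_on UNIV \<psi>" "\<And>x. x \<in> K1 \<Longrightarrow> \<psi> x = 0" "\<And>x. x \<in> K2 \<Longrightarrow> \<psi> x = 1"
    using Urysohn[of K1 K2 0 1] assms(1-3) compact_imp_closed by metis
  \<comment> \<open>Stretching the middle third of \<open>\<psi>\<close> makes the cutoff constant
    on open neighbourhoods of \<open>K1\<close> and \<open>K2\<close>, not only on the sets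
    themselves; this gives continuity of \<open>F\<close> there.\<close>
  define \<phi> where "\<phi> x = min 1 (max 0 (3 * \<psi> x - 1))" for x
  have \<phi>: "continuous_on A \<phi>" for A
    unfolding \<phi>_def by (intro continuous_intros continuous_on_subset[OF \<psi>(1)]) auto
  define V1 where "V1 = {x. \<psi> x < 1 / 3} - K2"
  define V2 where "V2 = {x. \<psi> x > 2 / 3} - K1"
  have op: "open V1" "open V2" "open (- K)"
  proof -
    have "closed K1" "closed K2" using assms(1,2) by (auto intro: compact_imp_closed)
    moreover have "open {x. \<psi> x < 1 / 3}" "open {x. \<psi> x > 2 / 3}"
      by (rule open_Collect_less[OF \<psi>(1) continuous_on_const] open_Collect_less[OF continuous_on_const \<psi>(1)])+
    ultimately show "open V1" "open V2" "open (- K)"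
      unfolding V1_def V2_def K_def by (auto intro: open_Diff simp: open_Compl closed_Un)
  qed
  \<comment> \<open>Cutoff 0 turns the last formula into \<open>z - p2\<close>, cutoff 1 into
    \<open>z - p1\<close>. Each linear factor is thus used near the compact set that does not
    contain its zero.\<close>
  define F where "F z = (if z \<in> K1 then z - p2 else if z \<in> K2 then z - p1
      else (z - p1) * exp (complex_of_real (1 - \<phi> z) * \<Lambda> z))" for z
  have F1: "F z = z - p2" if "z \<in> V1" for z
  proof (cases "z \<in> K1")
    case False
    then have "z \<notin> K1 \<union> K2" "\<phi> z = 0" using that by (auto simp: V1_def \<phi>_def)
    moreover have "z \<noteq> p1" using False assms by auto
    ultimately show ?thesis using log[of z] by (simp add: F_def)
  qed (simp add: F_def)
  have F2: "F z = z - p1" if "z \<in> V2" for z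
  proof (cases "z \<in> K2")
    case False
    then have "z \<notin> K1 \<union> K2" "\<phi> z = 1" using that by (auto simp: V2_def \<phi>_def)
    then show ?thesis by (simp add: F_def)
  qed (use that in \<open>auto simp: F_def V2_def\<close>)
  have F3: "F z = (z - p1) * exp (complex_of_real (1 - \<phi> z) * \<Lambda> z)" if "z \<notin> K" for z
    using that by (simp add: F_def K_def)
  have "continuous_on V1 F"
    by (subst continuous_on_cong[OF refl F1]) (auto intro!: continuous_intros)
  moreover have "continuous_on V2 F"
    by (subst continuous_on_cong[OF refl F2]) (auto intro!: continuous_intros)
  moreover have "continuous_on (- K) F"
    using cont by (subst continuous_on_cong[OF refl F3]) (auto intro!: continuous_intros \<phi> simp: K_def)
  ultimately have "continuous_on (V1 \<union> V2 \<union> - K) F"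
    using op by (intro continuous_on_open_Un open_Un)
  moreover have "V1 \<union> V2 \<union> - K = UNIV"
    using \<psi>(2,3) assms(3) by (auto simp: V1_def V2_def K_def)
  ultimately have "continuous_on UNIV F" by simp
  moreover have "F z \<noteq> 0" for z
    using assms(3-5) by (auto simp: F_def)
  ultimately obtain \<mu> where \<mu>: "continuous_on UNIV \<mu>" "\<And>z. F z = exp (\<mu> z)"
    using continuous_logarithm_on_contractible[of UNIV F] contractible_UNIV by auto
  have "bounded (insert p1 K)" using assms(1,2) by (simp add: K_def compact_imp_bounded)
  then obtain R where R: "R > 0" "insert p1 K \<subseteq> ball p1 R"
    by (metis bounded_subset_ballD)
  show False
  proof (rule no_log_on_sphere[OF R(1)])
    show "continuous_on (sphere p1 R) (\<lambda>z. \<mu> z - complex_of_real (1 - \<phi> z) * \<Lambda> z)"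
      using R(2) by (intro continuous_intros \<phi> continuous_on_subset[OF \<mu>(1)] continuous_on_subset[OF cont])
        (auto simp: K_def)
    show "exp (\<mu> z - complex_of_real (1 - \<phi> z) * \<Lambda> z) = z - p1" if "z \<in> sphere p1 R" for z
    proof -
      have "z \<notin> K" using R(2) that by auto
      then show ?thesis using F3[of z] \<mu>(2)[of z] by (simp add: exp_diff)
    qed
  qed
qed

text \<open>
  \<open>U\<close> and \<open>D\<close> are connected, but \<open>U \<inter> D\<close> need not be: \<open>j\<close> compares the branches of \<open>log h\<close> on \<open>U\<close> and on \<open>D\<close> at
  two points of \<open>U \<inter> D\<close>, as the winding number of \<open>h\<close> along a loop through \<open>x\<close> and \<open>y\<close> would do.
\<close>

definition log_jump ::
  "complex set \<Rightarrow> complex set \<Rightarrow> complex \<Rightarrow> complex \<Rightarrow> (complex \<Rightarrow> complex) \<Rightarrow> complex \<Rightarrow> bool" where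
  "log_jump U D x y h j \<longleftrightarrow> (\<exists>\<Lambda> \<mu>. continuous_on U \<Lambda> \<and> continuous_on D \<mu> \<and>
     (\<forall>w\<in>U. exp (\<Lambda> w) = h w) \<and> (\<forall>w\<in>D. exp (\<mu> w) = h w) \<and> j = (\<Lambda> x - \<mu> x) - (\<Lambda> y - \<mu> y))"

lemma log_jumpI:
  assumes "continuous_on U \<Lambda>" "continuous_on D \<mu>"
    "\<And>w. w \<in> U \<Longrightarrow> exp (\<Lambda> w) = h w" "\<And>w. w \<in> D \<Longrightarrow> exp (\<mu> w) = h w"
  shows "log_jump U D x y h ((\<Lambda> x - \<mu> x) - (\<Lambda> y - \<mu> y))"
  unfolding log_jump_def using assms
  by (intro exI[of _ \<Lambda>] exI[of _ \<mu>] conjI ballI refl)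

text \<open>Another branch on \<open>U\<close> or on \<open>D\<close> differs by a constant, as both
  sets are connected, and the constants cancel between \<open>x\<close> and
  \<open>y\<close>.\<close>

lemma log_jump_unique:
  assumes "connected U" "connected D" "x \<in> U \<inter> D" "y \<in> U \<inter> D"
    and "log_jump U D x y h j" "log_jump U D x y h j'"
  shows "j = j'"
proof -
  obtain \<Lambda> \<mu> where 1: "continuous_on U \<Lambda>" "continuous_on D \<mu>"
     "\<And>w. w \<in> U \<Longrightarrow> exp (\<Lambda> w) = h w" "\<And>w. w \<in> D \<Longrightarrow> exp (\<mu> w) = h w" "j = (\<Lambda> x - \<mu> x) - (\<Lambda> y - \<mu> y)"
    using assms(5) unfolding log_jump_def by blast
  obtain \<Lambda>' \<mu>' where 2: "continuous_on U \<Lambda>'" "continuous_on D \<mu>'"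
     "\<And>w. w \<in> U \<Longrightarrow> exp (\<Lambda>' w) = h w" "\<And>w. w \<in> D \<Longrightarrow> exp (\<mu>' w) = h w" "j' = (\<Lambda>' x - \<mu>' x) - (\<Lambda>' y - \<mu>' y)"
    using assms(6) unfolding log_jump_def by blast
  have "exp (\<Lambda> w - \<Lambda>' w) = 1" if "w \<in> U" for w
  proof -
    have "exp (\<Lambda> w) = exp (\<Lambda>' w)" using 1(3) 2(3) that by simp
    then show ?thesis by (simp add: exp_diff)
  qed
  moreover have "continuous_on U (\<lambda>w. \<Lambda> w - \<Lambda>' w)" by (intro continuous_intros 1 2)
  ultimately obtain c where c: "\<And>w. w \<in> U \<Longrightarrow> \<Lambda> w - \<Lambda>' w = c"
    using exp_eq_one_imp_constant[OF assms(1), of "\<lambda>w. \<Lambda> w - \<Lambda>' w"] by metis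
  have "exp (\<mu> w - \<mu>' w) = 1" if "w \<in> D" for w
  proof -
    have "exp (\<mu> w) = exp (\<mu>' w)" using 1(4) 2(4) that by simp
    then show ?thesis by (simp add: exp_diff)
  qed
  moreover have "continuous_on D (\<lambda>w. \<mu> w - \<mu>' w)" by (intro continuous_intros 1 2)
  ultimately obtain e where e: "\<And>w. w \<in> D \<Longrightarrow> \<mu> w - \<mu>' w = e"
    using exp_eq_one_imp_constant[OF assms(2), of "\<lambda>w. \<mu> w - \<mu>' w"] by metis
  have "j - j' = (\<Lambda> x - \<Lambda>' x) - (\<mu> x - \<mu>' x) - ((\<Lambda> y - \<Lambda>' y) - (\<mu> y - \<mu>' y))"
    unfolding 1(5) 2(5) by (simp add: algebra_simps)
  also have "\<dots> = (c - e) - (c - e)"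
    using c[of x] c[of y] e[of x] e[of y] assms(3,4) by simp
  finally show ?thesis by simp
qed

lemma log_jump_divide:
  assumes "log_jump U D x y h j" "log_jump U D x y h' j'"
  shows "log_jump U D x y (\<lambda>w. h w / h' w) (j - j')"
proof -
  obtain \<Lambda> \<mu> where 1: "continuous_on U \<Lambda>" "continuous_on D \<mu>"
     "\<And>w. w \<in> U \<Longrightarrow> exp (\<Lambda> w) = h w" "\<And>w. w \<in> D \<Longrightarrow> exp (\<mu> w) = h w" "j = (\<Lambda> x - \<mu> x) - (\<Lambda> y - \<mu> y)"
    using assms(1) unfolding log_jump_def by blast
  obtain \<Lambda>' \<mu>' where 2: "continuous_on U \<Lambda>'" "continuous_on D \<mu>'"
     "\<And>w. w \<in> U \<Longrightarrow> exp (\<Lambda>' w) = h' w" "\<And>w. w \<in> D \<Longrightarrow> exp (\<mu>' w) = h' w" "j' = (\<Lambda>' x - \<mu>' x) - (\<Lambda>' y - \<mu>' y)"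
    using assms(2) unfolding log_jump_def by blast
  have "log_jump U D x y (\<lambda>w. h w / h' w)
      (((\<Lambda> x - \<Lambda>' x) - (\<mu> x - \<mu>' x)) - ((\<Lambda> y - \<Lambda>' y) - (\<mu> y - \<mu>' y)))"
    by (rule log_jumpI[where \<Lambda> = "\<lambda>w. \<Lambda> w - \<Lambda>' w" and \<mu> = "\<lambda>w. \<mu> w - \<mu>' w"])
       (auto intro!: continuous_intros 1 2 simp: exp_diff 1 2)
  then show ?thesis by (simp add: 1(5) 2(5) algebra_simps)
qed

lemma log_jump_cong:
  assumes "log_jump U D x y h j" "\<And>w. w \<in> U \<union> D \<Longrightarrow> h w = h' w"
  shows "log_jump U D x y h' j"
  using assms unfolding log_jump_def by auto

lemma log_jump_zero:
  assumes "continuous_on (U \<union> D) \<nu>" "\<And>w. w \<in> U \<union> D \<Longrightarrow> exp (\<nu> w) = h w"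
  shows "log_jump U D x y h 0"
proof -
  have "log_jump U D x y h ((\<nu> x - \<nu> x) - (\<nu> y - \<nu> y))"
    by (rule log_jumpI) (use assms in \<open>auto intro: continuous_on_subset\<close>)
  then show ?thesis by simp
qed

text \<open>Meant for the arcs of the other colours: they lie in the star and avoid the disc, so
  that their tips are as good as the centre \<open>c\<close>.\<close>

lemma log_jump_zero_path_connected:
  assumes "path_connected E" "p \<in> E" "p' \<in> E" "E \<inter> (U \<union> D) = {}"
  shows "log_jump U D x y (\<lambda>w. (w - p) / (w - p')) 0"
proof -
  obtain g where "continuous_on (- E) g" "\<And>z. z \<notin> E \<Longrightarrow> exp (g z) = (z - p) / (z - p')"
    using log_ratio_off_path_connected[OF assms(1-3)] by metis
  moreover have "U \<union> D \<subseteq> - E" using assms(4) by auto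
  ultimately show ?thesis
    by (intro log_jump_zero[where \<nu> = g]) (auto intro: continuous_on_subset)
qed

text \<open>If all jumps vanished, the branches off \<open>S\<close> and on \<open>D\<close> would
  differ by one constant on the overlap and could be glued to a branch off
  \<open>K1 \<union> K2\<close>, against \<open>no_log_separating\<close>.\<close>

lemma log_jump_nonzero:
  fixes S D K1 K2 :: "complex set"
  assumes S: "compact S" and conn: "path_connected S" and D: "open D" "convex D"
    and K: "compact K1" "compact K2" "K1 \<inter> K2 = {}" "p1 \<in> K1" "p2 \<in> K2" "S - D = K1 \<union> K2"
  obtains x y j where "x \<in> D - S" "y \<in> D - S" "j \<noteq> 0"
    "log_jump (- S) D x y (\<lambda>w. (w - p2) / (w - p1)) j"
proof -
  define f where "f w = (w - p2) / (w - p1)" for w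
  have pS: "p1 \<in> S" "p2 \<in> S" "p1 \<notin> D" "p2 \<notin> D" using K by auto
  obtain \<Lambda> where \<Lambda>: "continuous_on (- S) \<Lambda>" "\<And>w. w \<notin> S \<Longrightarrow> exp (\<Lambda> w) = f w"
    using log_ratio_off_path_connected[OF conn pS(2,1)] unfolding f_def by metis
  have fD: "continuous_on D f" "\<And>w. w \<in> D \<Longrightarrow> f w \<noteq> 0"
    unfolding f_def using pS by (auto intro!: continuous_intros)
  obtain \<mu> where \<mu>: "continuous_on D \<mu>" "\<And>w. w \<in> D \<Longrightarrow> f w = exp (\<mu> w)"
    using continuous_logarithm_on_contractible[OF fD(1) convex_imp_contractible[OF D(2)] fD(2)] by metis
  have "\<exists>x\<in>D - S. \<exists>y\<in>D - S. \<Lambda> x - \<mu> x \<noteq> \<Lambda> y - \<mu> y"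
  proof (rule ccontr)
    assume const: "\<not> ?thesis"
    obtain k where k: "exp k = 1" "\<And>w. w \<in> D - S \<Longrightarrow> \<Lambda> w - \<mu> w = k"
    proof (cases "D - S = {}")
      case True
      \<comment> \<open>With empty overlap any period serves for the gluing, so that a disc inside
        \<open>S\<close> is refuted in the same way.\<close>
      then show ?thesis using that[of 0] by auto
    next
      case False
      then obtain w0 where w0: "w0 \<in> D - S" by blast
      then have "exp (\<Lambda> w0 - \<mu> w0) = 1"
        using \<Lambda>(2)[of w0] \<mu>(2)[of w0] by (simp add: exp_diff)
      then show ?thesis using that const w0 by blast
    qed
    define \<nu> where "\<nu> w = (if w \<in> D then \<mu> w + k else \<Lambda> w)" for w
    have "continuous_on D \<nu>"
      using \<mu>(1) by (subst continuous_on_cong[OF refl, of _ _ "\<lambda>w. \<mu> w + k"]) (auto simp: \<nu>_def intro!: continuous_intros)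
    moreover have \<nu>\<Lambda>: "\<nu> w = \<Lambda> w" if "w \<in> - S" for w
      using k(2)[of w] that by (auto simp: \<nu>_def algebra_simps)
    have "continuous_on (- S) \<nu>"
      using \<Lambda>(1) by (subst continuous_on_cong[OF refl \<nu>\<Lambda>]) auto
    ultimately have "continuous_on (D \<union> - S) \<nu>"
      using D(1) S by (intro continuous_on_open_Un) (auto simp: open_Compl compact_imp_closed)
    moreover have "D \<union> - S = - (K1 \<union> K2)" using K(6) by blast
    ultimately have "continuous_on (- (K1 \<union> K2)) \<nu>" by simp
    moreover have "exp (\<nu> w) = (w - p2) / (w - p1)" if "w \<notin> K1 \<union> K2" for w
    proof (cases "w \<in> D")
      case True
      then show ?thesis using \<mu>(2)[of w] k(1) by (simp add: \<nu>_def exp_add f_def)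
    next
      case False
      then have "w \<notin> S" using that K(6) by blast
      then show ?thesis using False \<Lambda>(2)[of w] by (simp add: \<nu>_def f_def)
    qed
    ultimately show False by (rule no_log_separating[OF K(1-5)])
  qed
  then obtain x y where xy: "x \<in> D - S" "y \<in> D - S" "\<Lambda> x - \<mu> x \<noteq> \<Lambda> y - \<mu> y" by blast
  show ?thesis
  proof (rule that[OF xy(1,2)])
    show "(\<Lambda> x - \<mu> x) - (\<Lambda> y - \<mu> y) \<noteq> 0" using xy(3) by simp
    show "log_jump (- S) D x y (\<lambda>w. (w - p2) / (w - p1)) ((\<Lambda> x - \<mu> x) - (\<Lambda> y - \<mu> y))"
      by (rule log_jumpI) (use \<Lambda> \<mu> in \<open>auto simp: f_def\<close>)
  qed
qed

section \<open>Moments and partial fractions\<close>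

text \<open>Geometric series of \<open>1 / (P - t)\<close> in powers of \<open>P / t\<close>.
  Subtracting \<open>m\<close> terms, whose integrals are moments, leaves the integrand times
  \<open>(P / t) ^ m\<close>, and its integral tends to 0 with growing \<open>m\<close>.\<close>

lemma moments_imp_cauchy_transform_zero:
  fixes P q :: "complex poly"
  assumes mom: "\<And>i::nat. contour_integral (linepath a b) (\<lambda>z. poly P z ^ i * poly q z) = 0"
    and M: "\<And>z. z \<in> closed_segment a b \<Longrightarrow> norm (poly P z) \<le> M" and t: "norm t > M"
  shows "contour_integral (linepath a b) (\<lambda>z. poly q z / (poly P z - t)) = 0"
proof -
  have "0 \<le> norm (poly P a)" by simp
  also have "\<dots> \<le> M" by (rule M) simp
  finally have M0: "M \<ge> 0" .
  have t0: "t \<noteq> 0" using t M0 by auto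
  have ne: "poly P z \<noteq> t" if "z \<in> closed_segment a b" for z
    using M[OF that] t by auto
  define g where "g = (\<lambda>z. poly q z / (poly P z - t))"
  have gc: "continuous_on (closed_segment a b) g"
    unfolding g_def using ne by (intro continuous_intros) auto
  then have "bounded (g ` closed_segment a b)"
    by (intro compact_imp_bounded compact_continuous_image) auto
  then obtain C where C: "\<And>z. z \<in> closed_segment a b \<Longrightarrow> norm (g z) \<le> C"
    by (auto simp: bounded_iff)
  have C0: "C \<ge> 0" using C[of a] norm_ge_zero[of "g a"] by (simp del: norm_ge_zero)
  have bound: "norm (contour_integral (linepath a b) g) \<le> (M / norm t) ^ m * C * norm (b - a)" for m
  proof -
    have "((\<lambda>z. - (1 / t ^ Suc i) * (poly P z ^ i * poly q z)) has_contour_integral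
        - (1 / t ^ Suc i) * 0) (linepath a b)" if "i < m" for i
    proof (rule has_contour_integral_lmul)
      have "(\<lambda>z. poly P z ^ i * poly q z) contour_integrable_on linepath a b"
        by (intro contour_integrable_continuous_linepath continuous_intros)
      then show "((\<lambda>z. poly P z ^ i * poly q z) has_contour_integral 0) (linepath a b)"
        using mom[of i] has_contour_integral_integral by force
    qed
    then have S: "((\<lambda>z. \<Sum>i<m. - (1 / t ^ Suc i) * (poly P z ^ i * poly q z)) has_contour_integral
        (\<Sum>i<m. - (1 / t ^ Suc i) * 0)) (linepath a b)"
      by (intro has_contour_integral_sum) auto
    have "g contour_integrable_on linepath a b"
      by (rule contour_integrable_continuous_linepath[OF gc])
    then have "(g has_contour_integral contour_integral (linepath a b) g) (linepath a b)"
      by (rule has_contour_integral_integral)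
    from has_contour_integral_diff[OF this S]
    have *: "((\<lambda>z. g z - (\<Sum>i<m. - (1 / t ^ Suc i) * (poly P z ^ i * poly q z))) has_contour_integral
        contour_integral (linepath a b) g) (linepath a b)" by simp
    show ?thesis
    proof (rule has_contour_integral_bound_linepath[OF * ])
      show "0 \<le> (M / norm t) ^ m * C" using M0 C0 by simp
      fix z assume z: "z \<in> closed_segment a b"
      have "(poly P z / t) ^ m - 1 = (poly P z / t - 1) * (\<Sum>i<m. (poly P z / t) ^ i)"
        by (rule power_diff_1_eq)
      then have "(poly P z / t) ^ m = 1 + (poly P z - t) * (\<Sum>i<m. poly P z ^ i / t ^ Suc i)"
        using t0 by (simp add: sum_distrib_left power_divide field_simps)
      moreover have "g z * (poly P z - t) = poly q z" using ne[OF z] by (simp add: g_def)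
      ultimately have "g z * (poly P z / t) ^ m = g z + poly q z * (\<Sum>i<m. poly P z ^ i / t ^ Suc i)"
        by (simp only: distrib_left mult_1_right mult.assoc[symmetric])
      then have "g z - (\<Sum>i<m. - (1 / t ^ Suc i) * (poly P z ^ i * poly q z)) = g z * (poly P z / t) ^ m"
        by (simp add: sum_distrib_left sum_negf mult_ac)
      then have "norm (g z - (\<Sum>i<m. - (1 / t ^ Suc i) * (poly P z ^ i * poly q z)))
          = norm (g z) * (norm (poly P z) / norm t) ^ m"
        by (simp add: norm_mult norm_power norm_divide)
      also have "\<dots> \<le> C * (M / norm t) ^ m"
        using C[OF z] M[OF z] t M0 C0
        by (intro mult_mono power_mono divide_right_mono) auto
      finally show "norm (g z - (\<Sum>i<m. - (1 / t ^ Suc i) * (poly P z ^ i * poly q z)))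
          \<le> (M / norm t) ^ m * C" by (simp add: mult.commute)
    qed
  qed
  have "(\<lambda>m. (M / norm t) ^ m * C * norm (b - a)) \<longlonglongrightarrow> 0 * C * norm (b - a)"
    using M0 t t0 by (intro tendsto_mult LIMSEQ_power_zero tendsto_const) (simp add: divide_less_eq)
  then have "norm (contour_integral (linepath a b) g) \<le> 0"
    using bound by (intro LIMSEQ_le_const[where x = 0]) auto
  then show ?thesis by (simp add: g_def)
qed

text \<open>Lagrange interpolation on the fibre: \<open>H y\<close> is
  \<open>(P - t) / (X - y)\<close>, which vanishes at the other points of the fibre and has the
  value \<open>P' y\<close> at \<open>y\<close>. Both sides have degree below the number of
  nodes.\<close>

lemma partial_fractions:
  fixes P A :: "complex poly"
  assumes "degree A < degree P" and t: "t \<notin> critical_values P" and z: "poly P z \<noteq> t"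
  shows "poly A z / (poly P z - t) = (\<Sum>y | poly P y = t. (poly A y / poly (pderiv P) y) * (1 / (z - y)))"
proof -
  define Z where "Z = {y. poly P y = t}"
  have degP: "degree P > 0" using assms(1) by simp
  have finZ: "finite Z" unfolding Z_def by (rule poly_eq_finite[OF degP])
  define H where "H y = smult (lead_coeff P) (\<Prod>x\<in>Z - {y}. [:-x, 1:])" for y
  have PH: "P - [:t:] = [:-y, 1:] * H y" if "y \<in> Z" for y
  proof -
    have "(\<Prod>x\<in>Z. [:-x, 1:]) = [:-y, 1:] * (\<Prod>x\<in>Z - {y}. [:-x, 1:])"
      by (rule prod.remove[OF finZ that])
    then show ?thesis
      using noncritical_decompose[OF degP t] by (simp only: H_def Z_def mult_smult_right)
  qed
  have H': "poly (pderiv P) y = poly (H y) y" if "y \<in> Z" for y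
  proof -
    have "pderiv P = pderiv (P - [:t:])" by (simp add: pderiv_diff)
    also have "\<dots> = pderiv ([:-y, 1:] * H y)" by (simp only: PH[OF that])
    also have "poly \<dots> y = poly (H y) y"
      by (simp only: pderiv_mult poly_add poly_mult) (simp add: pderiv_pCons)
    finally show ?thesis .
  qed
  have P'0: "poly (pderiv P) y \<noteq> 0" if "y \<in> Z" for y
    using that t noncritical_pderiv by (auto simp: Z_def)
  have Hz: "poly (H y) x = 0" if "x \<in> Z" "y \<in> Z" "x \<noteq> y" for x y
    using that finZ by (auto simp: H_def poly_prod prod_zero_iff)
  define B where "B = (\<Sum>y\<in>Z. smult (poly A y / poly (pderiv P) y) (H y))"
  have cardZ: "card Z = degree P"
    unfolding Z_def by (rule noncritical_card[OF degP t])
  have "A = B"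
  proof (rule poly_eqI_degree[of Z])
    fix x assume x: "x \<in> Z"
    have "poly B x = (\<Sum>y\<in>Z. (poly A y / poly (pderiv P) y) * poly (H y) x)"
      by (simp add: B_def poly_sum)
    also have "\<dots> = (\<Sum>y\<in>Z. if y = x then poly A x else 0)"
      by (rule sum.cong) (use x Hz H' P'0 in auto)
    also have "\<dots> = poly A x" using x finZ by simp
    finally show "poly A x = poly B x" by simp
    next
    show "card Z > degree A" using assms(1) cardZ by simp
    have "degree (smult (poly A y / poly (pderiv P) y) (H y)) \<le> degree P - 1" if "y \<in> Z" for y
    proof -
      have "degree (smult (poly A y / poly (pderiv P) y) (H y)) \<le> degree (\<Prod>x\<in>Z - {y}. [:-x, 1:])"
        unfolding H_def by (meson degree_smult_le order_trans)
      also have "\<dots> = (\<Sum>x\<in>Z - {y}. degree [:-x, 1:])"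
        by (rule degree_prod_sum_eq) auto
      also have "\<dots> = degree P - 1" using that finZ cardZ by simp
      finally show ?thesis .
    qed
    then have "degree B \<le> degree P - 1"
      unfolding B_def by (intro degree_sum_le finZ)
    then show "card Z > degree B" using degP cardZ by simp
  qed
  moreover have "poly B z = (\<Sum>y\<in>Z. (poly A y / poly (pderiv P) y) * poly (H y) z)"
    by (simp add: B_def poly_sum)
  ultimately have "poly A z = (\<Sum>y\<in>Z. (poly A y / poly (pderiv P) y) * poly (H y) z)"
    by metis
  then have "poly A z / (poly P z - t) = (\<Sum>y\<in>Z. (poly A y / poly (pderiv P) y) * (poly (H y) z / (poly P z - t)))"
    by (simp add: sum_divide_distrib)
  also have "\<dots> = (\<Sum>y\<in>Z. (poly A y / poly (pderiv P) y) * (1 / (z - y)))"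
  proof (rule sum.cong[OF refl])
    fix y assume y: "y \<in> Z"
    have "poly P z - t = poly (P - [:t:]) z" by simp
    also have "\<dots> = (z - y) * poly (H y) z" by (subst PH[OF y]) (simp add: algebra_simps)
    finally have *: "poly P z - t = (z - y) * poly (H y) z" .
    then have "poly (H y) z \<noteq> 0" using z by auto
    then show "(poly A y / poly (pderiv P) y) * (poly (H y) z / (poly P z - t))
        = (poly A y / poly (pderiv P) y) * (1 / (z - y))"
      unfolding * by simp
  qed
  finally show ?thesis by (simp add: Z_def)
qed

text \<open>Division with remainder \<open>q = P * q1 + A\<close>. The part \<open>A\<close> has a
  proper partial fraction expansion; for the rest, \<open>P / (P - t) = 1 + t / (P - t)\<close>
  reduces \<open>q\<close> to \<open>q1\<close>, of smaller degree.\<close>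

lemma cauchy_transform_residues:
  fixes P q :: "complex poly"
  assumes "degree P > 0"
  shows "\<exists>R. \<forall>t. t \<notin> critical_values P \<and> t \<notin> poly P ` closed_segment a b \<longrightarrow>
    contour_integral (linepath a b) (\<lambda>z. poly q z / (poly P z - t)) + poly R t =
    (\<Sum>y | poly P y = t. (poly q y / poly (pderiv P) y) * contour_integral (linepath a b) (\<lambda>z. 1 / (z - y)))"
proof (induction "degree q" arbitrary: q rule: less_induct)
  case less
  have low: "contour_integral (linepath a b) (\<lambda>z. poly A z / (poly P z - t)) =
    (\<Sum>y | poly P y = t. (poly A y / poly (pderiv P) y) * contour_integral (linepath a b) (\<lambda>z. 1 / (z - y)))"
    if A: "degree A < degree P" and t: "t \<notin> critical_values P" "t \<notin> poly P ` closed_segment a b" for A t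
  proof -
    have "((\<lambda>z. \<Sum>y | poly P y = t. (poly A y / poly (pderiv P) y) * (1 / (z - y))) has_contour_integral
      (\<Sum>y | poly P y = t. (poly A y / poly (pderiv P) y) * contour_integral (linepath a b) (\<lambda>z. 1 / (z - y))))
      (linepath a b)"
    proof (intro has_contour_integral_sum has_contour_integral_lmul has_contour_integral_integral
        contour_integrable_continuous_linepath poly_eq_finite[OF assms])
      fix y assume "y \<in> {y. poly P y = t}"
      then have "y \<notin> closed_segment a b" using t by auto
      then show "continuous_on (closed_segment a b) (\<lambda>z. 1 / (z - y))"
        by (intro continuous_intros) auto
    qed
    then have "((\<lambda>z. poly A z / (poly P z - t)) has_contour_integral
      (\<Sum>y | poly P y = t. (poly A y / poly (pderiv P) y) * contour_integral (linepath a b) (\<lambda>z. 1 / (z - y))))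
      (linepath a b)"
      by (rule has_contour_integral_eq) (use partial_fractions[OF A t(1)] t(2) in force)
    then show ?thesis by (rule contour_integral_unique)
  qed
  show ?case
  proof (cases "degree q < degree P")
    case True
    then show ?thesis using low by (intro exI[of _ 0]) auto
  next
    case False
    define q1 where "q1 = q div P"
    define A where "A = q mod P"
    have q: "q = P * q1 + A" by (simp add: q1_def A_def)
    have P0: "P \<noteq> 0" using assms by auto
    have A: "degree A < degree P"
      unfolding A_def using degree_mod_less'[OF P0, of q] assms by (cases "q mod P = 0") auto
    have "degree q1 < degree q"
    proof (cases "q1 = 0")
      case True
      then show ?thesis using False assms by simp
    next
      case q1: False
      then have "degree (P * q1) = degree P + degree q1" using P0 by (rule degree_mult_eq[rotated])
      moreover from this have "degree q = degree (P * q1)"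
        unfolding q using A by (intro degree_add_eq_left) simp
      ultimately show ?thesis using assms by simp
    qed
    from less[OF this] obtain R1 where R1: "\<And>t. t \<notin> critical_values P \<Longrightarrow> t \<notin> poly P ` closed_segment a b \<Longrightarrow>
      contour_integral (linepath a b) (\<lambda>z. poly q1 z / (poly P z - t)) + poly R1 t =
      (\<Sum>y | poly P y = t. (poly q1 y / poly (pderiv P) y) * contour_integral (linepath a b) (\<lambda>z. 1 / (z - y)))"
      by blast
    define k where "k = contour_integral (linepath a b) (poly q1)"
    \<comment> \<open>The new polynomial is \<open>t * R1 - k\<close>: on the fibre
      \<open>q = t * q1 + A\<close>, while the integral on the left has the additional term
      \<open>k\<close>.\<close>
    have "contour_integral (linepath a b) (\<lambda>z. poly q z / (poly P z - t)) + poly ([:0, 1:] * R1 - [:k:]) t =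
      (\<Sum>y | poly P y = t. (poly q y / poly (pderiv P) y) * contour_integral (linepath a b) (\<lambda>z. 1 / (z - y)))"
      if t: "t \<notin> critical_values P" "t \<notin> poly P ` closed_segment a b" for t
    proof -
      have ci: "(\<lambda>z. poly p z / (poly P z - t)) contour_integrable_on linepath a b" for p
        using t(2) by (intro contour_integrable_continuous_linepath continuous_intros) auto
      have "((\<lambda>z. (poly q1 z + t * (poly q1 z / (poly P z - t))) + poly A z / (poly P z - t)) has_contour_integral
        (k + t * contour_integral (linepath a b) (\<lambda>z. poly q1 z / (poly P z - t)))
          + contour_integral (linepath a b) (\<lambda>z. poly A z / (poly P z - t))) (linepath a b)"
        unfolding k_def
        by (intro has_contour_integral_add has_contour_integral_lmul has_contour_integral_integral ci
            contour_integrable_continuous_linepath continuous_intros)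
      then have "((\<lambda>z. poly q z / (poly P z - t)) has_contour_integral
        (k + t * contour_integral (linepath a b) (\<lambda>z. poly q1 z / (poly P z - t)))
          + contour_integral (linepath a b) (\<lambda>z. poly A z / (poly P z - t))) (linepath a b)"
      proof (rule has_contour_integral_eq)
        fix z assume "z \<in> path_image (linepath a b)"
        then have "poly P z - t \<noteq> 0" using t(2) by auto
        then show "poly q1 z + t * (poly q1 z / (poly P z - t)) + poly A z / (poly P z - t)
            = poly q z / (poly P z - t)"
          unfolding q by (simp add: divide_simps) (simp add: algebra_simps)
      qed
      then have *: "contour_integral (linepath a b) (\<lambda>z. poly q z / (poly P z - t)) =
        (k + t * contour_integral (linepath a b) (\<lambda>z. poly q1 z / (poly P z - t)))
          + contour_integral (linepath a b) (\<lambda>z. poly A z / (poly P z - t))"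
        by (rule contour_integral_unique)
      have "(\<Sum>y | poly P y = t. (poly q y / poly (pderiv P) y) * contour_integral (linepath a b) (\<lambda>z. 1 / (z - y)))
        = (\<Sum>y | poly P y = t. t * ((poly q1 y / poly (pderiv P) y) * contour_integral (linepath a b) (\<lambda>z. 1 / (z - y)))
           + (poly A y / poly (pderiv P) y) * contour_integral (linepath a b) (\<lambda>z. 1 / (z - y)))"
        by (rule sum.cong) (auto simp: q add_divide_distrib algebra_simps)
      also have "\<dots> = t * (contour_integral (linepath a b) (\<lambda>z. poly q1 z / (poly P z - t)) + poly R1 t)
          + contour_integral (linepath a b) (\<lambda>z. poly A z / (poly P z - t))"
        unfolding R1[OF t] low[OF A t] sum.distrib sum_distrib_left by (rule refl)
      finally show ?thesis using * by (simp add: algebra_simps)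
    qed
    then show ?thesis by blast
  qed
qed

text \<open>Dividing by \<open>z\<close> keeps \<open>1 - \<zeta> / z\<close> in the right
  half-plane, where the principal logarithm is a primitive.\<close>

lemma contour_integral_reciprocal_linepath:
  assumes "norm a < norm z" "norm b < norm z"
  shows "contour_integral (linepath a b) (\<lambda>\<zeta>. 1 / (\<zeta> - z)) = Ln (1 - b / z) - Ln (1 - a / z)"
proof -
  have z0: "z \<noteq> 0" using assms(1) by auto
  have "((\<lambda>\<zeta>. Ln (1 - \<zeta> / z)) has_field_derivative 1 / (\<zeta> - z)) (at \<zeta> within ball 0 (norm z))"
    if "\<zeta> \<in> ball 0 (norm z)" for \<zeta>
  proof -
    have "norm (\<zeta> / z) < 1" using that z0 by (simp add: norm_divide)
    then have "Re (\<zeta> / z) < 1" using complex_Re_le_cmod[of "\<zeta> / z"] by linarith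
    then have "1 - \<zeta> / z \<notin> \<real>\<^sub>\<le>\<^sub>0" by (auto simp: complex_nonpos_Reals_iff)
    moreover have "\<zeta> \<noteq> z" using that by auto
    ultimately show ?thesis
      using z0 by (auto intro!: derivative_eq_intros simp: field_simps)
  qed
  then have "((\<lambda>\<zeta>. 1 / (\<zeta> - z)) has_contour_integral
      (Ln (1 - pathfinish (linepath a b) / z) - Ln (1 - pathstart (linepath a b) / z))) (linepath a b)"
    using assms by (intro contour_integral_primitive[where S = "ball 0 (norm z)"])
      (auto intro: closed_segment_subset[OF _ _ convex_ball, THEN subsetD])
  then show ?thesis by (simp add: contour_integral_unique)
qed

text \<open>Far out, \<open>l\<close> and the segment integral of \<open>1 / (\<zeta> - z)\<close>
  are both logarithms of \<open>(z - b) / (z - a)\<close> on the connected exterior of a disc, hence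
  differ by a constant. This is \<open>c\<close>; it depends on the branch \<open>l\<close>, which
  is not normalised at infinity.\<close>

lemma moments_imp_log_sum_polynomial:
  fixes P q :: "complex poly"
  assumes "degree P > 0"
    and mom: "\<And>i::nat. contour_integral (linepath a b) (\<lambda>z. poly P z ^ i * poly q z) = 0"
    and "bounded E" and l: "continuous_on (- E) l" "\<And>z. z \<notin> E \<Longrightarrow> exp (l z) = (z - b) / (z - a)"
  obtains c R T where "\<And>t. t \<notin> critical_values P \<Longrightarrow> norm t > T \<Longrightarrow>
    (\<Sum>y | poly P y = t. (poly q y / poly (pderiv P) y) * (l y - c)) = poly R t"
proof -
  have "bounded (E \<union> closed_segment a b)"
    using assms(3) by (simp add: bounded_closed_segment)
  then obtain B where B: "B > 0" "E \<union> closed_segment a b \<subseteq> ball 0 B"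
    by (metis bounded_subset_ballD)
  have nab: "norm a < B" "norm b < B" using B(2) by auto
  define h where "h z = l z - (Ln (1 - b / z) - Ln (1 - a / z))" for z
  have "\<exists>c. \<forall>z\<in>- cball 0 B. h z = c"
  proof -
    have nz: "1 - x / z \<notin> \<real>\<^sub>\<le>\<^sub>0" if "z \<in> - cball 0 B" "norm x < B" for x z :: complex
    proof -
      have "norm (x / z) < 1" using that by (cases "z = 0") (auto simp: norm_divide divide_simps)
      then have "Re (x / z) < 1" using complex_Re_le_cmod[of "x / z"] by linarith
      then show ?thesis by (auto simp: complex_nonpos_Reals_iff)
    qed
    have "continuous_on (- cball 0 B) h"
      unfolding h_def using nz nab B
      by (intro continuous_intros continuous_on_subset[OF l(1)]) auto
    moreover have "exp (h z) = 1" if z: "z \<in> - cball 0 B" for z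
    proof -
      have "z \<noteq> 0" "z \<noteq> a" "z \<noteq> b" "z \<notin> E" using z nab B by auto
      moreover have "1 - b / z \<noteq> 0" "1 - a / z \<noteq> 0"
        using \<open>z \<noteq> 0\<close> \<open>z \<noteq> a\<close> \<open>z \<noteq> b\<close> by (auto simp: field_simps)
      moreover from this have "exp (h z) = exp (l z) / ((1 - b / z) / (1 - a / z))"
        unfolding h_def exp_diff by (simp only: exp_Ln not_False_eq_True)
      moreover have "(1 - b / z) / (1 - a / z) = (z - b) / (z - a)"
        using \<open>z \<noteq> 0\<close> \<open>z \<noteq> a\<close> by (simp add: divide_simps)
      ultimately show ?thesis
        using l(2)[of z] \<open>z \<noteq> a\<close> \<open>z \<noteq> b\<close> by simp
    qed
    moreover have "connected (- cball 0 B :: complex set)"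
      by (rule connected_complement_bounded_convex) auto
    ultimately show ?thesis using exp_eq_one_imp_constant[of "- cball 0 B" h] by metis
  qed
  then obtain c where c: "\<And>z. norm z > B \<Longrightarrow> h z = c" by auto
  obtain S where S: "S > 0" "\<And>z. norm (poly P z) \<le> S * (1 + norm z) ^ degree P"
    using poly_norm_bound by blast
  \<comment> \<open>A bound for \<open>P\<close> on the disc of radius \<open>B\<close>: for
    \<open>norm t > T\<close> the whole fibre lies outside, where \<open>h\<close> is the constant
    \<open>c\<close>.\<close>
  define T where "T = S * (1 + B) ^ degree P"
  have T: "norm (poly P z) \<le> T" if "norm z \<le> B" for z
  proof -
    have "S * (1 + norm z) ^ degree P \<le> S * (1 + B) ^ degree P"
      using S that by (intro mult_left_mono power_mono) auto
    then show ?thesis using S(2)[of z] by (simp add: T_def)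
  qed
  obtain R where R: "\<And>t. t \<notin> critical_values P \<Longrightarrow> t \<notin> poly P ` closed_segment a b \<Longrightarrow>
    contour_integral (linepath a b) (\<lambda>z. poly q z / (poly P z - t)) + poly R t =
    (\<Sum>y | poly P y = t. (poly q y / poly (pderiv P) y) * contour_integral (linepath a b) (\<lambda>z. 1 / (z - y)))"
    using cauchy_transform_residues[OF assms(1)] by blast
  have seg: "norm z < B" if "z \<in> closed_segment a b" for z
    using B(2) that by auto
  have "(\<Sum>y | poly P y = t. (poly q y / poly (pderiv P) y) * (l y - c)) = poly R t"
    if t: "t \<notin> critical_values P" "norm t > T" for t
  proof -
    have "contour_integral (linepath a b) (\<lambda>z. poly q z / (poly P z - t)) = 0"
      by (rule moments_imp_cauchy_transform_zero[OF mom T t(2)]) (use seg in force)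
    moreover have "t \<notin> poly P ` closed_segment a b"
    proof
      assume "t \<in> poly P ` closed_segment a b"
      then obtain z where "z \<in> closed_segment a b" "t = poly P z" by blast
      then show False using T[of z] seg[of z] t(2) by simp
    qed
    ultimately have "poly R t = (\<Sum>y | poly P y = t. (poly q y / poly (pderiv P) y) *
        contour_integral (linepath a b) (\<lambda>z. 1 / (z - y)))"
      using R[OF t(1)] by simp
    also have "\<dots> = (\<Sum>y | poly P y = t. (poly q y / poly (pderiv P) y) * (l y - c))"
    proof (rule sum.cong[OF refl])
      fix y assume "y \<in> {y. poly P y = t}"
      then have "norm y > B" using T[of y] t(2) by (cases "norm y \<le> B") auto
      then have "contour_integral (linepath a b) (\<lambda>z. 1 / (z - y)) = l y - c"
        using c[of y, symmetric] nab by (simp add: contour_integral_reciprocal_linepath h_def)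
      then show "(poly q y / poly (pderiv P) y) * contour_integral (linepath a b) (\<lambda>z. 1 / (z - y))
          = (poly q y / poly (pderiv P) y) * (l y - c)" by simp
    qed
    finally show ?thesis by simp
  qed
  then show ?thesis by (rule that)
qed

section \<open>The jump relation between the sheets\<close>

lemma continuous_on_fibre_sum:
  fixes l :: "complex \<Rightarrow> complex"
  assumes "degree P > 0" "critical_values P \<subseteq> S" "open (- S)" "E \<subseteq> poly P -` S"
    "continuous_on (- E) l"
  shows "continuous_on (- S) (\<lambda>t. \<Sum>y | poly P y = t. l y)"
proof -
  have "isCont (\<lambda>t. \<Sum>y | poly P y = t. l y) w0" if w0: "w0 \<in> - S" for w0
  proof -
    obtain r u where sh: "sheets P w0 r u"
      using sheets_exist[OF assms(1)] assms(2) w0 by blast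
    define V where "V = ball w0 r \<inter> - S"
    have V: "open V" "w0 \<in> V" using assms(3) w0 sheets_pos[OF sh] by (auto simp: V_def)
    have "continuous_on V (\<lambda>t. \<Sum>y | poly P y = w0. l (u y t))"
    proof (intro continuous_on_sum)
      fix y assume y: "y \<in> {y. poly P y = w0}"
      have "continuous_on V (u y)"
        using sheets_holomorphic[OF sh] y by (auto simp: V_def intro: holomorphic_on_imp_continuous_on continuous_on_subset)
      moreover have "u y ` V \<subseteq> - E"
        using sheets_poly[OF sh] y assms(4) by (force simp: V_def)
      ultimately show "continuous_on V (\<lambda>t. l (u y t))"
        by (rule continuous_on_compose2[OF assms(5)])
    qed
    then have "continuous_on V (\<lambda>t. \<Sum>y | poly P y = t. l y)"
      by (subst continuous_on_cong[OF refl sheets_sum[OF sh]]) (auto simp: V_def)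
    then show ?thesis using V continuous_on_eq_continuous_at by blast
  qed
  then show ?thesis by (simp add: continuous_at_imp_continuous_on)
qed

lemma holomorphic_on_fibre_sum:
  fixes h :: "complex \<Rightarrow> complex"
  assumes "degree P > 0" "critical_values P \<subseteq> S" "open (- S)"
    and h: "h holomorphic_on poly P -` (- S)"
  shows "(\<lambda>t. \<Sum>y | poly P y = t. h y) holomorphic_on - S"
proof (rule holomorphic_on_local)
  fix w0 assume w0: "w0 \<in> - S"
  obtain r u where sh: "sheets P w0 r u"
    using sheets_exist[OF assms(1)] assms(2) w0 by blast
  define V where "V = ball w0 r \<inter> - S"
  have V: "open V" "w0 \<in> V" using assms(3) w0 sheets_pos[OF sh] by (auto simp: V_def)
  have "(\<lambda>t. \<Sum>y | poly P y = w0. h (u y t)) holomorphic_on V"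
  proof (intro holomorphic_on_sum)
    fix y assume y: "y \<in> {y. poly P y = w0}"
    have "u y holomorphic_on V"
      using sheets_holomorphic[OF sh] y by (auto simp: V_def intro: holomorphic_on_subset)
    moreover have "u y ` V \<subseteq> poly P -` (- S)"
      using sheets_poly[OF sh] y by (auto simp: V_def)
    ultimately have "h \<circ> u y holomorphic_on V"
      using holomorphic_on_compose_gen[OF _ h] by blast
    then show "(\<lambda>t. h (u y t)) holomorphic_on V" by (simp add: o_def)
  qed
  moreover have "(\<Sum>y | poly P y = t. h y) = (\<Sum>y | poly P y = w0. h (u y t))" if "t \<in> V" for t
    using sheets_sum[OF sh] that by (auto simp: V_def)
  ultimately show "\<exists>V g. open V \<and> w0 \<in> V \<and> g holomorphic_on V \<and>
      (\<forall>t\<in>V. (\<Sum>y | poly P y = t. h y) = g t)"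
    using V by (intro exI[of _ V] exI[of _ "\<lambda>t. \<Sum>y | poly P y = w0. h (u y t)"]) auto
qed

text \<open>Factor \<open>P - w\<close> over its roots and evaluate at \<open>p\<close> and
  \<open>p'\<close>; leading coefficients and signs cancel. This transports a jump upstairs to one
  in the plane of values.\<close>

lemma fibre_product:
  assumes "degree P > 0" "w \<notin> critical_values P"
  shows "(\<Prod>y | poly P y = w. (y - p) / (y - p')) = (w - poly P p) / (w - poly P p')"
proof -
  have ev: "poly P x - w = lead_coeff P * (\<Prod>y | poly P y = w. x - y)" for x
  proof -
    have "poly P x - w = poly (P - [:w:]) x" by simp
    also have "\<dots> = lead_coeff P * (\<Prod>y | poly P y = w. x - y)"
      by (subst noncritical_decompose[OF assms]) (simp add: poly_prod)
    finally show ?thesis .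
  qed
  have "(\<Prod>y | poly P y = w. (y - p) / (y - p')) = (\<Prod>y | poly P y = w. (p - y) / (p' - y))"
    by (rule prod.cong) (auto simp: minus_diff_eq[symmetric, of _ p] minus_diff_eq[symmetric, of _ p']
        simp del: minus_diff_eq)
  also have "\<dots> = (\<Prod>y | poly P y = w. p - y) / (\<Prod>y | poly P y = w. p' - y)"
    by (rule prod_dividef)
  also have "\<dots> = (poly P p - w) / (poly P p' - w)"
    unfolding ev using assms(1) by auto
  also have "\<dots> = (w - poly P p) / (w - poly P p')"
    using minus_divide_divide[of "w - poly P p" "w - poly P p'"] by simp
  finally show ?thesis .
qed

text \<open>
  Only the sheet of \<open>y1\<close> meets \<open>E\<close>, so that the whole jump of the norm \<open>(w - P p) / (w - P p')\<close> of
  \<open>(z - p) / (z - p')\<close> is a jump on that sheet.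
\<close>

lemma sheet_log_jump:
  fixes E S :: "complex set"
  assumes "degree P > 0" and S: "critical_values P \<subseteq> S" "open (- S)" "connected (- S)"
    and E: "E \<subseteq> poly P -` S" "p \<in> E" "p' \<in> E" "open (- E)"
    and l': "continuous_on (- E) l" "\<forall>z. z \<notin> E \<longrightarrow> exp (l z) = (z - p) / (z - p')"
    and sh: "sheets P w0 r u" and y1: "poly P y1 = w0"
    and off': "\<forall>y w. poly P y = w0 \<longrightarrow> y \<noteq> y1 \<longrightarrow> w \<in> ball w0 r \<longrightarrow> u y w \<notin> E"
    and pD: "poly P p \<notin> ball w0 r" "poly P p' \<notin> ball w0 r"
    and xx: "x \<in> ball w0 r - S" "x' \<in> ball w0 r - S"
    and j: "log_jump (- S) (ball w0 r) x x' (\<lambda>w. (w - poly P p) / (w - poly P p')) j"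
  shows "\<exists>m n. (\<forall>y. poly P y = w0 \<longrightarrow> m y holomorphic_on ball w0 r) \<and>
    (\<forall>y w. poly P y = w0 \<longrightarrow> w \<in> ball w0 r - S \<longrightarrow> l (u y w) = m y w + (if y = y1 then n w else 0)) \<and>
    continuous_on (ball w0 r - S) n \<and> (\<forall>w\<in>ball w0 r - S. exp (n w) = 1) \<and> n x - n x' = j"
proof -
  note l = l'(1) l'(2)[rule_format] and off = off'[rule_format]
  define D where "D = ball w0 r"
  have uD: "u y holomorphic_on D" "continuous_on D (u y)" if "poly P y = w0" for y
    using sheets_holomorphic[OF sh that] by (auto simp: D_def intro: holomorphic_on_imp_continuous_on)
  have Pu: "poly P (u y w) = w" if "poly P y = w0" "w \<in> D" for y w
    using sheets_poly[OF sh that(1)] that(2) by (simp add: D_def)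
  define g where "g y w = (u y w - p) / (u y w - p')" for y w
  have ne: "u y w \<noteq> p" "u y w \<noteq> p'" if "poly P y = w0" "w \<in> D" for y w
    using Pu[OF that] pD that by (auto simp: D_def)
  have ghol: "g y holomorphic_on D" if "poly P y = w0" for y
    unfolding g_def using uD[OF that] ne[OF that] by (intro holomorphic_intros) auto
  obtain k where k: "continuous_on D k" "\<And>w. w \<in> D \<Longrightarrow> g y1 w = exp (k w)"
  proof -
    have "continuous_on D (g y1)" using ghol[OF y1] by (rule holomorphic_on_imp_continuous_on)
    moreover have "g y1 w \<noteq> 0" if "w \<in> D" for w using ne[OF y1 that] by (simp add: g_def)
    ultimately show ?thesis
      using continuous_logarithm_on_ball[of w0 r "g y1", folded D_def] that by metis
  qed
  \<comment> \<open>\<open>m y\<close> is a branch on the whole disc. Off the sheet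
    \<open>y1\<close> it is \<open>l\<close> itself, which meets no cut there; on \<open>y1\<close>
    it is an independent branch \<open>k\<close>, and \<open>n\<close> is the period by which
    \<open>l\<close> deviates from it.\<close>
  define m where "m y w = (if y = y1 then k w else l (u y w))" for y w
  define n where "n w = l (u y1 w) - k w" for w
  have mexp: "exp (m y w) = g y w" if "poly P y = w0" "w \<in> D" for y w
    using k(2)[OF that(2)] l(2)[OF off[OF that(1)]] that(2) by (auto simp: m_def g_def D_def)
  have mcont: "continuous_on D (m y)" if "poly P y = w0" for y
  proof (cases "y = y1")
    case True
    then have "m y = k" by (auto simp: m_def)
    then show ?thesis using k(1) by simp
  next
    case False
    then have "m y = (\<lambda>w. l (u y w))" by (auto simp: m_def)
    moreover have "u y ` D \<subseteq> - E" using off[OF that False] by (auto simp: D_def)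
    ultimately show ?thesis using continuous_on_compose2[OF l(1) uD(2)[OF that]] by simp
  qed
  have mhol: "m y holomorphic_on D" if "poly P y = w0" for y
    by (rule holomorphic_of_continuous_log[OF _ ghol[OF that] mcont[OF that] mexp[OF that]])
       (simp_all add: D_def)
  have uE: "u y w \<notin> E" if "poly P y = w0" "w \<in> D - S" for y w
    using E(1) Pu[OF that(1), of w] that(2) by auto
  have ncont: "continuous_on (D - S) n"
  proof -
    have "u y1 ` (D - S) \<subseteq> - E" using uE[OF y1] by auto
    then have "continuous_on (D - S) (\<lambda>w. l (u y1 w))"
      by (intro continuous_on_compose2[OF l(1)] continuous_on_subset[OF uD(2)[OF y1]]) auto
    then show ?thesis
      unfolding n_def by (intro continuous_intros continuous_on_subset[OF k(1)]) auto
  qed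
  have nexp: "exp (n w) = 1" if "w \<in> D - S" for w
  proof -
    have "exp (l (u y1 w)) = g y1 w" using l(2)[OF uE[OF y1 that]] by (simp add: g_def)
    also have "\<dots> = exp (k w)" using k(2) that by simp
    finally show ?thesis by (simp add: n_def exp_diff)
  qed
  have split: "l (u y w) = m y w + (if y = y1 then n w else 0)" for y w
    by (simp add: m_def n_def)
  \<comment> \<open>\<open>L\<close> and \<open>M\<close> are branches of the logarithm of the fibre
    product off the star and on the disc. In \<open>L - M\<close> all sheets but \<open>y1\<close>
    cancel, so the prescribed jump \<open>j\<close> is that of \<open>n\<close>.\<close>
  define L where "L t = (\<Sum>y | poly P y = t. l y)" for t
  define M where "M t = (\<Sum>y | poly P y = w0. m y t)" for t
  have "log_jump (- S) D x x' (\<lambda>w. (w - poly P p) / (w - poly P p')) ((L x - M x) - (L x' - M x'))"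
  proof (rule log_jumpI)
    show "continuous_on (- S) L"
      unfolding L_def using assms(1) S(1,2) E(1) l(1) by (rule continuous_on_fibre_sum)
    show "continuous_on D M"
      unfolding M_def by (intro continuous_on_sum mcont) auto
    show "exp (L w) = (w - poly P p) / (w - poly P p')" if "w \<in> - S" for w
    proof -
      have "exp (L w) = (\<Prod>y | poly P y = w. exp (l y))"
        unfolding L_def by (rule exp_sum) (rule poly_eq_finite[OF assms(1)])
      also have "\<dots> = (\<Prod>y | poly P y = w. (y - p) / (y - p'))"
        by (rule prod.cong) (use l(2) E(1) that in auto)
      also have "\<dots> = (w - poly P p) / (w - poly P p')"
        using S(1) that by (intro fibre_product[OF assms(1)]) auto
      finally show ?thesis .
    qed
    show "exp (M w) = (w - poly P p) / (w - poly P p')" if "w \<in> D" for w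
    proof -
      have "exp (M w) = (\<Prod>y | poly P y = w0. exp (m y w))"
        unfolding M_def by (rule exp_sum) (rule poly_eq_finite[OF assms(1)])
      also have "\<dots> = (\<Prod>y | poly P y = w0. (u y w - p) / (u y w - p'))"
        by (rule prod.cong) (use mexp that in \<open>auto simp: g_def\<close>)
      also have "\<dots> = (\<Prod>y | poly P y = w. (y - p) / (y - p'))"
        using that by (intro prod.reindex_bij_betw[OF sheets_bij[OF sh]]) (simp add: D_def)
      also have "\<dots> = (w - poly P p) / (w - poly P p')"
        using sheets_noncritical[OF sh] that by (intro fibre_product[OF assms(1)]) (auto simp: D_def)
      finally show ?thesis .
    qed
  qed
  then have "j = (L x - M x) - (L x' - M x')"
    using log_jump_unique[OF S(3) _ _ _ j[folded D_def]] xx by (simp add: D_def)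
  moreover have "L w - M w = n w" if "w \<in> D - S" for w
  proof -
    have "L w - M w = (\<Sum>y | poly P y = w0. l (u y w) - m y w)"
      unfolding L_def M_def using sheets_sum[OF sh, of w l] that by (simp add: D_def sum_subtractf)
    also have "\<dots> = (\<Sum>y | poly P y = w0. if y = y1 then n w else 0)"
      by (rule sum.cong) (auto simp: split)
    also have "\<dots> = n w" using y1 poly_eq_finite[OF assms(1)] by simp
    finally show ?thesis .
  qed
  ultimately have "n x - n x' = j" using xx by (simp add: D_def)
  moreover have "\<forall>y. poly P y = w0 \<longrightarrow> m y holomorphic_on D" using mhol by blast
  moreover have "\<forall>y w. poly P y = w0 \<longrightarrow> w \<in> D - S \<longrightarrow> l (u y w) = m y w + (if y = y1 then n w else 0)"
    using split by blast
  moreover have "\<forall>w\<in>D - S. exp (n w) = 1" using nexp by blast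
  ultimately show ?thesis
    using ncont unfolding D_def by (intro exI[of _ m] exI[of _ n] conjI)
qed

text \<open>\<open>E1\<close> and \<open>E2\<close> are the two halves of the path, joined at
  \<open>v\<close>; each enters the disc on at most one sheet. The logarithm is taken as a sum over
  the halves because \<open>sheet_log_jump\<close> handles one sheet at a time.\<close>

theorem sheets_agree:
  fixes P q :: "complex poly" and S E1 E2 :: "complex set"
  defines "f \<equiv> \<lambda>z. poly q z / poly (pderiv P) z"
  assumes P: "degree P > 0"
    and mom: "\<And>i::nat. contour_integral (linepath a b) (\<lambda>z. poly P z ^ i * poly q z) = 0"
    and S: "critical_values P \<subseteq> S" "compact S" "connected (- S)"
    and E1: "E1 \<subseteq> poly P -` S" "a \<in> E1" "v \<in> E1" "compact E1" "path_connected E1"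
    and E2: "E2 \<subseteq> poly P -` S" "v \<in> E2" "b \<in> E2" "compact E2" "path_connected E2"
    and sh: "sheets P w0 r u" and y: "poly P y1 = w0" "poly P y2 = w0" "y1 \<noteq> y2"
    and off1: "\<And>y w. poly P y = w0 \<Longrightarrow> y \<noteq> y1 \<Longrightarrow> w \<in> ball w0 r \<Longrightarrow> u y w \<notin> E1"
    and off2: "\<And>y w. poly P y = w0 \<Longrightarrow> y \<noteq> y2 \<Longrightarrow> w \<in> ball w0 r \<Longrightarrow> u y w \<notin> E2"
    and D: "poly P a \<notin> ball w0 r" "poly P v \<notin> ball w0 r" "poly P b \<notin> ball w0 r"
    and xx: "x \<in> ball w0 r - S" "x' \<in> ball w0 r - S"
    and j1: "log_jump (- S) (ball w0 r) x x' (\<lambda>w. (w - poly P v) / (w - poly P a)) j"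
    and j2: "log_jump (- S) (ball w0 r) x x' (\<lambda>w. (w - poly P b) / (w - poly P v)) (- j)"
    and j: "j \<noteq> 0" and w: "w \<in> ball w0 r"
  shows "f (u y1 w) = f (u y2 w)"
proof -
  have oS: "open (- S)" "open (- E1)" "open (- E2)"
    using S(2) E1(4) E2(4) by (auto simp: open_Compl compact_imp_closed)
  obtain l1 where l1: "continuous_on (- E1) l1" "\<forall>z. z \<notin> E1 \<longrightarrow> exp (l1 z) = (z - v) / (z - a)"
    using log_ratio_off_path_connected[OF E1(5,3,2)] by metis
  obtain l2 where l2: "continuous_on (- E2) l2" "\<forall>z. z \<notin> E2 \<longrightarrow> exp (l2 z) = (z - b) / (z - v)"
    using log_ratio_off_path_connected[OF E2(5,3,2)] by metis
  define E where "E = E1 \<union> E2"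
  define l where "l z = l1 z + l2 z" for z
  have E: "E \<subseteq> poly P -` S" "bounded E" "open (- E)"
    using E1 E2 oS by (auto simp: E_def compact_imp_bounded)
  have l: "continuous_on (- E) l"
    unfolding l_def E_def by (intro continuous_intros continuous_on_subset[OF l1(1)] continuous_on_subset[OF l2(1)]) auto
  have lexp: "exp (l z) = (z - b) / (z - a)" if "z \<notin> E" for z
  proof -
    have "z \<noteq> v" using that E1 by (auto simp: E_def)
    then show ?thesis using that l1(2)[rule_format, of z] l2(2)[rule_format, of z] by (simp add: l_def exp_add E_def)
  qed
  obtain c R T where R: "\<And>t. t \<notin> critical_values P \<Longrightarrow> norm t > T \<Longrightarrow>
      (\<Sum>y | poly P y = t. f y * (l y - c)) = poly R t"
    using moments_imp_log_sum_polynomial[OF P mom E(2) l lexp] unfolding f_def by metis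
  define I where "I t = (\<Sum>y | poly P y = t. f y * (l y - c))" for t
  have fhol: "f holomorphic_on poly P -` (- critical_values P)"
    unfolding f_def using noncritical_pderiv by (auto intro!: holomorphic_intros)
  have lhol: "l holomorphic_on - E"
  proof (rule holomorphic_of_continuous_log[OF E(3) _ l])
    show "(\<lambda>z. (z - b) / (z - a)) holomorphic_on - E"
      using E1 by (intro holomorphic_intros) (auto simp: E_def)
  qed (use lexp in auto)
  have Ihol: "I holomorphic_on - S"
    unfolding I_def
  proof (rule holomorphic_on_fibre_sum[OF P S(1) oS(1)])
    show "(\<lambda>y. f y * (l y - c)) holomorphic_on poly P -` (- S)"
      using S(1) E(1)
      by (intro holomorphic_intros holomorphic_on_subset[OF fhol] holomorphic_on_subset[OF lhol]) auto
  qed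
  \<comment> \<open>Identity theorem: the relation, known for large \<open>t\<close>, spreads over
    the connected complement of the star.\<close>
  have IR: "I t = poly R t" if t: "t \<in> - S" for t
  proof -
    obtain B where B: "S \<subseteq> ball 0 B" using S(2) compact_imp_bounded bounded_subset_ballD by metis
    define V where "V = - cball (0::complex) (max B T)"
    have VS: "V \<subseteq> - S" using B by (auto simp: V_def)
    have "\<exists>z::complex. norm z > max B T"
    proof
      show "norm (of_real (\<bar>max B T\<bar> + 1) :: complex) > max B T"
        unfolding norm_of_real by linarith
    qed
    then obtain z0 :: complex where "norm z0 > max B T" ..
    then have "z0 \<in> V" by (simp only: V_def Compl_iff mem_cball_0 not_le)
    then have "V \<noteq> {}" by blast
    show ?thesis
    proof (rule analytic_continuation_open[OF _ oS(1) \<open>V \<noteq> {}\<close> S(3) VS Ihol _ _ t])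
      show "open V" by (simp add: V_def open_Compl)
      show "poly R holomorphic_on - S" by (intro holomorphic_intros)
      show "I z = poly R z" if "z \<in> V" for z
      proof -
        have "norm z > T" using that by (simp add: V_def max_def split: if_splits)
        moreover have "z \<notin> critical_values P" using that VS S(1) by blast
        ultimately show ?thesis unfolding I_def by (rule R[rotated])
      qed
    qed
  qed
  have off1': "\<forall>y w. poly P y = w0 \<longrightarrow> y \<noteq> y1 \<longrightarrow> w \<in> ball w0 r \<longrightarrow> u y w \<notin> E1"
    using off1 by blast
  from sheet_log_jump[OF P S(1) oS(1) S(3) E1(1,3,2) oS(2) l1 sh y(1) off1' D(2,1) xx j1]
  obtain m1 n1 where m1': "\<forall>y. poly P y = w0 \<longrightarrow> m1 y holomorphic_on ball w0 r"
    and s1': "\<forall>y w. poly P y = w0 \<longrightarrow> w \<in> ball w0 r - S \<longrightarrow>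
      l1 (u y w) = m1 y w + (if y = y1 then n1 w else 0)"
    and n1': "continuous_on (ball w0 r - S) n1" "\<forall>w\<in>ball w0 r - S. exp (n1 w) = 1" "n1 x - n1 x' = j"
    by (elim exE conjE)
  note m1 = m1'[rule_format] and s1 = s1'[rule_format] and n1 = n1'(1) n1'(2)[rule_format] n1'(3)
  have off2': "\<forall>y w. poly P y = w0 \<longrightarrow> y \<noteq> y2 \<longrightarrow> w \<in> ball w0 r \<longrightarrow> u y w \<notin> E2"
    using off2 by blast
  from sheet_log_jump[OF P S(1) oS(1) S(3) E2(1,3,2) oS(3) l2 sh y(2) off2' D(3,2) xx j2]
  obtain m2 n2 where m2': "\<forall>y. poly P y = w0 \<longrightarrow> m2 y holomorphic_on ball w0 r"
    and s2': "\<forall>y w. poly P y = w0 \<longrightarrow> w \<in> ball w0 r - S \<longrightarrow>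
      l2 (u y w) = m2 y w + (if y = y2 then n2 w else 0)"
    and n2': "continuous_on (ball w0 r - S) n2" "\<forall>w\<in>ball w0 r - S. exp (n2 w) = 1" "n2 x - n2 x' = - j"
    by (elim exE conjE)
  note m2 = m2'[rule_format] and s2 = s2'[rule_format] and n2 = n2'(1) n2'(2)[rule_format] n2'(3)
  define g where "g y w = f (u y w)" for y w
  have ghol: "g y holomorphic_on ball w0 r" if "poly P y = w0" for y
  proof -
    have "f \<circ> u y holomorphic_on ball w0 r"
      using sheets_poly[OF sh that] sheets_noncritical[OF sh]
      by (intro holomorphic_on_compose_gen[OF sheets_holomorphic[OF sh that] fhol]) auto
    then show ?thesis by (simp add: g_def [abs_def] o_def)
  qed
  \<comment> \<open>The relation without its jumps. Every term is holomorphic on the full disc, also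
    across the star.\<close>
  define G where "G w = poly R w - (\<Sum>y | poly P y = w0. g y w * (m1 y w + m2 y w - c))" for w
  have Ghol: "G holomorphic_on ball w0 r"
    unfolding G_def by (intro holomorphic_intros ghol m1 m2) auto
  have key: "g y1 w * n1 w + g y2 w * n2 w = G w" if w: "w \<in> ball w0 r - S" for w
  proof -
    have "poly R w = (\<Sum>y | poly P y = w0. g y w * (l (u y w) - c))"
      using IR[of w] sheets_sum[OF sh, of w "\<lambda>y. f y * (l y - c)"] w by (simp add: I_def g_def)
    also have "\<dots> = (\<Sum>y | poly P y = w0. g y w * (m1 y w + m2 y w - c) +
        ((if y = y1 then g y w * n1 w else 0) + (if y = y2 then g y w * n2 w else 0)))"
      by (rule sum.cong) (use s1 s2 w in \<open>auto simp: l_def algebra_simps\<close>)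
    also have "\<dots> = (\<Sum>y | poly P y = w0. g y w * (m1 y w + m2 y w - c)) + (g y1 w * n1 w + g y2 w * n2 w)"
      using y(1,2) poly_eq_finite[OF P] by (simp add: sum.distrib)
    finally show ?thesis by (simp add: G_def)
  qed
  \<comment> \<open>The periods are constant near \<open>z\<close>. Once they are frozen there, both
    sides are holomorphic in \<open>w\<close> on the disc and agree near \<open>z\<close>, hence
    everywhere. So the same \<open>G w\<close> arises from every component of the disc off the star,
    and subtracting the cases \<open>x\<close> and \<open>x'\<close> removes it.\<close>
  have ext: "g y1 w * n1 z + g y2 w * n2 z = G w" if z: "z \<in> ball w0 r - S" for z
  proof -
    have "open (ball w0 r - S)" using oS(1) by (simp add: Diff_eq open_Int)
    then obtain e where e: "e > 0" "ball z e \<subseteq> ball w0 r - S"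
      using z open_contains_ball by blast
    have const: "n t = n z" if n: "continuous_on (ball w0 r - S) n" "\<And>w. w \<in> ball w0 r - S \<Longrightarrow> exp (n w) = 1"
      and t: "t \<in> ball z e" for n :: "complex \<Rightarrow> complex" and t
    proof -
      have "continuous_on (ball z e) n" using n(1) e(2) by (rule continuous_on_subset)
      moreover have "exp (n t) = 1" if "t \<in> ball z e" for t using n(2) e(2) that by blast
      ultimately obtain k where "\<And>t. t \<in> ball z e \<Longrightarrow> n t = k"
        using exp_eq_one_imp_constant[OF connected_ball, of z e n] by metis
      then show ?thesis using t e(1) by simp
    qed
    have ne: "ball z e \<noteq> {}" and sub: "ball z e \<subseteq> ball w0 r" using e by auto
    show ?thesis
    proof (rule analytic_continuation_open[OF open_ball open_ball ne connected_ball sub _ Ghol _ w])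
      show "(\<lambda>w. g y1 w * n1 z + g y2 w * n2 z) holomorphic_on ball w0 r"
        by (intro holomorphic_intros ghol y)
      show "g y1 t * n1 z + g y2 t * n2 z = G t" if "t \<in> ball z e" for t
        using key[of t] const[OF n1(1,2) that] const[OF n2(1,2) that] that e(2) by auto
    qed
  qed
  have "g y1 w * (n1 x - n1 x') + g y2 w * (n2 x - n2 x') = 0"
    using ext[OF xx(1)] ext[OF xx(2)] by (simp add: algebra_simps)
  then have "(g y1 w - g y2 w) * j = 0"
    using n1(3) n2(3) by (simp add: algebra_simps)
  then show ?thesis using j by (simp add: g_def)
qed

section \<open>The extended cactus\<close>

lemma path_image_lift:
  assumes "lift_of P g \<eta>"
  shows "path_image \<eta> \<subseteq> poly P -` path_image g"
  using assms by (auto simp: lift_of_def path_image_def)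

text \<open>\<open>P\<close> is injective near points over noncritical values, so coincidence is
  locally constant along \<open>{0..<1}\<close>; the end follows by continuity. Coincidence at 1
  alone proves nothing, as several lifts may end at one critical point.\<close>

lemma lift_unique:
  assumes "lift_of P g \<eta>" "lift_of P g \<eta>'"
    and nc: "\<And>t. t \<in> {0..<1} \<Longrightarrow> g t \<notin> critical_values P"
    and "t0 \<in> {0..<1}" "\<eta> t0 = \<eta>' t0" "t \<in> {0..1}"
  shows "\<eta> t = \<eta>' t"
proof -
  have cont: "continuous_on {0..1} \<eta>" "continuous_on {0..1} \<eta>'"
    and P: "\<And>t. t \<in> {0..1} \<Longrightarrow> poly P (\<eta> t) = g t" "\<And>t. t \<in> {0..1} \<Longrightarrow> poly P (\<eta>' t) = g t"
    using assms(1,2) by (auto simp: lift_of_def path_def)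
  have eq: "\<eta> t = \<eta>' t" if t: "t \<in> {0..<1}" for t
  proof -
    have "(\<eta> t = \<eta>' t) = (\<eta> t0 = \<eta>' t0)"
    proof (rule connected_local_const[where A = "{0..<1}" and f = "\<lambda>t. \<eta> t = \<eta>' t"])
      show "\<forall>x\<in>{0..<1}. \<forall>\<^sub>F y in at x within {0..<1}. (\<eta> x = \<eta>' x) = (\<eta> y = \<eta>' y)"
      proof
        fix x :: real assume x: "x \<in> {0..<1}"
        define F where "F = at x within {0..<1::real}"
        have lim: "(\<eta> \<longlongrightarrow> \<eta> x) F" "(\<eta>' \<longlongrightarrow> \<eta>' x) F"
        proof -
          have "{0..<1} \<subseteq> {0..1::real}" by auto
          then have "continuous_on {0..<1} \<eta>" "continuous_on {0..<1} \<eta>'"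
            using cont continuous_on_subset by blast+
          then show "(\<eta> \<longlongrightarrow> \<eta> x) F" "(\<eta>' \<longlongrightarrow> \<eta>' x) F"
            using x by (simp_all add: continuous_on_def F_def)
        qed
        have inF: "\<forall>\<^sub>F y in F. y \<in> {0..<1}"
          unfolding F_def by (auto simp: eventually_at_filter)
        have "\<forall>\<^sub>F y in F. (\<eta> x = \<eta>' x) = (\<eta> y = \<eta>' y)"
        proof (cases "\<eta> x = \<eta>' x")
          case True
          have "poly P (\<eta> x) \<notin> critical_values P" using nc[OF x] P x by simp
          then have "deriv (poly P) (\<eta> x) \<noteq> 0"
            using noncritical_pderiv[of P "\<eta> x"] by (simp add: DERIV_imp_deriv[OF poly_DERIV])
          moreover have "poly P holomorphic_on UNIV" by (intro holomorphic_intros)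
          ultimately obtain e where e: "e > 0" "inj_on (poly P) (ball (\<eta> x) e)"
            using has_complex_derivative_locally_injective[of "poly P" UNIV "\<eta> x"] by auto
          have "\<forall>\<^sub>F y in F. dist (\<eta> y) (\<eta> x) < e" "\<forall>\<^sub>F y in F. dist (\<eta>' y) (\<eta>' x) < e"
            using tendstoD[OF lim(1) e(1)] tendstoD[OF lim(2) e(1)] by auto
          with inF show ?thesis
          proof eventually_elim
            case (elim y)
            then have "poly P (\<eta> y) = poly P (\<eta>' y)" using P by simp
            moreover have "\<eta> y \<in> ball (\<eta> x) e" "\<eta>' y \<in> ball (\<eta> x) e"
              using elim True by (auto simp: dist_commute)
            ultimately show ?case using e(2) True by (auto dest: inj_onD)
          qed
        next
          case False
          have "((\<lambda>y. \<eta> y - \<eta>' y) \<longlongrightarrow> \<eta> x - \<eta>' x) F" by (intro tendsto_diff lim)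
          then have "\<forall>\<^sub>F y in F. \<eta> y - \<eta>' y \<noteq> 0"
            using False by (intro tendsto_imp_eventually_ne) auto
          then show ?thesis by eventually_elim (use False in auto)
        qed
        then show "\<forall>\<^sub>F y in at x within {0..<1}. (\<eta> x = \<eta>' x) = (\<eta> y = \<eta>' y)"
          unfolding F_def .
      qed
    qed (use t assms(4) in auto)
    then show ?thesis using assms(5) by simp
  qed
  have cl: "closure {0..<1::real} = {0..1}" by simp
  have "\<eta> t - \<eta>' t = 0"
  proof (rule continuous_constant_on_closure[where S = "{0..<1}" and f = "\<lambda>t. \<eta> t - \<eta>' t"])
    show "continuous_on (closure {0..<1}) (\<lambda>t. \<eta> t - \<eta>' t)"
      unfolding cl by (intro continuous_intros cont)
    show "t \<in> closure {0..<1}" unfolding cl by (rule assms(6))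
  qed (simp add: eq)
  then show ?thesis by simp
qed

locale star_over =
  fixes P :: "complex poly" and c :: complex and k s :: nat
    and cs :: "nat \<Rightarrow> complex" and \<gamma> :: "nat \<Rightarrow> real \<Rightarrow> complex"
  assumes P: "degree P > 0"
    and star: "is_star c k cs \<gamma>"
    and s: "s \<in> {1..k}"
    and inj: "inj_on cs {1..k}"
    and crit: "critical_values P \<subseteq> cs ` {1..k}"
begin

definition S :: "complex set" where
  "S = (\<Union>r\<in>{1..k}. path_image (\<gamma> r))"

lemma star_arc:
  assumes "r \<in> {1..k}"
  shows "arc (\<gamma> r)" "\<gamma> r 0 = c" "\<gamma> r 1 = cs r" "path (\<gamma> r)"
  using star assms by (auto simp: is_star_def pathstart_def pathfinish_def arc_imp_path)

lemma star_Int: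
  "r \<in> {1..k} \<Longrightarrow> t \<in> {1..k} \<Longrightarrow> r \<noteq> t \<Longrightarrow> path_image (\<gamma> r) \<inter> path_image (\<gamma> t) = {c}"
  using star by (auto simp: is_star_def)

lemma star_inj:
  assumes "r \<in> {1..k}" "t \<in> {0..1}" "t' \<in> {0..1}" "\<gamma> r t = \<gamma> r t'"
  shows "t = t'"
  using star_arc(1)[OF assms(1)] assms(2-) by (auto simp: arc_def inj_on_def)

lemma centre_in_image: "r \<in> {1..k} \<Longrightarrow> c \<in> path_image (\<gamma> r)"
  and tip_in_image: "r \<in> {1..k} \<Longrightarrow> cs r \<in> path_image (\<gamma> r)"
  using star_arc(2,3)[of r] by (auto simp: path_image_def image_iff intro: bexI[of _ 0] bexI[of _ 1])

lemma centre_neq_tip: "r \<in> {1..k} \<Longrightarrow> c \<noteq> cs r"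
  using star by (auto simp: is_star_def)

text \<open>A compact absolute retract does not separate the plane. Arcs are such retracts, and
  adding an arc that meets the rest in the single point \<open>c\<close> preserves the
  property.\<close>

lemma star_AR:
  assumes "finite A" "A \<noteq> {}" "A \<subseteq> {1..k}"
  shows "AR (\<Union>r\<in>A. path_image (\<gamma> r)) \<and> path_connected (\<Union>r\<in>A. path_image (\<gamma> r)) \<and>
    compact (\<Union>r\<in>A. path_image (\<gamma> r))"
  using assms
proof (induction A rule: finite_ne_induct)
  case (singleton r)
  then have "path_image (\<gamma> r) homeomorphic {0..1::real}"
    using star_arc(1) by (intro homeomorphic_arc_image_interval) auto
  then have "AR (path_image (\<gamma> r))"
    using homeomorphic_AR_iff_AR convex_imp_AR[of "{0..1::real}"] by auto
  then show ?case
    using singleton star_arc(4) by (auto intro: path_connected_path_image compact_path_image)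
next
  case (insert r A)
  define T where "T = (\<Union>r\<in>A. path_image (\<gamma> r))"
  have T: "AR T" "path_connected T" "compact T" using insert by (auto simp: T_def)
  have r: "r \<in> {1..k}" using insert.prems by auto
  have "path_image (\<gamma> r) homeomorphic {0..1::real}"
    using star_arc(1)[OF r] by (intro homeomorphic_arc_image_interval) auto
  then have r': "AR (path_image (\<gamma> r))"
    using homeomorphic_AR_iff_AR convex_imp_AR[of "{0..1::real}"] by auto
  have pr: "path_connected (path_image (\<gamma> r))" "compact (path_image (\<gamma> r))"
    using star_arc(4)[OF r] by (auto intro: path_connected_path_image compact_path_image)
  have int: "path_image (\<gamma> r) \<inter> T = {c}"
  proof -
    have "path_image (\<gamma> r) \<inter> path_image (\<gamma> t) = {c}" if "t \<in> A" for t
      using insert that by (intro star_Int) auto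
    then show ?thesis using insert.hyps(2) by (auto simp: T_def)
  qed
  have "AR (path_image (\<gamma> r) \<union> T)"
    using r' T pr int by (intro AR_closed_Un) (auto intro: compact_imp_closed convex_imp_AR)
  moreover have "path_connected (path_image (\<gamma> r) \<union> T)"
    using int by (intro path_connected_Un pr T) auto
  moreover have "compact (path_image (\<gamma> r) \<union> T)" using pr T by (simp add: compact_Un)
  ultimately show ?case by (simp add: T_def)
qed

lemma star_topology: "compact S" "path_connected S" "connected (- S)"
proof -
  have "AR S" "path_connected S" "compact S"
    using star_AR[of "{1..k}"] s by (auto simp: S_def)
  then show "compact S" "path_connected S" "connected (- S)"
    by (auto intro: connected_complement_absolute_retract)
qed

lemma marks_in_S: "c \<in> S" "r \<in> {1..k} \<Longrightarrow> cs r \<in> S"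
  using centre_in_image[OF s] s tip_in_image unfolding S_def by blast+

lemma critical_in_S: "critical_values P \<subseteq> S"
  using crit marks_in_S by blast

lemma critical_off_interior:
  assumes r: "r \<in> {1..k}" and t: "t \<in> {0..<1}"
  shows "\<gamma> r t \<notin> cs ` {1..k}"
proof
  assume "\<gamma> r t \<in> cs ` {1..k}"
  then obtain i where i: "i \<in> {1..k}" "\<gamma> r t = cs i" by auto
  have "\<gamma> r t \<in> path_image (\<gamma> r)" using t by (auto simp: path_image_def)
  show False
  proof (cases "i = r")
    case True
    then have "\<gamma> r t = \<gamma> r 1" using i star_arc(3)[OF r] by simp
    then show False using star_inj[OF r, of t 1] t by auto
  next
    case False
    then have "cs i = c"
      using star_Int[OF i(1) r False] tip_in_image[OF i(1)] \<open>\<gamma> r t \<in> path_image (\<gamma> r)\<close> i(2) by auto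
    then show False using centre_neq_tip[OF i(1)] by simp
  qed
qed

lemma star_lift_unique:
  assumes "lift_of P (\<gamma> r) \<eta>" "lift_of P (\<gamma> r) \<eta>'" "r \<in> {1..k}"
    "t0 \<in> {0..<1}" "\<eta> t0 = \<eta>' t0" "t \<in> {0..1}"
  shows "\<eta> t = \<eta>' t"
  using lift_unique[OF assms(1,2) _ assms(4-)] critical_off_interior[OF assms(3)] crit by blast

text \<open>The point near which the jump is examined; an interior parameter keeps it away from
  \<open>c\<close>, from the tips and from the other arcs.\<close>

definition w0 :: complex where "w0 = \<gamma> s (1/2)"

lemma w0_notin: "r \<in> {1..k} \<Longrightarrow> r \<noteq> s \<Longrightarrow> w0 \<notin> path_image (\<gamma> r)"
proof
  assume r: "r \<in> {1..k}" "r \<noteq> s" "w0 \<in> path_image (\<gamma> r)"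
  have "w0 \<in> path_image (\<gamma> s)" by (auto simp: w0_def path_image_def)
  then have "\<gamma> s (1/2) = \<gamma> s 0"
    using r star_Int[OF r(1) s r(2)] star_arc(2)[OF s] by (auto simp: w0_def)
  then show False using star_inj[OF s, of "1/2" 0] by simp
qed

text \<open>The disc has to meet the star only in a middle stretch of \<open>\<gamma> s\<close> that
  stays inside a larger disc \<open>ball w0 R0\<close> with sheets. Then a lift enters it only on
  the sheet labelled by its own midpoint. Removing the disc splits the star between \<open>c\<close>
  and \<open>cs s\<close>.\<close>

lemma localizing_disc:
  obtains R u K1 K2 where "sheets P w0 R u" "c \<notin> ball w0 R" "\<And>r. r \<in> {1..k} \<Longrightarrow> cs r \<notin> ball w0 R"
    "\<And>r. r \<in> {1..k} \<Longrightarrow> r \<noteq> s \<Longrightarrow> path_image (\<gamma> r) \<inter> ball w0 R = {}"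
    "\<And>r \<eta> \<tau> y w. r \<in> {1..k} \<Longrightarrow> lift_of P (\<gamma> r) \<eta> \<Longrightarrow> \<tau> \<in> {0..1} \<Longrightarrow> poly P y = w0 \<Longrightarrow>
       w \<in> ball w0 R \<Longrightarrow> \<eta> \<tau> = u y w \<Longrightarrow> r = s \<and> y = \<eta> (1/2)"
    "compact K1" "compact K2" "K1 \<inter> K2 = {}" "c \<in> K1" "cs s \<in> K2" "S - ball w0 R = K1 \<union> K2"
proof -
  have "w0 \<notin> critical_values P"
    using critical_off_interior[OF s, of "1/2"] crit by (auto simp: w0_def)
  then obtain R0 u where sh0: "sheets P w0 R0 u" using sheets_exist[OF P] by blast
  have R0: "R0 > 0" by (rule sheets_pos[OF sh0])
  have cont: "continuous_on {0..1} (\<gamma> s)" using star_arc(4)[OF s] by (simp add: path_def)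
  then have "\<exists>d>0. \<forall>t\<in>{0..1}. dist t (1/2) < d \<longrightarrow> dist (\<gamma> s t) (\<gamma> s (1/2)) < R0"
    using R0 cont[unfolded continuous_on_iff, THEN bspec, of "1/2"] by simp
  then obtain d where d: "d > 0" "\<And>t. t \<in> {0..1} \<Longrightarrow> dist t (1/2) < d \<Longrightarrow> dist (\<gamma> s t) (\<gamma> s (1/2)) < R0"
    by blast
  define \<delta> where "\<delta> = min d (1/4)"
  have \<delta>: "0 < \<delta>" "\<delta> \<le> 1/4" using d by (auto simp: \<delta>_def)
  have near: "\<gamma> s t \<in> ball w0 R0" if "\<bar>t - 1/2\<bar> < \<delta>" for t
  proof -
    have "\<bar>t - 1/2\<bar> < 1/4" "\<bar>t - 1/2\<bar> < d" using that by (auto simp: \<delta>_def)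
    then have "t \<in> {0..1}" "dist t (1/2) < d"
      by (auto simp: dist_real_def abs_if split: if_splits)
    then show ?thesis using d(2)[of t] by (simp add: w0_def dist_commute)
  qed
  \<comment> \<open>All of the star except the middle stretch; this compact set misses
    \<open>w0\<close>, and the final disc is chosen off it.\<close>
  define C where "C = (\<Union>r\<in>{1..k} - {s}. path_image (\<gamma> r)) \<union> \<gamma> s ` ({0..1/2 - \<delta>} \<union> {1/2 + \<delta>..1})"
  have "compact C"
    unfolding C_def using star_arc(4) \<delta>
    by (intro compact_Un compact_UN compact_continuous_image continuous_on_subset[OF cont])
      (auto intro: compact_path_image)
  moreover have "w0 \<notin> C"
  proof -
    have "\<gamma> s t \<noteq> \<gamma> s (1/2)" if "t \<in> {0..1/2 - \<delta>} \<union> {1/2 + \<delta>..1}" for t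
      using star_inj[OF s, of t "1/2"] that \<delta> by auto
    then show ?thesis using w0_notin unfolding C_def w0_def by fastforce
  qed
  ultimately obtain e where e: "e > 0" "ball w0 e \<subseteq> - C"
    using open_contains_ball[of "- C"] by (auto simp: open_Compl compact_imp_closed)
  define R where "R = min e R0"
  have R: "R > 0" "ball w0 R \<inter> C = {}" "ball w0 R \<subseteq> ball w0 R0"
    using e R0 by (auto simp: R_def)
  have sh: "sheets P w0 R u" by (rule sheets_subset[OF sh0]) (use R in \<open>auto simp: R_def\<close>)
  have \<gamma>C: "\<gamma> s t \<in> C" if "t \<in> {0..1}" "\<not> \<bar>t - 1/2\<bar> < \<delta>" for t
  proof -
    have "t \<in> {0..1/2 - \<delta>} \<union> {1/2 + \<delta>..1}" using that by auto
    then show ?thesis by (auto simp: C_def)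
  qed
  have "c \<in> C" using \<gamma>C[of 0] \<delta> star_arc(2)[OF s] by auto
  moreover have csC: "cs r \<in> C" if "r \<in> {1..k}" for r
  proof (cases "r = s")
    case True
    then show ?thesis using \<gamma>C[of 1] \<delta> star_arc(3)[OF s] by auto
  next
    case False
    then show ?thesis using tip_in_image[OF that] that by (auto simp: C_def)
  qed
  ultimately have marks: "c \<notin> ball w0 R" "\<And>r. r \<in> {1..k} \<Longrightarrow> cs r \<notin> ball w0 R"
    using R(2) by auto
  have other: "path_image (\<gamma> r) \<inter> ball w0 R = {}" if "r \<in> {1..k}" "r \<noteq> s" for r
  proof -
    have "path_image (\<gamma> r) \<subseteq> C" using that unfolding C_def by blast
    then show ?thesis using R(2) by blast
  qed
  have loc: "r = s \<and> y = \<eta> (1/2)"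
    if r: "r \<in> {1..k}" and lift: "lift_of P (\<gamma> r) \<eta>" and \<tau>: "\<tau> \<in> {0..1}" and y: "poly P y = w0"
      and w: "w \<in> ball w0 R" and eq: "\<eta> \<tau> = u y w" for r \<eta> \<tau> y w
  proof -
    have Pe: "poly P (\<eta> t) = \<gamma> r t" if "t \<in> {0..1}" for t using lift that by (simp add: lift_of_def)
    have wt: "w = \<gamma> r \<tau>" using Pe[OF \<tau>] eq sheets_poly[OF sh y w] by simp
    then have "w \<in> path_image (\<gamma> r)" using \<tau> by (auto simp: path_image_def)
    then have rs: "r = s" using other[OF r] w by blast
    then have \<tau>d: "\<bar>\<tau> - 1/2\<bar> < \<delta>" using \<gamma>C[OF \<tau>] wt w R(2) by auto
    define J where "J = {t::real. \<bar>t - 1/2\<bar> < \<delta>}"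
    have JI: "J = {1/2 - \<delta><..<1/2 + \<delta>}" by (auto simp: J_def)
    have J01: "t \<in> {0..1}" if "t \<in> J" for t using that \<delta> by (auto simp: J_def)
    have lim: "(\<eta> \<longlongrightarrow> \<eta> t) (at t within J)" if "t \<in> J" for t
    proof -
      have "continuous_on J \<eta>"
        using lift J01 by (auto simp: lift_of_def path_def intro: continuous_on_subset)
      then show ?thesis using that by (simp add: continuous_on_def)
    qed
    \<comment> \<open>Between the parameters \<open>\<tau>\<close> and \<open>1/2\<close> the arc
      may leave the small disc, but not the one of radius \<open>R0\<close>. The images of the
      sheets over the latter are open and disjoint, so that the connected stretch stays on one of
      them.\<close>
    have "(\<eta> \<tau> \<in> u y ` ball w0 R0) = (\<eta> (1/2) \<in> u y ` ball w0 R0)"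
    proof (rule connected_local_const[of J])
      show "connected J" by (simp add: JI)
      show "\<tau> \<in> J" "1/2 \<in> J" using \<tau>d \<delta> by (auto simp: J_def)
      show "\<forall>a\<in>J. \<forall>\<^sub>F b in at a within J. (\<eta> a \<in> u y ` ball w0 R0) = (\<eta> b \<in> u y ` ball w0 R0)"
      proof
        fix a assume a: "a \<in> J"
        have "poly P (\<eta> a) \<in> ball w0 R0"
          using Pe[OF J01[OF a]] near[of a] a rs by (simp add: J_def)
        from sheets_surj[OF sh0 this] obtain y' where y': "poly P y' = w0" "\<eta> a = u y' (poly P (\<eta> a))" .
        then have "\<eta> a \<in> u y' ` ball w0 R0" using \<open>poly P (\<eta> a) \<in> ball w0 R0\<close> by blast
        moreover have "open (u y' ` ball w0 R0)" by (rule sheets_open_image[OF sh0 y'(1)]) auto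
        ultimately have "\<forall>\<^sub>F b in at a within J. \<eta> b \<in> u y' ` ball w0 R0"
          using lim[OF a] by (intro topological_tendstoD)
        then show "\<forall>\<^sub>F b in at a within J. (\<eta> a \<in> u y ` ball w0 R0) = (\<eta> b \<in> u y ` ball w0 R0)"
        proof eventually_elim
          case (elim b)
          have disj: "y = y'" if z: "z \<in> u y ` ball w0 R0" "z \<in> u y' ` ball w0 R0" for z
          proof -
            obtain w1 where w1: "z = u y w1" "w1 \<in> ball w0 R0" using z(1) by (elim imageE)
            obtain w2 where w2: "z = u y' w2" "w2 \<in> ball w0 R0" using z(2) by (elim imageE)
            have "w1 = w2"
              using sheets_poly[OF sh0 y w1(2)] sheets_poly[OF sh0 y'(1) w2(2)] w1(1) w2(1) by simp
            then show ?thesis using sheets_inj[OF sh0 w1(2) y y'(1)] w1(1) w2(1) by simp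
          qed
          show ?case
            using disj[of "\<eta> a"] disj[of "\<eta> b"] elim \<open>\<eta> a \<in> u y' ` ball w0 R0\<close> by blast
        qed
      qed
    qed
    moreover have "\<eta> \<tau> \<in> u y ` ball w0 R0" using eq w R(3) by blast
    ultimately obtain w' where w': "w' \<in> ball w0 R0" "\<eta> (1/2) = u y w'" by auto
    then have "w' = w0"
      using Pe[of "1/2"] sheets_poly[OF sh0 y, of w'] rs by (simp add: w0_def)
    then show ?thesis using rs w' sheets_centre[OF sh0 y] by simp
  qed
  define T where "T = (\<Union>r\<in>{1..k} - {s}. path_image (\<gamma> r))"
  \<comment> \<open>The star is cut at parameter \<open>1/2\<close>: the two parts meet only in
    \<open>w0\<close>, which is removed with the disc.\<close>
  define K1 where "K1 = (T \<union> \<gamma> s ` {0..1/2}) - ball w0 R"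
  define K2 where "K2 = \<gamma> s ` {1/2..1} - ball w0 R"
  have "compact T"
    unfolding T_def using star_arc(4) by (intro compact_UN) (auto intro: compact_path_image)
  then have K: "compact K1" "compact K2"
    unfolding K1_def K2_def
    by (intro compact_diff compact_Un compact_continuous_image continuous_on_subset[OF cont]; force)+
  have K12: "K1 \<inter> K2 = {}"
  proof (rule ccontr)
    assume "K1 \<inter> K2 \<noteq> {}"
    then obtain z where z: "z \<in> K1" "z \<in> K2" by blast
    from z(2) obtain t where t: "t \<in> {1/2..1}" "z = \<gamma> s t" "z \<notin> ball w0 R" by (auto simp: K2_def)
    from z(1) consider "z \<in> T" | t' where "t' \<in> {0..1/2}" "z = \<gamma> s t'" by (auto simp: K1_def)
    then show False
    proof cases
      case 1
      then obtain r where r: "r \<in> {1..k}" "r \<noteq> s" "z \<in> path_image (\<gamma> r)"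
        unfolding T_def by blast
      moreover have "z \<in> path_image (\<gamma> s)" using t by (auto simp: path_image_def)
      ultimately have "z = c" using star_Int[OF r(1) s r(2)] by blast
      have "t = 0"
      proof (rule star_inj[OF s])
        show "\<gamma> s t = \<gamma> s 0" using \<open>z = c\<close> t(2) star_arc(2)[OF s] by simp
      qed (use t(1) in auto)
      then show False using t(1) by simp
    next
      case 2
      have "t = t'"
      proof (rule star_inj[OF s])
        show "\<gamma> s t = \<gamma> s t'" using 2 t by simp
      qed (use 2(1) t(1) in auto)
      then have "t = 1/2" using 2(1) t(1) by simp
      then have "z = w0" using t(2) by (simp only: w0_def)
      then show False using t(3) R(1) by simp
    qed
  qed
  have cK: "c \<in> K1"
    using marks(1) star_arc(2)[OF s] by (auto simp: K1_def image_iff intro!: bexI[of _ 0])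
  have csK: "cs s \<in> K2"
    using marks(2)[OF s] star_arc(3)[OF s] by (auto simp: K2_def image_iff intro!: bexI[of _ 1])
  have SK: "S - ball w0 R = K1 \<union> K2"
  proof -
    have "{0..1::real} = {0..1/2} \<union> {1/2..1}" by auto
    then have "path_image (\<gamma> s) = \<gamma> s ` {0..1/2} \<union> \<gamma> s ` {1/2..1}"
      unfolding path_image_def by (metis image_Un)
    moreover have "S = T \<union> path_image (\<gamma> s)" using s by (auto simp: S_def T_def)
    ultimately show ?thesis by (auto simp: K1_def K2_def)
  qed
  show ?thesis
    by (rule that[of R u K1 K2]) ((rule sh marks other loc K K12 cK csK SK; assumption?)+)
qed

section \<open>Walks in the cactus as point sets, and the lifts they contain\<close>

definition star_edge :: "nat \<Rightarrow> (real \<Rightarrow> complex) \<Rightarrow> complex \<times> complex set \<times> complex \<Rightarrow> bool" where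
  "star_edge r \<eta> x \<longleftrightarrow> r \<in> {1..k} \<and> lift_of P (\<gamma> r) \<eta> \<and> fst (snd x) = path_image \<eta> \<and>
     ((fst x = \<eta> 0 \<and> snd (snd x) = \<eta> 1) \<or> (fst x = \<eta> 1 \<and> snd (snd x) = \<eta> 0))"

abbreviation G where "G \<equiv> extended_cactus P c k cs \<gamma>"

lemma arcs_cactus: "x \<in> arcs G \<longleftrightarrow> (\<exists>r \<eta>. star_edge r \<eta> x)"
  by (cases x) (auto simp: extended_cactus_def star_edge_def pathstart_def pathfinish_def)

lemma tail_cactus [simp]: "tail G x = fst x"
  and head_cactus [simp]: "head G x = snd (snd x)"
  by (cases x; simp add: extended_cactus_def)+

lemma star_edge_ends:
  assumes "star_edge r \<eta> x"
  shows "poly P (\<eta> 0) = c" "poly P (\<eta> 1) = cs r" "r \<in> {1..k}" "lift_of P (\<gamma> r) \<eta>"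
    "fst x \<in> fst (snd x)" "snd (snd x) \<in> fst (snd x)"
  using assms star_arc(2,3)[of r] by (auto simp: star_edge_def lift_of_def path_image_def)

lemma star_edge_coloured:
  assumes "star_edge r \<eta> x" "i \<in> {1..k}"
  shows "poly P (fst x) = cs i \<Longrightarrow> r = i \<and> fst x = \<eta> 1 \<and> snd (snd x) = \<eta> 0"
    and "poly P (snd (snd x)) = cs i \<Longrightarrow> r = i \<and> snd (snd x) = \<eta> 1 \<and> fst x = \<eta> 0"
proof -
  note e = star_edge_ends[OF assms(1)]
  have "c \<noteq> cs i" using centre_neq_tip[OF assms(2)] by simp
  moreover have "r = i" if "cs r = cs i" using inj that e(3) assms(2) by (auto dest: inj_onD)
  ultimately show "poly P (fst x) = cs i \<Longrightarrow> r = i \<and> fst x = \<eta> 1 \<and> snd (snd x) = \<eta> 0"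
    "poly P (snd (snd x)) = cs i \<Longrightarrow> r = i \<and> snd (snd x) = \<eta> 1 \<and> fst x = \<eta> 0"
    using assms(1) e(1,2) by (auto simp: star_edge_def)
qed

text \<open>The inserted \<open>x\<close> gives the empty walk its one point, so that the set always
  contains both ends of the walk.\<close>

definition edges :: "complex \<Rightarrow> (complex \<times> complex set \<times> complex) list \<Rightarrow> complex set" where
  "edges x p = insert x (\<Union>e\<in>set p. fst (snd e))"

lemma edges_walk:
  assumes "pre_digraph.cas G x p y" "set p \<subseteq> arcs G"
  shows "path_connected (edges x p) \<and> compact (edges x p) \<and> y \<in> edges x p"
  using assms
proof (induction p arbitrary: x)
  case Nil
  then show ?case by (simp add: edges_def pre_digraph.cas.simps)
next
  case (Cons e p)
  have cas: "fst e = x" "pre_digraph.cas G (snd (snd e)) p y"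
    using Cons.prems(1) by (auto simp: pre_digraph.cas.simps)
  have IH: "path_connected (edges (snd (snd e)) p)" "compact (edges (snd (snd e)) p)" "y \<in> edges (snd (snd e)) p"
    using Cons.IH[OF cas(2)] Cons.prems(2) by auto
  obtain r \<eta> where e: "star_edge r \<eta> e" using Cons.prems(2) arcs_cactus by auto
  note ee = star_edge_ends[OF e]
  have pe: "path_connected (fst (snd e))" "compact (fst (snd e))"
    using e by (auto simp: star_edge_def lift_of_def path_connected_path_image compact_path_image)
  have eq: "edges x (e # p) = fst (snd e) \<union> edges (snd (snd e)) p"
    using ee(5,6) cas(1) by (auto simp: edges_def)
  have "snd (snd e) \<in> fst (snd e) \<inter> edges (snd (snd e)) p"
    using ee(6) by (simp add: edges_def)
  then show ?case
    unfolding eq using pe IH by (auto intro: path_connected_Un compact_Un)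
qed

lemma edges_over_star:
  assumes "poly P x \<in> S" "set p \<subseteq> arcs G"
  shows "edges x p \<subseteq> poly P -` S"
proof
  fix z assume "z \<in> edges x p"
  then consider "z = x" | e where "e \<in> set p" "z \<in> fst (snd e)" by (auto simp: edges_def)
  then show "z \<in> poly P -` S"
  proof cases
    case 2
    then obtain r \<eta> where "star_edge r \<eta> e" using assms(2) arcs_cactus by blast
    then show ?thesis using path_image_lift[of P "\<gamma> r" \<eta>] 2 by (auto simp: star_edge_def S_def)
  qed (use assms in auto)
qed

text \<open>All edges of colour \<open>s\<close> on the walk come from one lift. This is how the
  hypothesis on the weight reaches the analysis: the walk enters the localizing disc on at most one
  sheet.\<close>

definition single_lift :: "(real \<Rightarrow> complex) \<Rightarrow> (complex \<times> complex set \<times> complex) list \<Rightarrow> bool" where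
  "single_lift \<eta> p \<longleftrightarrow> lift_of P (\<gamma> s) \<eta> \<and>
     (\<forall>x\<in>set p. \<exists>r \<eta>'. star_edge r \<eta>' x \<and> (r = s \<longrightarrow> \<eta>' = \<eta>))"

text \<open>An edge of colour \<open>s\<close> has a vertex of colour \<open>s\<close> as one end,
  which can only be \<open>v\<close>; on a path without repetitions only the last edge touches its
  final vertex.\<close>

lemma single_lift_last:
  assumes cas: "pre_digraph.cas G x (p @ [e]) v" and arcs: "set (p @ [e]) \<subseteq> arcs G"
    and dist: "distinct (pre_digraph.awalk_verts G x (p @ [e]))"
    and v: "poly P v = cs s"
    and uniq: "\<And>z. z \<in> set (pre_digraph.awalk_verts G x (p @ [e])) \<Longrightarrow> poly P z = cs s \<Longrightarrow> z = v"
  obtains \<eta> where "single_lift \<eta> (p @ [e])" "\<eta> 1 = v" "\<eta> 0 = fst e"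
proof -
  have tails: "pre_digraph.awalk_verts G x (p @ [e]) = map fst (p @ [e]) @ [snd (snd e)]"
    by (simp add: pre_digraph.awalk_verts_conv)
  have heads: "pre_digraph.awalk_verts G x (p @ [e]) = fst (hd (p @ [e])) # map (\<lambda>x. snd (snd x)) (p @ [e])"
    using pre_digraph.awalk_verts_conv'[OF cas] by simp
  have ve: "snd (snd e) = v"
    using cas by (induction p arbitrary: x) (auto simp: pre_digraph.cas.simps)
  obtain r \<eta> where re: "star_edge r \<eta> e" using arcs arcs_cactus by auto
  have e: "r = s" "v = \<eta> 1" "fst e = \<eta> 0" using star_edge_coloured(2)[OF re s] v ve by auto
  have "\<exists>r \<eta>'. star_edge r \<eta>' y \<and> (r = s \<longrightarrow> \<eta>' = \<eta>)" if y: "y \<in> set (p @ [e])" for y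
  proof (cases "y = e")
    case True
    then show ?thesis using re by blast
  next
    case False
    then have yp: "y \<in> set p" using y by auto
    have "fst y \<noteq> v" using dist yp ve unfolding tails by force
    moreover have "snd (snd y) \<noteq> v" using dist yp ve unfolding heads by (force simp: image_iff)
    moreover obtain r' \<eta>' where re': "star_edge r' \<eta>' y" using arcs y arcs_cactus by blast
    moreover have "\<eta>' 1 \<in> {fst y, snd (snd y)}" using re' by (auto simp: star_edge_def)
    moreover have "fst y \<in> set (pre_digraph.awalk_verts G x (p @ [e]))" unfolding tails using yp by auto
    moreover have "snd (snd y) \<in> set (pre_digraph.awalk_verts G x (p @ [e]))" unfolding heads using yp by auto
    ultimately have "poly P (\<eta>' 1) \<noteq> cs s" using uniq by auto
    then have "r' \<noteq> s" using star_edge_ends(2)[OF re'] by auto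
    then show ?thesis using re' by blast
  qed
  then have "single_lift \<eta> (p @ [e])"
    using star_edge_ends(4)[OF re] e(1) by (simp add: single_lift_def)
  then show ?thesis using that e by simp
qed

text \<open>Mirror image of \<open>single_lift_last\<close>, for a path that starts at its only
  vertex of colour \<open>s\<close>.\<close>

lemma single_lift_first:
  assumes cas: "pre_digraph.cas G v (e # p) x" and arcs: "set (e # p) \<subseteq> arcs G"
    and dist: "distinct (pre_digraph.awalk_verts G v (e # p))"
    and v: "poly P v = cs s"
    and uniq: "\<And>z. z \<in> set (pre_digraph.awalk_verts G v (e # p)) \<Longrightarrow> poly P z = cs s \<Longrightarrow> z = v"
  obtains \<eta> where "single_lift \<eta> (e # p)" "\<eta> 1 = v" "\<eta> 0 = snd (snd e)"
proof -
  have tails: "pre_digraph.awalk_verts G v (e # p) = map fst (e # p) @ [snd (snd (last (e # p)))]"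
    by (simp add: pre_digraph.awalk_verts_conv)
  have ve: "fst e = v" using cas by (simp add: pre_digraph.cas.simps)
  have heads: "pre_digraph.awalk_verts G v (e # p) = v # map (\<lambda>x. snd (snd x)) (e # p)"
    using pre_digraph.awalk_verts_conv'[OF cas] ve by simp
  obtain r \<eta> where re: "star_edge r \<eta> e" using arcs arcs_cactus by auto
  have e: "r = s" "v = \<eta> 1" "snd (snd e) = \<eta> 0" using star_edge_coloured(1)[OF re s] v ve by auto
  have "\<exists>r \<eta>'. star_edge r \<eta>' y \<and> (r = s \<longrightarrow> \<eta>' = \<eta>)" if y: "y \<in> set (e # p)" for y
  proof (cases "y = e")
    case True
    then show ?thesis using re by blast
  next
    case False
    then have yp: "y \<in> set p" using y by auto
    have "fst y \<noteq> v" using dist yp ve unfolding tails by (auto simp: image_iff)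
    moreover have "snd (snd y) \<noteq> v" using dist yp unfolding heads by auto
    moreover obtain r' \<eta>' where re': "star_edge r' \<eta>' y" using arcs y arcs_cactus by blast
    moreover have "\<eta>' 1 \<in> {fst y, snd (snd y)}" using re' by (auto simp: star_edge_def)
    moreover have "fst y \<in> set (pre_digraph.awalk_verts G v (e # p))" unfolding tails using yp by auto
    moreover have "snd (snd y) \<in> set (pre_digraph.awalk_verts G v (e # p))" unfolding heads using yp by auto
    ultimately have "poly P (\<eta>' 1) \<noteq> cs s" using uniq by auto
    then have "r' \<noteq> s" using star_edge_ends(2)[OF re'] by auto
    then show ?thesis using re' by blast
  qed
  then have "single_lift \<eta> (e # p)"
    using star_edge_ends(4)[OF re] e(1) by (simp add: single_lift_def)
  then show ?thesis using that e by simp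
qed

text \<open>The vertex \<open>v\<close> splits the path. The two colour conditions treat both cases
  of weight 1 at once: either \<open>v\<close> alone has colour \<open>s\<close>, or both ends have
  it and \<open>v\<close> does not. In either case the two jumps are opposite and nonzero.\<close>

theorem common_right_factor:
  fixes Q :: "complex poly"
  assumes mom: "\<And>i::nat. contour_integral (linepath a b) (\<lambda>z. poly P z ^ i * poly (pderiv Q) z) = 0"
    and w1: "pre_digraph.cas G a \<Gamma>1 v" "set \<Gamma>1 \<subseteq> arcs G" "single_lift \<eta>1 \<Gamma>1"
    and w2: "pre_digraph.cas G v \<Gamma>2 b" "set \<Gamma>2 \<subseteq> arcs G" "single_lift \<eta>2 \<Gamma>2"
    and marks: "poly P a \<in> insert c (cs ` {1..k})" "poly P v \<in> insert c (cs ` {1..k})"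
      "poly P b \<in> insert c (cs ` {1..k})"
    and colours: "(poly P v = cs s) \<longleftrightarrow> (poly P a \<noteq> cs s)" "(poly P v = cs s) \<longleftrightarrow> (poly P b \<noteq> cs s)"
    and ne: "t \<in> {0..1}" "\<eta>1 t \<noteq> \<eta>2 t"
  shows "\<exists>Pt Qt W. degree W > 1 \<and> P = pcompose Pt W \<and> Q = pcompose Qt W"
proof -
  obtain R u K1 K2 where sh: "sheets P w0 R u" and mD: "c \<notin> ball w0 R" "\<And>r. r \<in> {1..k} \<Longrightarrow> cs r \<notin> ball w0 R"
    and other: "\<And>r. r \<in> {1..k} \<Longrightarrow> r \<noteq> s \<Longrightarrow> path_image (\<gamma> r) \<inter> ball w0 R = {}"
    and loc: "\<And>r \<eta> \<tau> y w. r \<in> {1..k} \<Longrightarrow> lift_of P (\<gamma> r) \<eta> \<Longrightarrow> \<tau> \<in> {0..1} \<Longrightarrow> poly P y = w0 \<Longrightarrow>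
       w \<in> ball w0 R \<Longrightarrow> \<eta> \<tau> = u y w \<Longrightarrow> r = s \<and> y = \<eta> (1/2)"
    and K: "compact K1" "compact K2" "K1 \<inter> K2 = {}" "c \<in> K1" "cs s \<in> K2" "S - ball w0 R = K1 \<union> K2"
    using localizing_disc by blast
  obtain x y j where xy: "x \<in> ball w0 R - S" "y \<in> ball w0 R - S" and j: "j \<noteq> 0"
     and J: "log_jump (- S) (ball w0 R) x y (\<lambda>w. (w - cs s) / (w - c)) j"
    using log_jump_nonzero[OF star_topology(1,2) open_ball convex_ball K] by metis
  \<comment> \<open>Relative to \<open>c\<close>, only the tip of \<open>\<gamma> s\<close> is cut
    off by the disc; every other marked value is joined to \<open>c\<close> within the star off the
    disc.\<close>
  define jv where "jv p = (if p = cs s then j else 0)" for p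
  have D: "p \<notin> ball w0 R" "p \<in> S" if "p \<in> insert c (cs ` {1..k})" for p
    using that mD marks_in_S by auto
  have jump1: "log_jump (- S) (ball w0 R) x y (\<lambda>w. (w - p) / (w - c)) (jv p)"
    if p: "p \<in> insert c (cs ` {1..k})" for p
  proof (cases "p = cs s")
    case True
    then show ?thesis using J by (simp add: jv_def)
  next
    case False
    obtain r where r: "r \<in> {1..k}" "p = c \<or> (p = cs r \<and> r \<noteq> s)"
      using p False s by blast
    define E where "E = (if p = c then {c} else path_image (\<gamma> r))"
    have "path_connected E" "p \<in> E" "c \<in> E"
      using r star_arc(4)[OF r(1)] centre_in_image tip_in_image
      by (auto simp: E_def intro: path_connected_path_image)
    moreover have "E \<inter> (- S \<union> ball w0 R) = {}"
      using r mD(1) marks_in_S(1) other[OF r(1)] by (auto simp: E_def S_def)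
    ultimately have "log_jump (- S) (ball w0 R) x y (\<lambda>w. (w - p) / (w - c)) 0"
      by (rule log_jump_zero_path_connected)
    then show ?thesis using False by (simp add: jv_def)
  qed
  have jump: "log_jump (- S) (ball w0 R) x y (\<lambda>w. (w - p) / (w - p')) (jv p - jv p')"
    if "p \<in> insert c (cs ` {1..k})" "p' \<in> insert c (cs ` {1..k})" for p p'
  proof (rule log_jump_cong[OF log_jump_divide[OF jump1[OF that(1)] jump1[OF that(2)]]])
    fix w assume "w \<in> - S \<union> ball w0 R"
    then have "w \<noteq> c" using mD(1) marks_in_S(1) by auto
    then show "(w - p) / (w - c) / ((w - p') / (w - c)) = (w - p) / (w - p')" by simp
  qed
  define j1 where "j1 = jv (poly P v) - jv (poly P a)"
  have j1: "j1 \<noteq> 0" "jv (poly P b) - jv (poly P v) = - j1"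
    using colours j by (auto simp: j1_def jv_def)
  define y1 y2 where "y1 = \<eta>1 (1/2)" and "y2 = \<eta>2 (1/2)"
  have lift: "lift_of P (\<gamma> s) \<eta>1" "lift_of P (\<gamma> s) \<eta>2" using w1(3) w2(3) by (auto simp: single_lift_def)
  have y12: "poly P y1 = w0" "poly P y2 = w0"
    using lift by (auto simp: y1_def y2_def w0_def lift_of_def)
  \<comment> \<open>Lifts that agree at \<open>1/2\<close> agree on all of \<open>{0..1}\<close>, so
    a difference at any parameter, even at a tip, suffices.\<close>
  have "y1 \<noteq> y2"
    using star_lift_unique[OF lift s, of "1/2" t] ne by (auto simp: y1_def y2_def)
  have off: "u z w \<notin> edges x' p"
    if sl: "single_lift \<eta> p" and x': "poly P x' \<in> insert c (cs ` {1..k})"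
      and z: "poly P z = w0" "z \<noteq> \<eta> (1/2)" and w: "w \<in> ball w0 R"
    for \<eta> p x' z w
  proof
    assume "u z w \<in> edges x' p"
    moreover have "u z w \<noteq> x'"
      using D(1)[OF x'] sheets_poly[OF sh z(1) w] w by auto
    ultimately obtain e where e: "e \<in> set p" "u z w \<in> fst (snd e)" by (auto simp: edges_def)
    then obtain r \<eta>' where r: "star_edge r \<eta>' e" "r = s \<Longrightarrow> \<eta>' = \<eta>"
      using sl unfolding single_lift_def by blast
    then obtain \<tau> where "\<tau> \<in> {0..1}" "\<eta>' \<tau> = u z w"
      using e(2) by (auto simp: star_edge_def path_image_def)
    then have "r = s \<and> z = \<eta>' (1/2)"
      using loc[of r \<eta>' \<tau> z w] r(1) z(1) w by (simp add: star_edge_def)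
    then show False using r(2) z(2) by simp
  qed
  define f where "f z = poly (pderiv Q) z / poly (pderiv P) z" for z
  have agree: "f (u y1 w) = f (u y2 w)" if "w \<in> ball w0 R" for w
    unfolding f_def
  proof (rule sheets_agree[OF P mom critical_in_S star_topology(1,3), where ?E1.0 = "edges a \<Gamma>1"
        and ?E2.0 = "edges v \<Gamma>2" and u = u and ?w0.0 = w0 and r = R and ?y1.0 = y1 and ?y2.0 = y2
        and w = w and v = v and x = x and x' = y and j = j1])
    show "edges a \<Gamma>1 \<subseteq> poly P -` S" "edges v \<Gamma>2 \<subseteq> poly P -` S"
      by (rule edges_over_star[OF D(2)[OF marks(1)] w1(2)] edges_over_star[OF D(2)[OF marks(2)] w2(2)])+
    show "a \<in> edges a \<Gamma>1" "v \<in> edges v \<Gamma>2" by (auto simp: edges_def)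
    show "v \<in> edges a \<Gamma>1" "compact (edges a \<Gamma>1)" "path_connected (edges a \<Gamma>1)"
      using edges_walk[OF w1(1,2)] by auto
    show "b \<in> edges v \<Gamma>2" "compact (edges v \<Gamma>2)" "path_connected (edges v \<Gamma>2)"
      using edges_walk[OF w2(1,2)] by auto
    show "u z w \<notin> edges a \<Gamma>1" if "poly P z = w0" "z \<noteq> y1" "w \<in> ball w0 R" for z w
      using off[OF w1(3) marks(1)] that by (simp add: y1_def)
    show "u z w \<notin> edges v \<Gamma>2" if "poly P z = w0" "z \<noteq> y2" "w \<in> ball w0 R" for z w
      using off[OF w2(3) marks(2)] that by (simp add: y2_def)
    show "log_jump (- S) (ball w0 R) x y (\<lambda>w. (w - poly P v) / (w - poly P a)) j1"
      unfolding j1_def by (rule jump[OF marks(2,1)])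
    show "log_jump (- S) (ball w0 R) x y (\<lambda>w. (w - poly P b) / (w - poly P v)) (- j1)"
      using jump[OF marks(3,2)] j1(2) by simp
  qed (use D(1) marks sh y12 \<open>y1 \<noteq> y2\<close> xy j1(1) that in auto)
  have w0D: "w0 \<in> ball w0 R" using sheets_pos[OF sh] by simp
  have "y1 \<in> regular_points P"
    using sheets_noncritical[OF sh w0D] y12 by (simp add: regular_points_def)
  moreover have "y2 \<in> germ_class P f y1"
  proof -
    have "f holomorphic_on regular_points P"
      unfolding f_def using noncritical_pderiv
      by (auto simp: regular_points_def intro!: holomorphic_intros)
    from germ_class_sheets[OF P this sh y12 w0D] show ?thesis
      using agree by (simp add: sheets_centre[OF sh] y12)
  qed
  ultimately show ?thesis
    using decomposition_of_germ_class[OF P, of y1 y2 Q] \<open>y1 \<noteq> y2\<close> unfolding f_def by auto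
qed

end

text \<open>Doubling gives 2 = (ends of this colour) + 2 * (inner vertices of this colour), which
  leaves only one inner vertex or both ends.\<close>

lemma color_weight_eq_1:
  assumes "finite V" "color_weight P cs a b V s = 1" "a \<noteq> b"
  obtains v where "{z \<in> V. poly P z = cs s} = {v}" "v \<noteq> a" "v \<noteq> b"
  | "{z \<in> V. poly P z = cs s} = {a, b}"
proof -
  define A where "A = {z \<in> V. poly P z = cs s}"
  have finA: "finite A" using assms(1) by (simp add: A_def)
  have "1 = (\<Sum>z\<in>A. if z = a \<or> z = b then 1/2 else 1 :: real)"
    using assms(2) by (simp add: color_weight_def A_def)
  also have "\<dots> = (\<Sum>z\<in>A \<inter> {z. z = a \<or> z = b}. 1/2) + (\<Sum>z\<in>A \<inter> - {z. z = a \<or> z = b}. 1)"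
    by (rule sum.If_cases[OF finA])
  also have "{z. z = a \<or> z = b} = {a, b}" by auto
  finally have eq: "1 = real (card (A \<inter> {a, b})) / 2 + real (card (A - {a, b}))"
    by (simp add: Diff_eq)
  then have two: "2 = card (A \<inter> {a, b}) + 2 * card (A - {a, b})" by linarith
  show ?thesis
  proof (cases "A \<inter> {a, b} = {}")
    case True
    then have "card (A - {a, b}) = 1" using two by simp
    then obtain v where "A - {a, b} = {v}" by (auto simp: card_1_singleton_iff)
    then show ?thesis using that(1)[of v] True by (auto simp: A_def)
  next
    case False
    then have "card (A \<inter> {a, b}) > 0" by (simp add: card_gt_0_iff)
    with two have "card (A \<inter> {a, b}) = 2" "card (A - {a, b}) = 0" by arith+
    then have "A - {a, b} = {}" using finA by simp
    moreover have "A \<inter> {a, b} = {a, b}"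
      using \<open>card (A \<inter> {a, b}) = 2\<close> assms(3) by (intro card_subset_eq) auto
    ultimately show ?thesis using that(2) by (auto simp: A_def)
  qed
qed

lemma cas_append:
  "pre_digraph.cas G x (p @ q) y \<longleftrightarrow> (\<exists>z. pre_digraph.cas G x p z \<and> pre_digraph.cas G z q y)"
  by (induction p arbitrary: x) (auto simp: pre_digraph.cas.simps)

theorem theorem3p1:
  fixes P q Q :: "complex poly"
    and a b c :: complex
    and k s :: nat
    and cs :: "nat \<Rightarrow> complex"
    and \<gamma> :: "nat \<Rightarrow> real \<Rightarrow> complex"
    and \<Gamma> :: "(complex \<times> complex set \<times> complex) list"
  assumes "degree P > 0"
    and "q \<noteq> 0"
    and "a \<noteq> b"
    and "\<And>i::nat. contour_integral (linepath a b) (\<lambda>z. poly P z ^ i * poly q z) = 0"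
    and "pderiv Q = q"
    and "bij_betw cs {1..k} (marked_values P a b)"
    and "is_star c k cs \<gamma>"
    and "pre_digraph.apath (extended_cactus P c k cs \<gamma>) a \<Gamma> b"
    and "s \<in> {1..k}"
    and "color_weight P cs a b
           (set (pre_digraph.awalk_verts (extended_cactus P c k cs \<gamma>) a \<Gamma>)) s = 1"
  shows "\<exists>Pt Qt W :: complex poly.
           degree W > 1 \<and> P = pcompose Pt W \<and> Q = pcompose Qt W"
proof -
  have marked: "cs ` {1..k} = marked_values P a b" and injcs: "inj_on cs {1..k}"
    using assms(6) by (auto simp: bij_betw_def)
  have crit: "critical_values P \<subseteq> cs ` {1..k}"
    unfolding marked marked_values_def by blast
  interpret star_over P c k s cs \<gamma>
    by unfold_locales (rule assms(1,7,9) injcs crit)+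
  note mom = assms(4)[folded assms(5)]
  define V where "V = pre_digraph.awalk_verts G"
  have cas: "pre_digraph.cas G a \<Gamma> b" and arcs: "set \<Gamma> \<subseteq> arcs G" and dist: "distinct (V a \<Gamma>)"
    using assms(8) by (auto simp: pre_digraph.apath_def pre_digraph.awalk_def V_def)
  have ma: "poly P a \<in> insert c (cs ` {1..k})" and mb: "poly P b \<in> insert c (cs ` {1..k})"
    unfolding marked marked_values_def by blast+
  have V_cons: "V x (e # p) = fst e # V (snd (snd e)) p" for x e p
    by (simp add: V_def pre_digraph.awalk_verts.simps)
  have V_nil: "V x [] = [x]" for x by (simp add: V_def pre_digraph.awalk_verts.simps)
  have first: "V x p = x # map (\<lambda>e. snd (snd e)) p" if "pre_digraph.cas G x p y" for x p y
    using that by (induction p arbitrary: x) (auto simp: V_cons V_nil pre_digraph.cas.simps)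
  have V_app: "V x (p @ p') = V x p @ map (\<lambda>e. snd (snd e)) p'" if "pre_digraph.cas G x (p @ p') y" for x p p' y
    using first[OF that] that first by (auto simp: cas_append)
  have V_last: "y \<in> set (V x p)" if "pre_digraph.cas G x p y" for x p y
    using that by (induction p arbitrary: x) (auto simp: V_cons V_nil pre_digraph.cas.simps)
  have "a \<in> set (V a \<Gamma>)" using first[OF cas] by simp
  have "b \<in> set (V a \<Gamma>)" using V_last[OF cas] .
  from color_weight_eq_1[OF _ assms(10,3)] consider
    (interior) v where "{z \<in> set (V a \<Gamma>). poly P z = cs s} = {v}" "v \<noteq> a" "v \<noteq> b"
  | (ends) "{z \<in> set (V a \<Gamma>). poly P z = cs s} = {a, b}"
    unfolding V_def by (metis List.finite_set)
  then show ?thesis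
  proof cases
    case interior
    have v: "v \<in> set (V a \<Gamma>)" "poly P v = cs s" using interior(1) by auto
    have uniq: "z = v" if "z \<in> set (V a \<Gamma>)" "poly P z = cs s" for z using interior(1) that by auto
    have Pab: "poly P a \<noteq> cs s" "poly P b \<noteq> cs s"
      using uniq \<open>a \<in> set (V a \<Gamma>)\<close> \<open>b \<in> set (V a \<Gamma>)\<close> interior(2,3) by auto
    obtain e p p' where \<Gamma>: "\<Gamma> = (p @ [e]) @ p'" "snd (snd e) = v"
    proof -
      have "v \<in> (\<lambda>e. snd (snd e)) ` set \<Gamma>" using v(1) first[OF cas] interior(2) by auto
      then obtain e where "e \<in> set \<Gamma>" "snd (snd e) = v" by auto
      then show ?thesis using that by (metis append.assoc append_Cons append_Nil split_list)
    qed
    define p1 where "p1 = p @ [e]"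
    have cas1: "pre_digraph.cas G a p1 v" and cas2: "pre_digraph.cas G v p' b"
      using cas \<Gamma>(2) unfolding \<Gamma>(1) p1_def[symmetric] by (auto simp: cas_append p1_def pre_digraph.cas.simps)
    obtain e' p2 where p': "p' = e' # p2"
      using cas2 interior(3) by (cases p') (auto simp: pre_digraph.cas.simps)
    have Vsplit: "V a \<Gamma> = V a p1 @ map (\<lambda>e. snd (snd e)) p'"
      using V_app[of a p1 p' b] cas by (simp add: \<Gamma>(1) p1_def)
    have V2: "V v p' = v # map (\<lambda>e. snd (snd e)) p'" by (rule first[OF cas2])
    have v1: "v \<in> set (V a p1)" by (rule V_last[OF cas1])
    have d1: "distinct (V a p1)" and d2: "distinct (V v p')"
      using dist v1 unfolding Vsplit V2 by auto
    have sub2: "set (V v p') \<subseteq> set (V a \<Gamma>)" using v1 unfolding Vsplit V2 by auto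
    obtain \<eta>1 where 1: "single_lift \<eta>1 p1" "\<eta>1 1 = v" "\<eta>1 0 = fst e"
      using single_lift_last[of a p e v] cas1 d1 arcs uniq v(2) Vsplit
      unfolding p1_def V_def \<Gamma>(1) by auto
    obtain \<eta>2 where 2: "single_lift \<eta>2 p'" "\<eta>2 1 = v" "\<eta>2 0 = snd (snd e')"
      using single_lift_first[of v e' p2 b] cas2 d2 arcs uniq v(2) sub2
      unfolding p' V_def \<Gamma>(1) by auto
    have "fst e \<in> set (V a p1)"
      unfolding p1_def V_def by (simp add: pre_digraph.awalk_verts_conv)
    \<comment> \<open>Both lifts end at \<open>v\<close>, so they are told apart at their white
      ends, the two neighbours of \<open>v\<close> on a path without repetitions.\<close>
    then have "\<eta>1 0 \<noteq> \<eta>2 0"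
      using dist 1(3) 2(3) unfolding Vsplit p' by auto
    then show ?thesis
      using common_right_factor[OF mom cas1 _ 1(1) cas2 _ 2(1) ma _ mb, of 0] arcs v(2) Pab s
      by (auto simp: \<Gamma>(1) p1_def)
  next
    case ends
    have Pab: "poly P a = cs s" "poly P b = cs s" using ends by auto
    have uniq: "z = a \<or> z = b" if "z \<in> set (V a \<Gamma>)" "poly P z = cs s" for z using ends that by auto
    obtain e p where \<Gamma>: "\<Gamma> = e # p"
      using cas assms(3) by (cases \<Gamma>) (auto simp: pre_digraph.cas.simps)
    \<comment> \<open>Without an inner vertex of colour \<open>s\<close> the path is split at the
      white neighbour of \<open>a\<close>. The lifts are then told apart at parameter 1, where they
      reach \<open>a\<close> and \<open>b\<close>.\<close>
    define v where "v = snd (snd e)"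
    have ea: "fst e = a" and cas2: "pre_digraph.cas G v p b"
      using cas by (auto simp: \<Gamma> v_def pre_digraph.cas.simps)
    have cas1: "pre_digraph.cas G a [e] v" by (simp add: ea v_def pre_digraph.cas.simps)
    obtain r \<eta> where re: "star_edge r \<eta> e" using arcs arcs_cactus by (auto simp: \<Gamma>)
    then have Pv: "poly P v = c"
      using star_edge_coloured(1)[OF re s] star_edge_ends(1)[OF re] ea Pab by (simp add: v_def)
    then have vs: "poly P v \<noteq> cs s" using centre_neq_tip[OF s] by simp
    obtain e' p' where p: "p = p' @ [e']"
      using cas2 vs Pab(2) by (cases p rule: rev_cases) (auto simp: pre_digraph.cas.simps)
    have VG: "V a \<Gamma> = a # V v p" by (simp add: \<Gamma> V_cons ea v_def)
    have V1: "V a [e] = [a, v]" by (simp add: V_cons V_nil ea v_def)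
    have "v \<in> set (V v p)" using first[OF cas2] by simp
    then have d1: "distinct (V a [e])" and d2: "distinct (V v p)"
      using dist unfolding VG V1 by auto
    have u1: "z = a" if "z \<in> set (V a [e])" "poly P z = cs s" for z
      using that vs by (auto simp: V1)
    have u2: "z = b" if "z \<in> set (V v p)" "poly P z = cs s" for z
      using uniq[of z] that dist by (auto simp: VG)
    obtain \<eta>1 where 1: "single_lift \<eta>1 [e]" "\<eta>1 1 = a"
      using single_lift_first[of a e "[]" v] cas1 d1 arcs u1 Pab unfolding V_def \<Gamma> by auto
    obtain \<eta>2 where 2: "single_lift \<eta>2 p" "\<eta>2 1 = b"
      using single_lift_last[of v p' e' b] cas2 d2 arcs u2 Pab unfolding V_def \<Gamma> p by auto
    show ?thesis
      using common_right_factor[OF mom cas1 _ 1(1) cas2 _ 2(1) ma _ mb, of 1] arcs vs Pv Pab s 1(2) 2(2) assms(3)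
      by (auto simp: \<Gamma>)
  qed
qed

end
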